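(* Fix a constant $\overline{\gamma}<1/2$. Let $A\in\mathbb{Q}^{n\times n}$ be nonsingular with $\|A^{-1}\|_1\le\overline{\gamma}$, let $b\in\mathbb{Q}^n$, write $A=\bar A/d_A$, $b=\bar b/d_b$ with $\bar A\in\mathbb{Z}^{n\times n}$, $\bar b\in\mathbb{Z}^n$, $d_A,d_b\in\mathbb{Z}_{>0}$, and let $L=\max\{d_b,d_A,\|\bar b\|_\infty,\|\bar A\|_{\max}\}$. Then, for any initial sign vector, the sign-flip algorithm equipped with the $c(n)$-capture rule finds a global maximizer $z^*$ of the problem $\max_{z\in\{-1,1\}^n}F(z)$, where $F(z)=z^T(A-\operatorname{Diag}(z))^{-1}b$, in polynomial time. Moreover, the maximum number $T$ of iterations satisfies $$T=\mathcal{O}\!\left(\frac{n}{c(n)}\log(nL)\right).$$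
   Context: $\|\cdot\|_1$ for matrices is the maximum absolute column sum; $\|\cdot\|_\infty$ for vectors is the maximum absolute entry; $\|X\|_{\max}=\max_{i,j}|X_{ij}|$. For $z\in\{-1,1\}^n$, $\operatorname{Diag}(z)$ is the diagonal matrix with diagonal $z$, and we write $Z=\operatorname{Diag}(z)$; $A-Z$ is nonsingular for all such $z$ under the stated condition. Sign-flip algorithm for the absolute value equation $Ax-|x|=b$ (with $|x|$ taken componentwise): initialize $z\in\{-1,1\}^n$; compute $x=(A-Z)^{-1}b$ and the mismatch set $\mathcal{V}_z=\{i\in[n]: z_ix_i<0\}$, where $[n]=\{1,\dots,n\}$. While $\mathcal{V}_z\neq\emptyset$: select a nonempty subset $S\subseteq\mathcal{V}_z$ by some rule; replace $z_i$ by $-z_i$ for $i\in S$; recompute $Z$, $x=(A-Z)^{-1}b$ and $\mathcal{V}_z$. When $\mathcal{V}_z=\emptyset$, return $x$. One pass through the while loop is one iteration. $c(n)$-capture rule: at each iteration $S\subseteq\mathcal{V}_z$ satisfies $\sum_{i\in S}|x_i|\ge c(n)\sum_{i\in\mathcal{V}_z}|x_i|$, where $c(n)\in(0,1]$ may depend on $n$ but not on the iteration index. The constant $\overline{\gamma}$ is given and fixed; the constant implied by $\mathcal{O}$ may depend on it.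
   Formalization: "Polynomial time" is read as bit cost polynomial in the input length and 1/c(n), not counting the cost of evaluating the unspecified selection rule; for exponentially small c(n), such as 9^{-n}, the algorithm can need 2^n-1 iterations, so the unqualified claim fails. *)

theory Defs
  imports
    Complex_Main
    "HOL-Library.Log_Nat"
    "HOL-Computational_Algebra.Polynomial"
    "Jordan_Normal_Form.Gauss_Jordan_Elimination"
begin

section \<open>Norms\<close>

text \<open>Indices run over \<open>0, \<dots>, n - 1\<close>.  The maxima below are meant for \<open>n \<ge> 1\<close>.\<close>

definition norm_1 :: "'a :: linordered_idom mat \<Rightarrow> 'a" where
  "norm_1 M = Max ((\<lambda>j. \<Sum>i<dim_row M. \<bar>M $$ (i, j)\<bar>) ` {..<dim_col M})"

definition norm_inf :: "'a :: linordered_idom vec \<Rightarrow> 'a" where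
  "norm_inf v = Max ((\<lambda>i. \<bar>v $ i\<bar>) ` {..<dim_vec v})"

definition norm_max :: "'a :: linordered_idom mat \<Rightarrow> 'a" where
  "norm_max M = Max ((\<lambda>(i, j). \<bar>M $$ (i, j)\<bar>) ` ({..<dim_row M} \<times> {..<dim_col M}))"


section \<open>The sign-flip algorithm\<close>

text \<open>Only meaningful for invertible matrices (\<open>mat_inverse\<close> returns \<open>None\<close> otherwise).\<close>

definition matinv :: "rat mat \<Rightarrow> rat mat" where
  "matinv M = the (mat_inverse M)"

definition sign_vecs :: "nat \<Rightarrow> rat vec set" where
  "sign_vecs n = {z \<in> carrier_vec n. \<forall>i<n. z $ i \<in> {-1, 1}}"

definition Diag :: "rat vec \<Rightarrow> rat mat" where
  "Diag z = mat_diag (dim_vec z) (\<lambda>i. z $ i)"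

definition x_of :: "rat mat \<Rightarrow> rat vec \<Rightarrow> rat vec \<Rightarrow> rat vec" where
  "x_of A b z = matinv (A - Diag z) *\<^sub>v b"

definition F :: "rat mat \<Rightarrow> rat vec \<Rightarrow> rat vec \<Rightarrow> rat" where
  "F A b z = z \<bullet> (matinv (A - Diag z) *\<^sub>v b)"

definition mismatch :: "rat mat \<Rightarrow> rat vec \<Rightarrow> rat vec \<Rightarrow> nat set" where
  "mismatch A b z = {i. i < dim_vec z \<and> z $ i * x_of A b z $ i < 0}"

definition flip :: "nat set \<Rightarrow> rat vec \<Rightarrow> rat vec" where
  "flip S z = vec (dim_vec z) (\<lambda>i. if i \<in> S then - (z $ i) else z $ i)"

text \<open>
  For a fixed instance, a run of the algorithm is determined by the initial sign vector and by the
  sequence \<open>S 0, S 1, \<dots>\<close> of sets picked by the selection rule in the successive iterations.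
  Quantifying over all such sequences covers every rule, including rules that depend on the
  instance and on the whole history.  \<open>sign_after A b z0 S k\<close> is the sign vector after \<open>k\<close>
  iterations; it no longer changes once the while loop has been left.
\<close>

primrec sign_after :: "rat mat \<Rightarrow> rat vec \<Rightarrow> rat vec \<Rightarrow> (nat \<Rightarrow> nat set) \<Rightarrow> nat \<Rightarrow> rat vec" where
  "sign_after A b z0 S 0 = z0"
| "sign_after A b z0 S (Suc k) =
    (let z = sign_after A b z0 S k in if mismatch A b z = {} then z else flip (S k) z)"

text \<open>The \<open>c(n)\<close>-capture rule, for a single choice and for a whole run.\<close>

definition capture_choice :: "real \<Rightarrow> rat mat \<Rightarrow> rat vec \<Rightarrow> rat vec \<Rightarrow> nat set \<Rightarrow> bool" where
  "capture_choice \<kappa> A b z S \<longleftrightarrow>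
     S \<noteq> {} \<and> S \<subseteq> mismatch A b z \<and>
     (\<Sum>i\<in>S. real_of_rat \<bar>x_of A b z $ i\<bar>)
       \<ge> \<kappa> * (\<Sum>i\<in>mismatch A b z. real_of_rat \<bar>x_of A b z $ i\<bar>)"

definition capture_run :: "real \<Rightarrow> rat mat \<Rightarrow> rat vec \<Rightarrow> rat vec \<Rightarrow> (nat \<Rightarrow> nat set) \<Rightarrow> bool" where
  "capture_run \<kappa> A b z0 S \<longleftrightarrow>
     (\<forall>k. mismatch A b (sign_after A b z0 S k) \<noteq> {} \<longrightarrow>
          capture_choice \<kappa> A b (sign_after A b z0 S k) (S k))"

text \<open>The run terminates, after exactly \<open>T\<close> iterations.\<close>

definition stops_after :: "rat mat \<Rightarrow> rat vec \<Rightarrow> rat vec \<Rightarrow> (nat \<Rightarrow> nat set) \<Rightarrow> nat \<Rightarrow> bool" where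
  "stops_after A b z0 S T \<longleftrightarrow>
     mismatch A b (sign_after A b z0 S T) = {} \<and>
     (\<forall>k<T. mismatch A b (sign_after A b z0 S k) \<noteq> {})"

definition global_maximizer :: "nat \<Rightarrow> rat mat \<Rightarrow> rat vec \<Rightarrow> rat vec \<Rightarrow> bool" where
  "global_maximizer n A b z \<longleftrightarrow> z \<in> sign_vecs n \<and> (\<forall>y \<in> sign_vecs n. F A b y \<le> F A b z)"


section \<open>Integer data\<close>

definition integer_data ::
  "nat \<Rightarrow> rat mat \<Rightarrow> rat vec \<Rightarrow> int mat \<Rightarrow> int vec \<Rightarrow> int \<Rightarrow> int \<Rightarrow> bool" where
  "integer_data n A b Abar bbar dA db \<longleftrightarrow>
     Abar \<in> carrier_mat n n \<and> bbar \<in> carrier_vec n \<and> dA > 0 \<and> db > 0 \<and>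
     A = (1 / of_int dA) \<cdot>\<^sub>m map_mat of_int Abar \<and>
     b = (1 / of_int db) \<cdot>\<^sub>v map_vec of_int bbar"

definition data_bound :: "int mat \<Rightarrow> int vec \<Rightarrow> int \<Rightarrow> int \<Rightarrow> int" where
  "data_bound Abar bbar dA db = Max {db, dA, norm_inf bbar, norm_max Abar}"


section \<open>Running time\<close>

text \<open>
  Running time is measured on a random access machine over the integers with structured control
  flow and logarithmic (bit) cost, which is polynomially equivalent to the Turing machine model.
  A memory cell is addressed by a name and two integers; every memory access is charged the bit
  lengths of the indices and of the value, every arithmetic operation the bit lengths of its
  operands (their product for multiplication and division).
\<close>

type_synonym loc = "string \<times> int \<times> int"
type_synonym store = "loc \<Rightarrow> int"

datatype aexp =
    Const int
  | Cell string aexp aexp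
  | Plus aexp aexp
  | Minus aexp aexp
  | Times aexp aexp
  | Div aexp aexp

datatype com =
    Skip
  | Assign string aexp aexp aexp  \<comment> \<open>cell name, two indices, new value\<close>
  | Seq com com
  | IfPos aexp com com            \<comment> \<open>tests whether the value is positive\<close>
  | WhilePos aexp com

text \<open>Binary length plus sign bit; at least 1.\<close>

definition bits :: "int \<Rightarrow> nat" where
  "bits k = Suc (floorlog 2 (nat \<bar>k\<bar>))"

primrec aval :: "aexp \<Rightarrow> store \<Rightarrow> int" where
  "aval (Const k) s = k"
| "aval (Cell x e1 e2) s = s (x, aval e1 s, aval e2 s)"
| "aval (Plus e1 e2) s = aval e1 s + aval e2 s"
| "aval (Minus e1 e2) s = aval e1 s - aval e2 s"
| "aval (Times e1 e2) s = aval e1 s * aval e2 s"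
| "aval (Div e1 e2) s = aval e1 s div aval e2 s"

primrec acost :: "aexp \<Rightarrow> store \<Rightarrow> nat" where
  "acost (Const k) s = bits k"
| "acost (Cell x e1 e2) s = acost e1 s + acost e2 s +
     bits (aval e1 s) + bits (aval e2 s) + bits (aval (Cell x e1 e2) s)"
| "acost (Plus e1 e2) s = acost e1 s + acost e2 s + bits (aval e1 s) + bits (aval e2 s)"
| "acost (Minus e1 e2) s = acost e1 s + acost e2 s + bits (aval e1 s) + bits (aval e2 s)"
| "acost (Times e1 e2) s = acost e1 s + acost e2 s + bits (aval e1 s) * bits (aval e2 s)"
| "acost (Div e1 e2) s = acost e1 s + acost e2 s + bits (aval e1 s) * bits (aval e2 s)"

text \<open>\<open>exec P s t s'\<close>: started in store \<open>s\<close>, program \<open>P\<close> halts in store \<open>s'\<close> at cost \<open>t\<close>.\<close>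

inductive exec :: "com \<Rightarrow> store \<Rightarrow> nat \<Rightarrow> store \<Rightarrow> bool" where
  exec_Skip: "exec Skip s 1 s"
| exec_Assign: "exec (Assign x e1 e2 e) s
     (acost e1 s + acost e2 s + acost e s + bits (aval e1 s) + bits (aval e2 s) + bits (aval e s))
     (s((x, aval e1 s, aval e2 s) := aval e s))"
| exec_Seq: "exec P s t s' \<Longrightarrow> exec Q s' t' s'' \<Longrightarrow> exec (Seq P Q) s (t + t') s''"
| exec_IfTrue: "aval e s > 0 \<Longrightarrow> exec P s t s' \<Longrightarrow> exec (IfPos e P Q) s (acost e s + t + 1) s'"
| exec_IfFalse: "\<not> aval e s > 0 \<Longrightarrow> exec Q s t s' \<Longrightarrow> exec (IfPos e P Q) s (acost e s + t + 1) s'"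
| exec_WhileFalse: "\<not> aval e s > 0 \<Longrightarrow> exec (WhilePos e P) s (acost e s + 1) s"
| exec_WhileTrue: "aval e s > 0 \<Longrightarrow> exec P s t s' \<Longrightarrow> exec (WhilePos e P) s' t' s'' \<Longrightarrow>
     exec (WhilePos e P) s (acost e s + t + t' + 1) s''"

text \<open>
  The input of a run: the dimension, the integer data and the initial sign vector.  The selection
  rule is unspecified, so its own running time is not accounted for: its answers are supplied in
  the cells \<open>''S''\<close> (cell \<open>k, i\<close> tells whether \<open>i\<close> is in the set selected in iteration \<open>k\<close>), and
  the program is charged for reading them.  All other cells are initially zero.
\<close>

definition input_store ::
  "nat \<Rightarrow> int mat \<Rightarrow> int vec \<Rightarrow> int \<Rightarrow> int \<Rightarrow> rat vec \<Rightarrow> (nat \<Rightarrow> nat set) \<Rightarrow> store" where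
  "input_store n Abar bbar dA db z0 S = (\<lambda>(x, i, j).
     if x = ''n'' \<and> i = 0 \<and> j = 0 then int n
     else if x = ''dA'' \<and> i = 0 \<and> j = 0 then dA
     else if x = ''db'' \<and> i = 0 \<and> j = 0 then db
     else if x = ''A'' \<and> 0 \<le> i \<and> i < int n \<and> 0 \<le> j \<and> j < int n then Abar $$ (nat i, nat j)
     else if x = ''b'' \<and> 0 \<le> i \<and> i < int n \<and> j = 0 then bbar $ nat i
     else if x = ''z'' \<and> 0 \<le> i \<and> i < int n \<and> j = 0 then \<lfloor>z0 $ nat i\<rfloor>
     else if x = ''S'' \<and> 0 \<le> i \<and> 0 \<le> j \<and> j < int n then (if nat j \<in> S (nat i) then 1 else 0)
     else 0)"

text \<open>Total binary length of the input; each of the \<open>n\<close> entries of \<open>z0\<close> counts one bit.\<close>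

definition input_size :: "nat \<Rightarrow> int mat \<Rightarrow> int vec \<Rightarrow> int \<Rightarrow> int \<Rightarrow> nat" where
  "input_size n Abar bbar dA db =
     bits (int n) + bits dA + bits db + (\<Sum>i<n. \<Sum>j<n. bits (Abar $$ (i, j))) +
     (\<Sum>i<n. bits (bbar $ i)) + n"

text \<open>
  The final store exhibits the complete run: the number of iterations \<open>T\<close>, and for every
  \<open>k \<le> T\<close> the sign vector \<open>z\<close> and the vector \<open>x = (A - Diag z)\<^sup>-\<^sup>1 b\<close> after \<open>k\<close> iterations, the
  latter with numerators in \<open>''X''\<close> and a common denominator in \<open>''D''\<close>.  Thus the program has to
  carry out the sign-flip algorithm itself, with the given choices of the rule.
\<close>

definition computes_run ::
  "nat \<Rightarrow> rat mat \<Rightarrow> rat vec \<Rightarrow> rat vec \<Rightarrow> (nat \<Rightarrow> nat set) \<Rightarrow> nat \<Rightarrow> store \<Rightarrow> bool" where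
  "computes_run n A b z0 S T s \<longleftrightarrow>
     s (''T'', 0, 0) = int T \<and>
     (\<forall>k\<le>T. s (''D'', int k, 0) \<noteq> 0 \<and>
       (\<forall>i<n. of_int (s (''Z'', int k, int i)) = sign_after A b z0 S k $ i \<and>
              of_int (s (''X'', int k, int i)) / of_int (s (''D'', int k, 0)) =
                x_of A b (sign_after A b z0 S k) $ i))"

end

theory Submission
  imports Defs "Jordan_Normal_Form.Char_Poly"
begin

text \<open>
  Flipping \<open>z\<close> to \<open>y\<close> changes \<open>F\<close> by \<open>2 (y \<bullet> w + \<Sum> v)\<close>, where \<open>v\<^sub>i = - z\<^sub>i x\<^sub>i\<close> on the flipped
  indices and \<open>(A - Diag y) w = v\<close>.  As \<open>g = \<parallel>A\<^sup>-\<^sup>1\<parallel>\<^sub>1 < 1/2\<close>, the \<open>1\<close>-norm of \<open>w\<close> is at most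
  \<open>g / (1 - g) < 1\<close> times that of \<open>v\<close>.  Hence the gap \<open>F y - F z\<close> to any \<open>y\<close> is at most a multiple of
  the total mismatch \<open>\<Sum>i\<in>V. \<bar>x\<^sub>i\<bar>\<close>, a capturing flip gains a multiple of it, and every iteration
  shrinks the gap by the factor \<open>1 - c (1 - 2 g)\<close>.  A nonzero \<open>x\<^sub>i\<close> is at least the reciprocal of the
  common denominator, so the mismatch set is empty after \<open>O(n / c log (n L))\<close> iterations.

  Each linear system is solved over the integers by the Faddeev--LeVerrier recursion, which needs no
  pivoting and whose intermediate values are coefficients of the characteristic polynomial and of
  the adjugate of \<open>x I - M\<close>; these have polynomially many bits by a direct estimate of the recursion.
\<close>

section \<open>Contraction of the optimality gap\<close>

text \<open>\<open>run_bound\<close> does not compare with a global maximizer. The contraction holds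
  for every fixed target \<open>y\<close>, even where the gap to it is negative, so \<open>y\<close>
  is picked with hindsight: all mismatches of the \<open>k\<close>-th iterate flipped. That gap is
  at least a multiple of one nonzero entry of the current solution. Optimality is a separate
  consequence of an empty mismatch set. The iteration bound has no additive term, so a vanishing
  \<open>ln (n L)\<close> would demand zero iterations. The norm bound itself excludes
  \<open>n L = 1\<close> (\<open>n_data_bound_ge_2\<close>); hence \<open>n ln (n L)\<close> is at
  least 1/2 and absorbs both the logarithm of \<open>\<delta>\<close> and the last iteration. On the
  machine side, the outer loop is the only one whose number of passes is not bounded by
  \<open>n\<close>. Cost is therefore split into a count \<open>fsteps\<close>, which depends on
  program and dimension alone, and one bit bound \<open>W\<close> valid throughout the run. A new
  pass meets whatever its predecessor left in the work cells, so each specification has to allow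
  arbitrary stale contents there.\<close>

definition l1 :: "rat vec \<Rightarrow> rat" where
  "l1 v = (\<Sum>i<dim_vec v. \<bar>v $ i\<bar>)"

lemma l1_eq: "v \<in> carrier_vec n \<Longrightarrow> l1 v = (\<Sum>i<n. \<bar>v $ i\<bar>)"
  by (simp add: l1_def carrier_vecD)

lemma mult_mat_vec_index:
  assumes "M \<in> carrier_mat n n" "v \<in> carrier_vec n" "i < n"
  shows "(M *\<^sub>v v) $ i = (\<Sum>j<n. M $$ (i, j) * v $ j)"
  using assms by (simp add: scalar_prod_def lessThan_atLeast0)

text \<open>The maximal column sum is the operator norm belonging to \<open>l1\<close>: after
  exchanging the sums, entry \<open>j\<close> of the vector is weighted by column
  \<open>j\<close>.\<close>

lemma l1_mult_mat_vec:
  assumes M: "M \<in> carrier_mat n n" and v: "v \<in> carrier_vec n"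
  shows "l1 (M *\<^sub>v v) \<le> norm_1 M * l1 v"
proof -
  have col: "(\<Sum>i<n. \<bar>M $$ (i, j)\<bar>) \<le> norm_1 M" if "j < n" for j
    unfolding norm_1_def using M that by (intro Max_ge) auto
  have "l1 (M *\<^sub>v v) = (\<Sum>i<n. \<bar>\<Sum>j<n. M $$ (i, j) * v $ j\<bar>)"
    using l1_eq[OF mult_mat_vec_carrier[OF M v]] mult_mat_vec_index[OF M v] by simp
  also have "\<dots> \<le> (\<Sum>i<n. \<Sum>j<n. \<bar>M $$ (i, j)\<bar> * \<bar>v $ j\<bar>)"
    by (intro sum_mono order_trans[OF sum_abs]) (simp add: abs_mult)
  also have "\<dots> = (\<Sum>j<n. (\<Sum>i<n. \<bar>M $$ (i, j)\<bar>) * \<bar>v $ j\<bar>)"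
    by (subst sum.swap) (simp add: sum_distrib_right)
  also have "\<dots> \<le> (\<Sum>j<n. norm_1 M * \<bar>v $ j\<bar>)"
    by (intro sum_mono mult_right_mono col) auto
  also have "\<dots> = norm_1 M * l1 v" by (simp add: l1_eq[OF v] sum_distrib_left)
  finally show ?thesis .
qed

section \<open>Inverse matrices, sign vectors and flips\<close>

lemma invertible_mat_det:
  fixes A :: "rat mat"
  assumes A: "A \<in> carrier_mat n n" and inv: "invertible_mat A"
  shows "det A \<noteq> 0"
proof -
  obtain B where B: "A * B = 1\<^sub>m n" "B * A = 1\<^sub>m (dim_row B)"
    using A inv by (auto simp: invertible_mat_def inverts_mat_def)
  \<comment> \<open>The shape of \<open>B\<close> is not given; its column and row counts are read
    off the two products.\<close>
  have "B \<in> carrier_mat n n"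
    using arg_cong[OF B(1), of dim_col] arg_cong[OF B(2), of dim_col] A by auto
  then have "det A * det B = 1" using B(1) det_mult[OF A] by (metis det_one)
  then show ?thesis by auto
qed

lemma matinv_inverse:
  assumes A: "A \<in> carrier_mat n n" and "det A \<noteq> 0"
  shows "matinv A \<in> carrier_mat n n" "A * matinv A = 1\<^sub>m n" "matinv A * A = 1\<^sub>m n"
proof -
  obtain B where "mat_inverse A = Some B"
    using mat_inverse(1)[OF A, of "()"] det_non_zero_imp_unit[OF assms, of "()"] by (cases "mat_inverse A") auto
  then show "matinv A \<in> carrier_mat n n" "A * matinv A = 1\<^sub>m n" "matinv A * A = 1\<^sub>m n"
    using mat_inverse(2)[OF A] by (auto simp: matinv_def)
qed

lemma sign_vecsD:
  assumes "z \<in> sign_vecs n"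
  shows "z \<in> carrier_vec n" "i < n \<Longrightarrow> z $ i = -1 \<or> z $ i = 1" "dim_vec z = n"
  using assms by (auto simp: sign_vecs_def)

lemma Diag_carrier: "z \<in> sign_vecs n \<Longrightarrow> Diag z \<in> carrier_mat n n"
  by (simp add: Diag_def sign_vecsD)

lemma minus_Diag_mult_index:
  assumes A: "A \<in> carrier_mat n n" and z: "z \<in> sign_vecs n" and w: "w \<in> carrier_vec n" and i: "i < n"
  shows "((A - Diag z) *\<^sub>v w) $ i = (A *\<^sub>v w) $ i - z $ i * w $ i"
proof -
  have "((A - Diag z) *\<^sub>v w) $ i = (\<Sum>j<n. A $$ (i, j) * w $ j - (if i = j then z $ j * w $ j else 0))"
    using assms sign_vecsD[OF z] Diag_carrier[OF z]
    by (subst mult_mat_vec_index[of _ n])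
       (auto simp: Diag_def mat_diag_def left_diff_distrib intro!: sum.cong)
  then show ?thesis using i by (simp add: mult_mat_vec_index[OF A w] sum_subtractf)
qed

lemma floor_sign:
  assumes "z \<in> sign_vecs n" "i < n"
  shows "of_int \<lfloor>z $ i\<rfloor> = z $ i" "\<bar>\<lfloor>z $ i\<rfloor>\<bar> = 1"
proof -
  have "z $ i = of_int (- 1) \<or> z $ i = of_int 1" using sign_vecsD(2)[OF assms] by simp
  then obtain m where "z $ i = of_int m" "m = - 1 \<or> m = 1" by blast
  then show "of_int \<lfloor>z $ i\<rfloor> = z $ i" "\<bar>\<lfloor>z $ i\<rfloor>\<bar> = 1" by auto
qed

lemma flip_sign_vecs: "z \<in> sign_vecs n \<Longrightarrow> flip S z \<in> sign_vecs n"
  unfolding flip_def sign_vecs_def by fastforce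

lemma sign_after_sign_vecs: "z0 \<in> sign_vecs n \<Longrightarrow> sign_after A b z0 S k \<in> sign_vecs n"
  by (induction k) (auto simp: Let_def flip_sign_vecs)

section \<open>Values of \<open>F\<close> at two sign vectors, and the gap along a run\<close>

locale ave =
  fixes n :: nat and A :: "rat mat" and b :: "rat vec" and g :: rat
  assumes A: "A \<in> carrier_mat n n" and det: "det A \<noteq> 0" and b: "b \<in> carrier_vec n"
    and g: "norm_1 (matinv A) \<le> g" "0 \<le> g" "g < 1 / 2"
begin

text \<open>Apply the inverse of \<open>A\<close> to \<open>A w = (A - Diag z) w + Diag z w\<close>.
  Since \<open>Diag z\<close> preserves the 1-norm, the term \<open>g * l1 w\<close> can be moved to
  the left. No inverse of \<open>A - Diag z\<close> occurs, so the estimate also yields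
  nonsingularity in \<open>det_minus_Diag\<close>.\<close>

lemma solution_bound:
  assumes z: "z \<in> sign_vecs n" and w: "w \<in> carrier_vec n"
  shows "(1 - g) * l1 w \<le> g * l1 ((A - Diag z) *\<^sub>v w)"
proof -
  have C: "A - Diag z \<in> carrier_mat n n" using A Diag_carrier[OF z] by (intro minus_carrier_mat)
  let ?v = "(A - Diag z) *\<^sub>v w"
  have v: "?v \<in> carrier_vec n" using C w by (rule mult_mat_vec_carrier)
  have u: "A *\<^sub>v w \<in> carrier_vec n" using A w by (rule mult_mat_vec_carrier)
  have "matinv A *\<^sub>v (A *\<^sub>v w) = w"
    unfolding assoc_mult_mat_vec[OF matinv_inverse(1)[OF A det] A w, symmetric] matinv_inverse(3)[OF A det]
    using w by simp
  then have "l1 w \<le> norm_1 (matinv A) * l1 (A *\<^sub>v w)"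
    using l1_mult_mat_vec[OF matinv_inverse(1)[OF A det] u] by simp
  also have "\<dots> \<le> g * l1 (A *\<^sub>v w)"
    using g by (intro mult_right_mono) (auto simp: l1_def intro: sum_nonneg)
  also have "l1 (A *\<^sub>v w) \<le> l1 ?v + l1 w"
    unfolding l1_eq[OF u] l1_eq[OF v] l1_eq[OF w] sum.distrib[symmetric]
  proof (rule sum_mono)
    fix i assume i: "i \<in> {..<n}"
    have "\<bar>z $ i\<bar> = 1" using sign_vecsD(2)[OF z, of i] i by auto
    then show "\<bar>(A *\<^sub>v w) $ i\<bar> \<le> \<bar>?v $ i\<bar> + \<bar>w $ i\<bar>"
      using minus_Diag_mult_index[OF A z w, of i] i abs_mult[of "z $ i" "w $ i"]
        abs_triangle_ineq[of "?v $ i" "z $ i * w $ i"] by simp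
  qed
  finally have "l1 w \<le> g * (l1 ?v + l1 w)" using g by (simp add: mult_left_mono)
  then show ?thesis by (simp add: algebra_simps)
qed

lemma det_minus_Diag:
  assumes z: "z \<in> sign_vecs n"
  shows "det (A - Diag z) \<noteq> 0"
proof
  have C: "A - Diag z \<in> carrier_mat n n" using A Diag_carrier[OF z] by (intro minus_carrier_mat)
  assume "det (A - Diag z) = 0"
  then obtain w where w: "w \<in> carrier_vec n" "w \<noteq> 0\<^sub>v n" "(A - Diag z) *\<^sub>v w = 0\<^sub>v n"
    using det_0_iff_vec_prod_zero_field[OF C] by auto
  have "(1 - g) * l1 w \<le> 0"
    using solution_bound[OF z w(1)] w(3) by (simp add: l1_def)
  then have "l1 w \<le> 0" using g by (simp add: mult_le_0_iff)
  moreover have "0 \<le> l1 w" by (simp add: l1_def sum_nonneg)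
  ultimately have "(\<Sum>i<n. \<bar>w $ i\<bar>) = 0" using l1_eq[OF w(1)] by linarith
  then have "w = 0\<^sub>v n" using w(1) by (intro eq_vecI) (auto simp: sum_nonneg_eq_0_iff)
  with w show False by simp
qed

lemma x_of_solves:
  assumes z: "z \<in> sign_vecs n"
  shows "x_of A b z \<in> carrier_vec n" "(A - Diag z) *\<^sub>v x_of A b z = b"
proof -
  have C: "A - Diag z \<in> carrier_mat n n" using A Diag_carrier[OF z] by (intro minus_carrier_mat)
  note I = matinv_inverse[OF C det_minus_Diag[OF z]]
  show "x_of A b z \<in> carrier_vec n" unfolding x_of_def using I(1) b by (rule mult_mat_vec_carrier)
  show "(A - Diag z) *\<^sub>v x_of A b z = b"
    unfolding x_of_def assoc_mult_mat_vec[OF C I(1) b, symmetric] I(2) using b by simp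
qed

lemma x_of_unique:
  assumes z: "z \<in> sign_vecs n" and x: "x \<in> carrier_vec n" "(A - Diag z) *\<^sub>v x = b"
  shows "x_of A b z = x"
proof -
  have C: "A - Diag z \<in> carrier_mat n n" using A Diag_carrier[OF z] by (intro minus_carrier_mat)
  note I = matinv_inverse[OF C det_minus_Diag[OF z]]
  show ?thesis
    unfolding x_of_def x(2)[symmetric] assoc_mult_mat_vec[OF I(1) C x(1), symmetric] I(3)
    using x(1) by simp
qed

lemma F_eq:
  assumes z: "z \<in> sign_vecs n"
  shows "F A b z = (\<Sum>i<n. z $ i * x_of A b z $ i)"
  using x_of_solves(1)[OF z]
  by (auto simp: F_def x_of_def[symmetric] scalar_prod_def lessThan_atLeast0)

lemma abs_sum_sign_le_l1:
  assumes y: "y \<in> sign_vecs n" and w: "w \<in> carrier_vec n"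
  shows "\<bar>\<Sum>i<n. y $ i * w $ i\<bar> \<le> l1 w"
proof -
  have "\<bar>\<Sum>i<n. y $ i * w $ i\<bar> \<le> (\<Sum>i<n. \<bar>y $ i * w $ i\<bar>)" by (rule sum_abs)
  also have "\<dots> = l1 w"
    unfolding l1_eq[OF w] abs_mult using sign_vecsD(2)[OF y] by (intro sum.cong) force+
  finally show ?thesis .
qed

lemma F_bound:
  assumes z: "z \<in> sign_vecs n"
  shows "(1 - g) * \<bar>F A b z\<bar> \<le> g * l1 b"
proof -
  have "(1 - g) * \<bar>F A b z\<bar> \<le> (1 - g) * l1 (x_of A b z)"
    unfolding F_eq[OF z] using abs_sum_sign_le_l1[OF z x_of_solves(1)[OF z]] g
    by (intro mult_left_mono) auto
  also have "\<dots> \<le> g * l1 b"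
    using solution_bound[OF z x_of_solves(1)[OF z]] x_of_solves(2)[OF z] by simp
  finally show ?thesis .
qed

lemma F_diff:
  assumes y: "y \<in> sign_vecs n" and z: "z \<in> sign_vecs n"
  defines "v \<equiv> \<lambda>i. if y $ i = z $ i then 0 else - (z $ i * x_of A b z $ i)"
  shows "(1 - g) * \<bar>F A b y - F A b z - 2 * (\<Sum>i<n. v i)\<bar> \<le> 2 * g * (\<Sum>i<n. \<bar>v i\<bar>)"
proof -
  let ?x = "x_of A b z" and ?x' = "x_of A b y"
  note x = x_of_solves[OF z] and x' = x_of_solves[OF y]
  \<comment> \<open>This is twice the \<open>w\<close> of the overview: the old solution has
    residual \<open>2 v\<close> in the new system.\<close>
  define w where "w = ?x' - ?x"
  have w: "w \<in> carrier_vec n" using x x' by (simp add: w_def)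
  have C: "A - Diag y \<in> carrier_mat n n" using A Diag_carrier[OF y] by (intro minus_carrier_mat)
  have v: "(y $ i - z $ i) * ?x $ i = 2 * v i" if "i < n" for i
    using sign_vecsD(2)[OF y that] sign_vecsD(2)[OF z that] by (auto simp: v_def)
  have "((A - Diag y) *\<^sub>v w) $ i = 2 * v i" if i: "i < n" for i
  proof -
    have "((A - Diag y) *\<^sub>v w) $ i = b $ i - ((A - Diag y) *\<^sub>v ?x) $ i"
      unfolding w_def mult_minus_distrib_mat_vec[OF C x'(1) x(1)] x'(2)
      using i C x(1) by (intro index_minus_vec) (metis carrier_matD(1) dim_mult_mat_vec)
    also have "\<dots> = ((A - Diag z) *\<^sub>v ?x) $ i - ((A - Diag y) *\<^sub>v ?x) $ i" using x(2) by simp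
    also have "\<dots> = (y $ i - z $ i) * ?x $ i"
      by (simp add: minus_Diag_mult_index[OF A _ x(1) i] y z left_diff_distrib)
    finally show ?thesis using v[OF i] by simp
  qed
  then have "l1 ((A - Diag y) *\<^sub>v w) = 2 * (\<Sum>i<n. \<bar>v i\<bar>)"
    unfolding l1_eq[OF mult_mat_vec_carrier[OF C w]] sum_distrib_left by (intro sum.cong) auto
  then have lw: "(1 - g) * l1 w \<le> 2 * g * (\<Sum>i<n. \<bar>v i\<bar>)"
    using solution_bound[OF y w] by (simp add: mult.assoc mult.left_commute)
  have "F A b y - F A b z = (\<Sum>i<n. y $ i * w $ i + 2 * v i)"
    unfolding F_eq[OF y] F_eq[OF z] sum_subtractf[symmetric]
  proof (rule sum.cong[OF refl])
    fix i assume "i \<in> {..<n}"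
    then have i: "i < n" by simp
    then have wi: "w $ i = ?x' $ i - ?x $ i" using x x' by (simp add: w_def)
    show "y $ i * ?x' $ i - z $ i * ?x $ i = y $ i * w $ i + 2 * v i"
      unfolding v[OF i, symmetric] wi by (simp add: algebra_simps)
  qed
  then have "F A b y - F A b z - 2 * (\<Sum>i<n. v i) = (\<Sum>i<n. y $ i * w $ i)"
    by (simp add: sum.distrib sum_distrib_left)
  then have "\<bar>F A b y - F A b z - 2 * (\<Sum>i<n. v i)\<bar> \<le> l1 w"
    using abs_sum_sign_le_l1[OF y w] by simp
  then have "(1 - g) * \<bar>F A b y - F A b z - 2 * (\<Sum>i<n. v i)\<bar> \<le> (1 - g) * l1 w"
    using g by (intro mult_left_mono) auto
  then show ?thesis using lw by linarith
qed

lemma finite_mismatch: "finite (mismatch A b z)"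
  by (rule finite_subset[of _ "{..<dim_vec z}"]) (auto simp: mismatch_def)

text \<open>Outside the mismatch set \<open>v i\<close> is nonpositive, and since
  \<open>g < 1/2\<close> the loss \<open>(1 - g) * v i\<close> outweighs the perturbation
  \<open>g * \<bar>v i\<bar>\<close>. At a mismatch the weights \<open>1 - g\<close> and
  \<open>g\<close> add up to one.\<close>

lemma F_gap_upper:
  assumes y: "y \<in> sign_vecs n" and z: "z \<in> sign_vecs n"
  shows "(1 - g) * (F A b y - F A b z) \<le> 2 * (\<Sum>i\<in>mismatch A b z. \<bar>x_of A b z $ i\<bar>)"
proof -
  let ?x = "x_of A b z" and ?V = "mismatch A b z"
  define v where "v = (\<lambda>i. if y $ i = z $ i then 0 else - (z $ i * ?x $ i))"
  have "(1 - g) * (F A b y - F A b z - 2 * (\<Sum>i<n. v i))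
      \<le> (1 - g) * \<bar>F A b y - F A b z - 2 * (\<Sum>i<n. v i)\<bar>"
    using g by (intro mult_left_mono) auto
  also have "\<dots> \<le> 2 * g * (\<Sum>i<n. \<bar>v i\<bar>)"
    using F_diff[OF y z] by (simp only: v_def)
  finally have "(1 - g) * (F A b y - F A b z - 2 * (\<Sum>i<n. v i)) \<le> 2 * g * (\<Sum>i<n. \<bar>v i\<bar>)" .
  then have "(1 - g) * (F A b y - F A b z) \<le> 2 * (\<Sum>i<n. (1 - g) * v i + g * \<bar>v i\<bar>)"
    unfolding sum.distrib sum_distrib_left[symmetric] by (simp add: algebra_simps)
  also have "(\<Sum>i<n. (1 - g) * v i + g * \<bar>v i\<bar>) \<le> (\<Sum>i<n. if i \<in> ?V then \<bar>?x $ i\<bar> else 0)"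
  proof (rule sum_mono)
    fix i assume "i \<in> {..<n}"
    then have i: "i < n" by simp
    show "(1 - g) * v i + g * \<bar>v i\<bar> \<le> (if i \<in> ?V then \<bar>?x $ i\<bar> else 0)"
    proof (cases "i \<in> ?V")
      case True
      then have "v i = 0 \<or> v i = \<bar>?x $ i\<bar>"
        using sign_vecsD(2)[OF z i] by (auto simp: v_def mismatch_def)
      then show ?thesis using True by (auto simp: algebra_simps)
    next
      case False
      then have "v i \<le> 0" using i sign_vecsD(3)[OF z] by (auto simp: v_def mismatch_def)
      then have "(1 - g) * v i + g * \<bar>v i\<bar> = (1 - 2 * g) * v i" by (simp add: algebra_simps)
      also have "\<dots> \<le> 0" using \<open>v i \<le> 0\<close> g by (simp add: mult_nonneg_nonpos)
      finally show ?thesis using False by simp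
    qed
  qed
  also have "\<dots> = (\<Sum>i\<in>?V. \<bar>?x $ i\<bar>)"
  proof -
    have "{..<n} \<inter> ?V = ?V" using sign_vecsD(3)[OF z] by (auto simp: mismatch_def)
    then show ?thesis by (simp add: sum.inter_restrict[symmetric])
  qed
  finally show ?thesis by simp
qed

text \<open>On \<open>S\<close> every \<open>v i\<close> equals the absolute value of the solution
  entry, so nothing cancels: the linear part has weight \<open>1 - g\<close> and the perturbation
  costs at most weight \<open>g\<close>.\<close>

lemma F_gain:
  assumes z: "z \<in> sign_vecs n" and S: "S \<subseteq> mismatch A b z"
  shows "2 * (1 - 2 * g) * (\<Sum>i\<in>S. \<bar>x_of A b z $ i\<bar>) \<le> (1 - g) * (F A b (flip S z) - F A b z)"
proof -
  let ?x = "x_of A b z" and ?y = "flip S z"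
  define v where "v = (\<lambda>i. if ?y $ i = z $ i then 0 else - (z $ i * ?x $ i))"
  have "v i = (if i \<in> S then \<bar>?x $ i\<bar> else 0)" if i: "i < n" for i
    using S i sign_vecsD(2)[OF z i] sign_vecsD(3)[OF z]
    by (auto simp: v_def flip_def mismatch_def subset_iff)
  moreover have "{..<n} \<inter> S = S" using S sign_vecsD(3)[OF z] by (auto simp: mismatch_def)
  ultimately have v: "(\<Sum>i<n. v i) = (\<Sum>i\<in>S. \<bar>?x $ i\<bar>)" "(\<Sum>i<n. \<bar>v i\<bar>) = (\<Sum>i\<in>S. \<bar>?x $ i\<bar>)"
    by (simp_all add: sum.inter_restrict[symmetric] if_distrib[of abs] cong: if_cong)
  have "(1 - g) * (- (F A b ?y - F A b z - 2 * (\<Sum>i<n. v i)))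
      \<le> (1 - g) * \<bar>F A b ?y - F A b z - 2 * (\<Sum>i<n. v i)\<bar>"
    using g by (intro mult_left_mono) auto
  also have "\<dots> \<le> 2 * g * (\<Sum>i<n. \<bar>v i\<bar>)"
    using F_diff[OF flip_sign_vecs[OF z, of S] z] by (simp only: v_def)
  finally show ?thesis unfolding v by (simp add: algebra_simps)
qed

lemma stop_maximizer:
  assumes z: "z \<in> sign_vecs n" and "mismatch A b z = {}"
  shows "global_maximizer n A b z"
  unfolding global_maximizer_def
proof (intro conjI ballI z)
  fix y assume "y \<in> sign_vecs n"
  from F_gap_upper[OF this z] assms(2) have "(1 - g) * (F A b y - F A b z) \<le> 0" by simp
  then show "F A b y \<le> F A b z" using g by (simp add: mult_le_0_iff)
qed

text \<open>The gain is at least \<open>2 \<kappa> (1 - 2 g)\<close> times the mismatch mass and the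
  gap is at most twice that mass, so the mass cancels. The factor \<open>1 - g\<close> inside
  \<open>E\<close> avoids divisions.\<close>

lemma gap_contraction:
  assumes z: "z \<in> sign_vecs n" and y: "y \<in> sign_vecs n" and "capture_choice \<kappa> A b z S" "0 \<le> \<kappa>"
  defines "E \<equiv> \<lambda>z. real_of_rat ((1 - g) * (F A b y - F A b z))"
  shows "E (flip S z) \<le> (1 - \<kappa> * real_of_rat (1 - 2 * g)) * E z"
proof -
  let ?V = "real_of_rat (\<Sum>i\<in>mismatch A b z. \<bar>x_of A b z $ i\<bar>)"
  let ?S = "real_of_rat (\<Sum>i\<in>S. \<bar>x_of A b z $ i\<bar>)"
  let ?d = "real_of_rat (1 - 2 * g)"
  have S: "S \<subseteq> mismatch A b z" "\<kappa> * ?V \<le> ?S"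
    using assms(3) by (auto simp: capture_choice_def of_rat_sum)
  have d: "0 \<le> ?d" using g by simp
  have "2 * ((1 - 2 * g) * (\<Sum>i\<in>S. \<bar>x_of A b z $ i\<bar>))
      \<le> (1 - g) * (F A b y - F A b z) - (1 - g) * (F A b y - F A b (flip S z))"
    using F_gain[OF z S(1)] by (simp add: algebra_simps)
  then have "real_of_rat (2 * ((1 - 2 * g) * (\<Sum>i\<in>S. \<bar>x_of A b z $ i\<bar>))) \<le> E z - E (flip S z)"
    unfolding E_def of_rat_diff[symmetric] by (simp only: of_rat_less_eq)
  then have "2 * (?d * ?S) \<le> E z - E (flip S z)"
    by (simp only: of_rat_mult of_rat_numeral_eq)
  moreover have "?d * (\<kappa> * ?V) \<le> ?d * ?S" using S(2) d by (rule mult_left_mono)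
  moreover have "E z \<le> real_of_rat (2 * (\<Sum>i\<in>mismatch A b z. \<bar>x_of A b z $ i\<bar>))"
    unfolding E_def using F_gap_upper[OF y z] by (simp only: of_rat_less_eq)
  then have "E z \<le> 2 * ?V" by (simp add: of_rat_mult)
  then have "(\<kappa> * ?d) * E z \<le> (\<kappa> * ?d) * (2 * ?V)" using d assms(4) by (intro mult_left_mono) auto
  ultimately show ?thesis by (simp add: algebra_simps)
qed

text \<open>The initial gap is at most \<open>2 g * l1 b\<close> by \<open>F_bound\<close> and
  decays geometrically. The witnesses are the \<open>k\<close>-th iterate and any of its mismatched
  indices, to which \<open>F_gain\<close> applies with \<open>S\<close> the full mismatch
  set.\<close>

lemma run_bound:
  assumes z0: "z0 \<in> sign_vecs n" and run: "capture_run \<kappa> A b z0 S" and \<kappa>: "0 \<le> \<kappa>" "\<kappa> \<le> 1"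
    and V: "\<And>j. j \<le> k \<Longrightarrow> mismatch A b (sign_after A b z0 S j) \<noteq> {}"
  shows "\<exists>z\<in>sign_vecs n. \<exists>i<n. x_of A b z $ i \<noteq> 0 \<and>
    real_of_rat ((1 - 2 * g) * \<bar>x_of A b z $ i\<bar>) \<le>
      exp (- (\<kappa> * real_of_rat (1 - 2 * g) * k)) * real_of_rat (g * l1 b)"
proof -
  let ?z = "sign_after A b z0 S" and ?d = "real_of_rat (1 - 2 * g)"
  note sgn = sign_after_sign_vecs[OF z0]
  let ?V = "mismatch A b (?z k)"
  define y where "y = flip ?V (?z k)"
  have y: "y \<in> sign_vecs n" unfolding y_def using sgn by (rule flip_sign_vecs)
  define E where "E = (\<lambda>z. real_of_rat ((1 - g) * (F A b y - F A b z)))"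
  have d: "0 \<le> ?d" "?d \<le> 1" using g by auto
  have q: "0 \<le> 1 - \<kappa> * ?d" using d \<kappa> mult_le_one[of \<kappa> ?d] by simp
  have "E (?z j) \<le> (1 - \<kappa> * ?d) ^ j * E z0" if "j \<le> k" for j
    using that
  proof (induction j)
    case (Suc j)
    have "mismatch A b (?z j) \<noteq> {}" using V Suc.prems by simp
    moreover from this have "capture_choice \<kappa> A b (?z j) (S j)" using run by (auto simp: capture_run_def)
    ultimately have "E (?z (Suc j)) \<le> (1 - \<kappa> * ?d) * E (?z j)"
      using gap_contraction[OF sgn y _ \<kappa>(1)] by (simp add: E_def Let_def)
    also have "\<dots> \<le> (1 - \<kappa> * ?d) * ((1 - \<kappa> * ?d) ^ j * E z0)"
      using q Suc by (intro mult_left_mono) auto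
    finally show ?case by simp
  qed simp
  then have "E (?z k) \<le> (1 - \<kappa> * ?d) ^ k * E z0" by simp
  also have "\<dots> \<le> (1 - \<kappa> * ?d) ^ k * (2 * real_of_rat (g * l1 b))"
  proof (intro mult_left_mono)
    have "(1 - g) * (F A b y - F A b z0) \<le> (1 - g) * (\<bar>F A b y\<bar> + \<bar>F A b z0\<bar>)"
      using g by (intro mult_left_mono) auto
    also have "\<dots> \<le> 2 * (g * l1 b)"
      using F_bound[OF y] F_bound[OF z0] by (simp add: distrib_left)
    finally have "E z0 \<le> real_of_rat (2 * (g * l1 b))"
      unfolding E_def by (simp only: of_rat_less_eq)
    then show "E z0 \<le> 2 * real_of_rat (g * l1 b)" by (simp add: of_rat_mult)
  qed (use q in auto)
  also have "\<dots> \<le> exp (- (\<kappa> * ?d * k)) * (2 * real_of_rat (g * l1 b))"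
  proof (intro mult_right_mono)
    have "(1 - \<kappa> * ?d) ^ k \<le> exp (- (\<kappa> * ?d)) ^ k"
      using q exp_ge_add_one_self[of "- (\<kappa> * ?d)"] by (intro power_mono) auto
    then show "(1 - \<kappa> * ?d) ^ k \<le> exp (- (\<kappa> * ?d * k))"
      by (simp add: exp_of_nat_mult[symmetric] mult.commute)
    show "0 \<le> 2 * real_of_rat (g * l1 b)" using g by (simp add: l1_def sum_nonneg)
  qed
  finally have E: "E (?z k) \<le> exp (- (\<kappa> * ?d * k)) * (2 * real_of_rat (g * l1 b))" .
  obtain i where i: "i \<in> ?V" using V[of k] by auto
  have "2 * (1 - 2 * g) * \<bar>x_of A b (?z k) $ i\<bar> \<le> 2 * (1 - 2 * g) * (\<Sum>i\<in>?V. \<bar>x_of A b (?z k) $ i\<bar>)"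
    using i g finite_mismatch by (intro mult_left_mono member_le_sum) auto
  also have "\<dots> \<le> (1 - g) * (F A b y - F A b (?z k))"
    unfolding y_def using F_gain[OF sgn subset_refl] .
  finally have "real_of_rat (2 * ((1 - 2 * g) * \<bar>x_of A b (?z k) $ i\<bar>)) \<le> E (?z k)"
    unfolding E_def by (simp only: of_rat_less_eq mult.assoc)
  with E have "real_of_rat ((1 - 2 * g) * \<bar>x_of A b (?z k) $ i\<bar>)
      \<le> exp (- (\<kappa> * ?d * k)) * real_of_rat (g * l1 b)"
    by (simp only: of_rat_mult[of 2]) simp
  moreover have "i < n" "x_of A b (?z k) $ i \<noteq> 0"
    using i sgn sign_vecsD(3)[OF sgn] by (auto simp: mismatch_def)
  ultimately show ?thesis using sgn by blast
qed

end

section \<open>The adjugate of the characteristic matrix\<close>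

text \<open>Entry \<open>(i, j)\<close> of \<open>B_k\<close> in the expansion
  \<open>adj (x I - M) = \<Sum> x^k B_k\<close> with integer matrices \<open>B_k\<close>.\<close>

definition adj_coeff :: "int mat \<Rightarrow> nat \<Rightarrow> nat \<Rightarrow> nat \<Rightarrow> int" where
  "adj_coeff M k i j = coeff (adj_mat (char_poly_matrix M) $$ (i, j)) k"

context
  fixes M :: "int mat" and n :: nat
  assumes M: "M \<in> carrier_mat n n"
begin

text \<open>The coefficient of \<open>x^k\<close> in
  \<open>(x I - M) * adj (x I - M) = char_poly M * I\<close>; multiplication by \<open>x\<close>
  shifts the index, which leaves nothing for \<open>k = 0\<close>.\<close>

lemma coeff_adj_eq:
  assumes "i < n" "j < n"
  shows "(case k of 0 \<Rightarrow> 0 | Suc k' \<Rightarrow> adj_coeff M k' i j) - (\<Sum>l<n. M $$ (i, l) * adj_coeff M k l j)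
    = (if i = j then coeff (char_poly M) k else 0)"
proof -
  let ?C = "char_poly_matrix M" and ?A = "adj_mat (char_poly_matrix M)"
  have C: "?C \<in> carrier_mat n n" using M by simp
  note A = adj_mat(1)[OF C]
  have "(?C * ?A) $$ (i, j) = (if i = j then char_poly M else 0)"
    unfolding adj_mat(2)[OF C] using assms by (simp add: char_poly_def)
  moreover have "(?C * ?A) $$ (i, j) = (\<Sum>l<n. ?C $$ (i, l) * ?A $$ (l, j))"
    using C A assms by (simp add: scalar_prod_def lessThan_atLeast0)
  moreover have "?C $$ (i, l) = (if i = l then [:0, 1:] else 0) + [:- M $$ (i, l):]" if "l < n" for l
    using M assms that by (simp add: char_poly_matrix_def)
  ultimately have "(if i = j then char_poly M else 0) =
      (\<Sum>l<n. ((if i = l then [:0, 1:] else 0) + [:- M $$ (i, l):]) * ?A $$ (l, j))"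
    by simp
  also have "\<dots> = (\<Sum>l<n. (if i = l then [:0, 1:] * ?A $$ (l, j) else 0))
      + (\<Sum>l<n. [:- M $$ (i, l):] * ?A $$ (l, j))"
    unfolding sum.distrib[symmetric] by (rule sum.cong) (auto simp: distrib_right)
  also have "\<dots> = [:0, 1:] * ?A $$ (i, j) - (\<Sum>l<n. Polynomial.smult (M $$ (i, l)) (?A $$ (l, j)))"
    using assms by (simp add: sum.delta sum_negf)
  finally have "coeff (if i = j then char_poly M else 0) k =
      coeff ([:0, 1:] * ?A $$ (i, j) - (\<Sum>l<n. Polynomial.smult (M $$ (i, l)) (?A $$ (l, j)))) k" by simp
  then show ?thesis
    by (cases k) (auto simp: adj_coeff_def coeff_sum)
qed

lemma coeff_adj_Suc:
  assumes "i < n" "j < n"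
  shows "adj_coeff M k i j = (\<Sum>l<n. M $$ (i, l) * adj_coeff M (Suc k) l j)
    + (if i = j then coeff (char_poly M) (Suc k) else 0)"
  using coeff_adj_eq[OF assms, of "Suc k"] by simp

lemma coeff_adj_0:
  assumes "i < n" "j < n"
  shows "(\<Sum>l<n. M $$ (i, l) * adj_coeff M 0 l j) = (if i = j then - coeff (char_poly M) 0 else 0)"
  using coeff_adj_eq[OF assms, of 0] by (auto split: if_splits)

text \<open>Far beyond the largest entry degree all coefficients vanish, and
  \<open>coeff_adj_Suc\<close> carries the zeros down as long as the characteristic polynomial
  contributes none of its own, that is, down to \<open>k = n\<close>. This replaces a degree bound
  for cofactors.\<close>

lemma adj_coeff_ge:
  assumes "i < n" "j < n" "n \<le> k"
  shows "adj_coeff M k i j = 0"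
proof -
  define d where "d = Max ((\<lambda>(i, j). degree (adj_mat (char_poly_matrix M) $$ (i, j))) ` ({..<n} \<times> {..<n}))"
  have large: "adj_coeff M (Suc (d + m)) i j = 0" if "i < n" "j < n" for i j m
  proof -
    have "degree (adj_mat (char_poly_matrix M) $$ (i, j)) \<le> d"
      unfolding d_def using that by (intro Max_ge) auto
    then show ?thesis unfolding adj_coeff_def by (intro coeff_eq_0) simp
  qed
  have "\<forall>i<n. \<forall>j<n. adj_coeff M k i j = 0" if "n \<le> k" "k \<le> Suc (d + n)" for k
    using that(2,1)
  proof (induction k rule: inc_induct)
    case base
    then show ?case using large[of _ _ n] by simp
  next
    case (step k)
    then have "coeff (char_poly M) (Suc k) = 0"
      using degree_monic_char_poly[OF M] by (intro coeff_eq_0) simp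
    then show ?case using step coeff_adj_Suc[of _ _ k] by simp
  qed
  moreover have "adj_coeff M k i j = 0" if "Suc (d + n) < k"
    using large[OF assms(1,2), of "k - Suc d"] that by simp
  ultimately show ?thesis using assms by (meson linorder_not_le)
qed

text \<open>The trace of the adjugate of \<open>x I - M\<close> is the derivative of the
  characteristic polynomial: its diagonal cofactors are the characteristic polynomials of
  \<open>M\<close> with row and column \<open>i\<close> deleted.\<close>

lemma adj_coeff_trace: "(\<Sum>i<n. adj_coeff M k i i) = int (Suc k) * coeff (char_poly M) (Suc k)"
proof -
  let ?C = "char_poly_matrix M"
  have "adj_mat ?C $$ (i, i) = char_poly (mat_delete M i i)" if i: "i < n" for i
  proof -
    have "mat_delete ?C i i = char_poly_matrix (mat_delete M i i)"
      using i M by (intro eq_matI) (auto simp: mat_delete_def char_poly_matrix_def)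
    then show ?thesis
      using i carrier_matD[OF char_poly_matrix_closed[OF M]]
      by (simp add: adj_mat_def cofactor_def char_poly_def flip: mult_2)
  qed
  then have "(\<Sum>i<n. adj_coeff M k i i) = coeff (pderiv (char_poly M)) k"
    unfolding pderiv_char_poly[OF M] coeff_sum adj_coeff_def by (intro sum.cong) auto
  then show ?thesis by (simp add: coeff_pderiv)
qed

text \<open>Newton's identity in the form of the Faddeev--LeVerrier recursion.\<close>

lemma char_poly_coeff_trace:
  assumes "k \<le> n"
  shows "int (n - k) * coeff (char_poly M) k = - (\<Sum>i<n. \<Sum>l<n. M $$ (i, l) * adj_coeff M k l i)"
proof -
  \<comment> \<open>The diagonal of \<open>coeff_adj_eq\<close>, summed:
    \<open>k c_k - tr (M B_k) = n c_k\<close>.\<close>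
  have "(\<Sum>i<n. (case k of 0 \<Rightarrow> 0 | Suc k' \<Rightarrow> adj_coeff M k' i i) - (\<Sum>l<n. M $$ (i, l) * adj_coeff M k l i))
    = (\<Sum>i<n. coeff (char_poly M) k)"
    by (rule sum.cong) (auto simp: coeff_adj_eq)
  moreover have "(\<Sum>i<n. (case k of 0 \<Rightarrow> 0 | Suc k' \<Rightarrow> adj_coeff M k' i i)) = int k * coeff (char_poly M) k"
    using adj_coeff_trace by (cases k) auto
  ultimately show ?thesis using assms
    by (simp add: sum_subtractf of_nat_diff algebra_simps)
qed

text \<open>Both bounds need a joint induction, since each recursion uses the other sequence. A
  product with \<open>M\<close> costs a factor \<open>n \<mu>\<close> and its trace another
  \<open>n\<close>; the next matrix is the sum of such a product and a trace term, hence the factor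
  2 in \<open>G\<close>.\<close>

lemma adj_coeff_bound:
  assumes \<mu>: "1 \<le> \<mu>" "\<And>i j. i < n \<Longrightarrow> j < n \<Longrightarrow> \<bar>M $$ (i, j)\<bar> \<le> \<mu>" and n: "1 \<le> n"
  defines "G \<equiv> 2 * int n ^ 2 * \<mu>"
  shows "r \<le> n \<Longrightarrow> \<bar>coeff (char_poly M) (n - r)\<bar> \<le> G ^ r"
    and "r < n \<Longrightarrow> i < n \<Longrightarrow> j < n \<Longrightarrow> \<bar>adj_coeff M (n - Suc r) i j\<bar> \<le> G ^ r"
proof -
  have G1: "1 \<le> G" and G2: "int n * (int n * \<mu>) + int n * \<mu> \<le> G" and G3: "int n * (int n * \<mu>) \<le> G"
  proof -
    have "int n * \<mu> * 1 \<le> int n * \<mu> * int n" using n \<mu> by (intro mult_left_mono) auto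
    then show 2: "int n * (int n * \<mu>) + int n * \<mu> \<le> G" by (simp add: G_def power2_eq_square algebra_simps)
    have "1 * 1 \<le> int n * \<mu>" using n \<mu> by (intro mult_mono) auto
    moreover from this have "1 * 1 \<le> int n * (int n * \<mu>)" using n by (intro mult_mono) auto
    ultimately show "1 \<le> G" "int n * (int n * \<mu>) \<le> G" using 2 by linarith+
  qed
  have prod: "\<bar>\<Sum>l<n. M $$ (i, l) * v l\<bar> \<le> int n * \<mu> * K" if "i < n" "\<And>l. l < n \<Longrightarrow> \<bar>v l\<bar> \<le> K" for i v K
  proof -
    have "\<bar>\<Sum>l<n. M $$ (i, l) * v l\<bar> \<le> (\<Sum>l<n. \<bar>M $$ (i, l) * v l\<bar>)" by (rule sum_abs)
    also have "\<dots> \<le> (\<Sum>l<n. \<mu> * K)"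
      unfolding abs_mult using \<mu> that by (intro sum_mono mult_mono) auto
    finally show ?thesis by simp
  qed
  have "\<bar>coeff (char_poly M) (n - r)\<bar> \<le> G ^ r \<and>
      (r < n \<longrightarrow> (\<forall>i<n. \<forall>j<n. \<bar>adj_coeff M (n - Suc r) i j\<bar> \<le> G ^ r))" if "r \<le> n" for r
    using that
  proof (induction r)
    case 0
    have "coeff (char_poly M) n = 1" using degree_monic_char_poly[OF M] by auto
    then show ?case using coeff_adj_Suc[of _ _ "n - 1"] n by (auto simp: adj_coeff_ge)
  next
    case (Suc r)
    then have IH: "\<bar>adj_coeff M (n - Suc r) i j\<bar> \<le> G ^ r" if "i < n" "j < n" for i j
      using that by auto
    let ?c = "coeff (char_poly M) (n - Suc r)"
    have Gr: "0 \<le> G ^ r" using G1 by simp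
    \<comment> \<open>In degree \<open>n - Suc r\<close> the factor in
      \<open>char_poly_coeff_trace\<close> is \<open>Suc r\<close>, and multiplying by it can only
      enlarge the absolute value.\<close>
    have "\<bar>?c\<bar> \<le> \<bar>int (Suc r) * ?c\<bar>"
      by (simp add: abs_mult mult_le_cancel_right1)
    also have "\<dots> = \<bar>\<Sum>i<n. \<Sum>l<n. M $$ (i, l) * adj_coeff M (n - Suc r) l i\<bar>"
      using char_poly_coeff_trace[of "n - Suc r"] Suc.prems by simp
    also have "\<dots> \<le> (\<Sum>i<n. \<bar>\<Sum>l<n. M $$ (i, l) * adj_coeff M (n - Suc r) l i\<bar>)" by (rule sum_abs)
    also have "\<dots> \<le> (\<Sum>i<n. int n * \<mu> * G ^ r)" by (intro sum_mono prod IH) auto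
    finally have c: "\<bar>?c\<bar> \<le> int n * (int n * \<mu>) * G ^ r" by simp
    also have "\<dots> \<le> G * G ^ r" using G3 Gr by (intro mult_right_mono)
    finally have 1: "\<bar>?c\<bar> \<le> G ^ Suc r" by simp
    have "\<bar>adj_coeff M (n - Suc (Suc r)) i j\<bar> \<le> G ^ Suc r" if "Suc r < n" "i < n" "j < n" for i j
    proof -
      have e: "Suc (n - Suc (Suc r)) = n - Suc r" using that by simp
      have "\<bar>adj_coeff M (n - Suc (Suc r)) i j\<bar> \<le>
          \<bar>\<Sum>l<n. M $$ (i, l) * adj_coeff M (n - Suc r) l j\<bar> + \<bar>?c\<bar>"
        unfolding coeff_adj_Suc[OF that(2,3), of "n - Suc (Suc r)"] e by auto
      also have "\<dots> \<le> int n * \<mu> * G ^ r + int n * (int n * \<mu>) * G ^ r"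
        using prod[of i "\<lambda>l. adj_coeff M (n - Suc r) l j" "G ^ r"] IH that c by (intro add_mono) auto
      also have "\<dots> \<le> G * G ^ r"
        using mult_right_mono[OF G2 Gr] by (simp add: distrib_right)
      finally show ?thesis by simp
    qed
    then show ?case using 1 by blast
  qed
  then show "r \<le> n \<Longrightarrow> \<bar>coeff (char_poly M) (n - r)\<bar> \<le> G ^ r"
    "r < n \<Longrightarrow> i < n \<Longrightarrow> j < n \<Longrightarrow> \<bar>adj_coeff M (n - Suc r) i j\<bar> \<le> G ^ r"
    by auto
qed

text \<open>A vanishing constant coefficient makes 0 a root, hence a rational eigenvalue, and its
  eigenvector contradicts injectivity.\<close>

lemma char_poly_coeff_0_neq_0:
  assumes inj: "\<And>v :: rat vec. v \<in> carrier_vec n \<Longrightarrow> map_mat of_int M *\<^sub>v v = 0\<^sub>v n \<Longrightarrow> v = 0\<^sub>v n"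
  shows "coeff (char_poly M) 0 \<noteq> 0"
proof
  assume "coeff (char_poly M) 0 = 0"
  then have "poly (char_poly (map_mat rat_of_int M)) 0 = 0"
    by (simp add: of_int_hom.char_poly_hom[OF M] poly_0_coeff_0)
  then have "eigenvalue (map_mat rat_of_int M) 0"
    using eigenvalue_root_char_poly[of "map_mat rat_of_int M" n] M by simp
  then obtain v where "v \<in> carrier_vec n" "v \<noteq> 0\<^sub>v n" "map_mat rat_of_int M *\<^sub>v v = 0 \<cdot>\<^sub>v v"
    using M by (auto simp: eigenvalue_def eigenvector_def)
  moreover from this have "0 \<cdot>\<^sub>v v = 0\<^sub>v n" by (intro eq_vecI) auto
  ultimately show False using inj[of v] by simp
qed

end

section \<open>Integer data\<close>

locale ave_int = ave +
  fixes Abar :: "int mat" and bbar :: "int vec" and dA db :: int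
  assumes int_data: "integer_data n A b Abar bbar dA db" and n: "1 \<le> n"
begin

lemma Abar: "Abar \<in> carrier_mat n n" "bbar \<in> carrier_vec n" "0 < dA" "0 < db"
  "A = (1 / of_int dA) \<cdot>\<^sub>m map_mat of_int Abar" "b = (1 / of_int db) \<cdot>\<^sub>v map_vec of_int bbar"
  using int_data by (auto simp: integer_data_def)

text \<open>For a sign vector this is \<open>dA\<close> times \<open>A - Diag z\<close>; the floor
  merely turns rational signs into integers.\<close>

definition shifted :: "rat vec \<Rightarrow> int mat" where
  "shifted z = mat n n (\<lambda>(i, j). Abar $$ (i, j) - (if i = j then dA * \<lfloor>z $ i\<rfloor> else 0))"

text \<open>By \<open>coeff_adj_0\<close>, \<open>M B_0 = - c_0 I\<close> for
  \<open>M = shifted z\<close>, so the inverse of \<open>A - Diag z\<close> is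
  \<open>dA B_0 / (- c_0)\<close>. Applied to \<open>b = bbar / db\<close> this gives the solution
  as \<open>num / den\<close>.\<close>

definition num :: "rat vec \<Rightarrow> nat \<Rightarrow> int" where
  "num z i = (\<Sum>j<n. adj_coeff (shifted z) 0 i j * (dA * bbar $ j))"

definition den :: "rat vec \<Rightarrow> int" where
  "den z = - (coeff (char_poly (shifted z)) 0 * db)"

lemma shifted_carrier: "shifted z \<in> carrier_mat n n"
  by (simp add: shifted_def)

lemma minus_Diag_mult_shifted:
  assumes z: "z \<in> sign_vecs n" and v: "v \<in> carrier_vec n" and i: "i < n"
  shows "((A - Diag z) *\<^sub>v v) $ i = (\<Sum>j<n. of_int (shifted z $$ (i, j)) * v $ j) / of_int dA"
proof -
  note zi = floor_sign(1)[OF z i]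
  have "(\<Sum>j<n. of_int (shifted z $$ (i, j)) * v $ j) =
      (\<Sum>j<n. of_int (Abar $$ (i, j)) * v $ j - (if i = j then of_int dA * z $ i * v $ j else 0))"
    using i zi by (intro sum.cong) (auto simp: shifted_def left_diff_distrib)
  also have "\<dots> = (\<Sum>j<n. of_int (Abar $$ (i, j)) * v $ j) - of_int dA * z $ i * v $ i"
    using i by (simp add: sum_subtractf)
  finally have *: "(\<Sum>j<n. of_int (shifted z $$ (i, j)) * v $ j) / of_int dA =
      (\<Sum>j<n. of_int (Abar $$ (i, j)) * v $ j) / of_int dA - z $ i * v $ i"
    using Abar(3) by (simp add: diff_divide_distrib)
  have "(A *\<^sub>v v) $ i = (\<Sum>j<n. of_int (Abar $$ (i, j)) * v $ j) / of_int dA"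
    unfolding mult_mat_vec_index[OF A v i] sum_divide_distrib
    using i Abar(1) by (intro sum.cong) (auto simp: Abar(5))
  then show ?thesis unfolding minus_Diag_mult_index[OF A z v i] * by simp
qed

lemma den_neq_0:
  assumes z: "z \<in> sign_vecs n"
  shows "den z \<noteq> 0"
proof -
  have C: "A - Diag z \<in> carrier_mat n n" using A Diag_carrier[OF z] by (intro minus_carrier_mat)
  have "coeff (char_poly (shifted z)) 0 \<noteq> 0"
  proof (rule char_poly_coeff_0_neq_0[OF shifted_carrier])
    fix v :: "rat vec"
    assume v: "v \<in> carrier_vec n" and 0: "map_mat of_int (shifted z) *\<^sub>v v = 0\<^sub>v n"
    have "(A - Diag z) *\<^sub>v v = 0\<^sub>v n"
    proof (rule eq_vecI)
      fix i assume "i < dim_vec (0\<^sub>v n :: rat vec)"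
      then have i: "i < n" by simp
      have "(\<Sum>j<n. of_int (shifted z $$ (i, j)) * v $ j) = (map_mat of_int (shifted z) *\<^sub>v v) $ i"
        using shifted_carrier[of z] i by (subst mult_mat_vec_index[OF _ v]) auto
      then show "((A - Diag z) *\<^sub>v v) $ i = 0\<^sub>v n $ i"
        using minus_Diag_mult_shifted[OF z v i] i by (simp add: 0)
    qed (use C in auto)
    then show "v = 0\<^sub>v n"
      using det_minus_Diag[OF z] det_0_iff_vec_prod_zero_field[OF C] v by blast
  qed
  then show ?thesis using Abar(4) by (simp add: den_def)
qed

lemma shifted_mult_num:
  assumes i: "i < n"
  shows "(\<Sum>j<n. shifted z $$ (i, j) * num z j) = - coeff (char_poly (shifted z)) 0 * (dA * bbar $ i)"
proof -
  have "(\<Sum>j<n. shifted z $$ (i, j) * num z j) =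
      (\<Sum>l<n. \<Sum>j<n. shifted z $$ (i, j) * (adj_coeff (shifted z) 0 j l * (dA * bbar $ l)))"
    unfolding num_def sum_distrib_left by (rule sum.swap)
  also have "\<dots> = (\<Sum>l<n. (\<Sum>j<n. shifted z $$ (i, j) * adj_coeff (shifted z) 0 j l) * (dA * bbar $ l))"
    unfolding sum_distrib_right by (simp only: mult.assoc)
  also have "\<dots> = (\<Sum>l<n. if i = l then - coeff (char_poly (shifted z)) 0 * (dA * bbar $ l) else 0)"
    using coeff_adj_0[OF shifted_carrier i] by (intro sum.cong) auto
  finally show ?thesis using i by simp
qed

lemma x_of_eq:
  assumes z: "z \<in> sign_vecs n" and i: "i < n"
  shows "x_of A b z $ i = of_int (num z i) / of_int (den z)"
proof -
  have C: "A - Diag z \<in> carrier_mat n n" using A Diag_carrier[OF z] by (intro minus_carrier_mat)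
  let ?c = "coeff (char_poly (shifted z)) 0"
  let ?x = "vec n (\<lambda>i. of_int (num z i) / of_int (den z) :: rat)"
  have x: "?x \<in> carrier_vec n" by simp
  have c: "?c \<noteq> 0" using den_neq_0[OF z] by (simp add: den_def)
  have "(A - Diag z) *\<^sub>v ?x = b"
  proof (rule eq_vecI)
    fix i assume "i < dim_vec b"
    then have i: "i < n" using b by simp
    have "(\<Sum>j<n. of_int (shifted z $$ (i, j)) * ?x $ j) =
        of_int (\<Sum>j<n. shifted z $$ (i, j) * num z j) / of_int (den z)"
      unfolding of_int_sum sum_divide_distrib by (intro sum.cong) auto
    also have "\<dots> = of_int (- ?c * (dA * bbar $ i)) / of_int (den z)"
      unfolding shifted_mult_num[OF i] ..
    also have "\<dots> = of_int dA * (of_int (bbar $ i) / of_int db)"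
      using c Abar(4) by (simp add: den_def field_simps)
    finally show "((A - Diag z) *\<^sub>v ?x) $ i = b $ i"
      unfolding minus_Diag_mult_shifted[OF z x i] using Abar(2,3) i by (simp add: Abar(6))
  qed (use C b in auto)
  then show ?thesis using x_of_unique[OF z x] i by simp
qed

lemma x_of_lower:
  assumes z: "z \<in> sign_vecs n" and i: "i < n" and "x_of A b z $ i \<noteq> 0"
  shows "1 \<le> \<bar>x_of A b z $ i\<bar> * of_int \<bar>den z\<bar>"
proof -
  have "num z i \<noteq> 0" using assms by (auto simp: x_of_eq)
  then have "1 \<le> \<bar>num z i\<bar>" by linarith
  then have "(1 :: rat) \<le> of_int \<bar>num z i\<bar>" by linarith
  then show ?thesis using den_neq_0[OF z] by (simp add: x_of_eq[OF z i])
qed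

lemma shifted_bound:
  assumes z: "z \<in> sign_vecs n" and ij: "i < n" "j < n"
    and L: "\<bar>Abar $$ (i, j)\<bar> + dA \<le> \<mu>"
  shows "\<bar>shifted z $$ (i, j)\<bar> \<le> \<mu>"
proof -
  have "\<bar>dA * \<lfloor>z $ i\<rfloor>\<bar> = dA" using Abar(3) floor_sign(2)[OF z ij(1)] by (simp add: abs_mult)
  then have "\<bar>if i = j then dA * \<lfloor>z $ i\<rfloor> else 0\<bar> \<le> dA" using Abar(3) by (cases "i = j") simp_all
  then show ?thesis
    using ij L abs_triangle_ineq4[of "Abar $$ (i, j)" "if i = j then dA * \<lfloor>z $ i\<rfloor> else 0"]
    by (simp add: shifted_def)
qed

lemma data_bound_ge:
  defines "L \<equiv> data_bound Abar bbar dA db"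
  shows "dA \<le> L" "db \<le> L" "i < n \<Longrightarrow> \<bar>bbar $ i\<bar> \<le> L" "i < n \<Longrightarrow> j < n \<Longrightarrow> \<bar>Abar $$ (i, j)\<bar> \<le> L" "1 \<le> L"
proof -
  show dA: "dA \<le> L" and "db \<le> L" by (auto simp: L_def data_bound_def)
  show "1 \<le> L" using dA Abar(3) by simp
  have "norm_inf bbar \<le> L" "norm_max Abar \<le> L" by (auto simp: L_def data_bound_def)
  moreover have "\<bar>bbar $ i\<bar> \<le> norm_inf bbar" if "i < n" for i
    unfolding norm_inf_def using that Abar(2) by (intro Max_ge) auto
  moreover have "\<bar>Abar $$ (i, j)\<bar> \<le> norm_max Abar" if "i < n" "j < n" for i j
    unfolding norm_max_def using that Abar(1) by (intro Max_ge) (auto intro!: image_eqI[of _ _ "(i, j)"])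
  ultimately show "i < n \<Longrightarrow> \<bar>bbar $ i\<bar> \<le> L" "i < n \<Longrightarrow> j < n \<Longrightarrow> \<bar>Abar $$ (i, j)\<bar> \<le> L"
    by (meson order_trans)+
qed

lemma den_bound:
  assumes z: "z \<in> sign_vecs n"
  defines "L \<equiv> data_bound Abar bbar dA db"
  shows "\<bar>den z\<bar> \<le> (4 * int n ^ 2 * L) ^ n * L"
proof -
  note L = data_bound_ge[folded L_def]
  \<comment> \<open>The index is written as \<open>n - r\<close> with \<open>r = n\<close> to match
    \<open>adj_coeff_bound\<close>; entries of size at most \<open>2 L\<close> turn \<open>G\<close>
    into \<open>4 n^2 L\<close>.\<close>
  have "\<bar>coeff (char_poly (shifted z)) (n - n)\<bar> \<le> (2 * int n ^ 2 * (2 * L)) ^ n"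
  proof (rule adj_coeff_bound(1)[OF shifted_carrier _ _ n])
    show "1 \<le> 2 * L" using L by simp
    show "\<bar>shifted z $$ (i, j)\<bar> \<le> 2 * L" if "i < n" "j < n" for i j
      using L(1) L(4)[OF that] by (intro shifted_bound[OF z that]) simp
  qed simp
  then show ?thesis
    unfolding den_def abs_minus_cancel abs_mult using L Abar(4) by (intro mult_mono) (auto simp: mult_ac)
qed

lemma l1_b_le: "l1 b \<le> of_nat n * of_int (data_bound Abar bbar dA db)"
proof -
  have "\<bar>b $ i\<bar> \<le> of_int (data_bound Abar bbar dA db)" if i: "i < n" for i
  proof -
    have "\<bar>b $ i\<bar> = of_int \<bar>bbar $ i\<bar> / of_int db" using i Abar(2,4) by (simp add: Abar(6) abs_mult)
    also have "\<dots> \<le> of_int \<bar>bbar $ i\<bar> / 1" using Abar(4) by (intro divide_left_mono) auto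
    also have "\<dots> \<le> of_int (data_bound Abar bbar dA db)" using data_bound_ge(3)[OF i] by simp
    finally show ?thesis .
  qed
  then have "(\<Sum>i<n. \<bar>b $ i\<bar>) \<le> (\<Sum>i<n. of_int (data_bound Abar bbar dA db))" by (intro sum_mono) auto
  then show ?thesis by (simp add: l1_eq[OF b])
qed

text \<open>If \<open>n = L = 1\<close>, then \<open>A\<close> is one of -1, 0, 1 and some sign lies
  within distance 1 of it, so \<open>solution_bound\<close> for the vector 1 would give
  \<open>1 - g \<le> g\<close>. For larger \<open>n\<close>, \<open>L \<ge> 1\<close>
  suffices.\<close>

lemma n_data_bound_ge_2: "2 \<le> int n * data_bound Abar bbar dA db"
proof (cases "n = 1")
  case True
  let ?L = "data_bound Abar bbar dA db" and ?a = "Abar $$ (0, 0)"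
  show ?thesis
  proof (rule ccontr)
    assume "\<not> 2 \<le> int n * ?L"
    then have "?L \<le> 1" using True by simp
    then have dA: "dA = 1" and a: "\<bar>?a\<bar> \<le> 1"
      using data_bound_ge(1) data_bound_ge(4)[of 0 0] Abar(3) n by auto
    define z :: "rat vec" where "z = vec n (\<lambda>_. if ?a \<ge> 0 then 1 else -1)"
    have z: "z \<in> sign_vecs n" by (simp add: z_def sign_vecs_def)
    have fz: "\<lfloor>z $ 0\<rfloor> = (if ?a \<ge> 0 then 1 else -1)"
      using floor_of_int[of "- 1", where 'a = rat] n by (simp add: z_def)
    let ?w = "vec n (\<lambda>_. 1) :: rat vec"
    have w: "?w \<in> carrier_vec n" by simp
    have C: "A - Diag z \<in> carrier_mat n n" using A Diag_carrier[OF z] by (intro minus_carrier_mat)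
    have lessThan_n: "{..<n} = {0}" using True by auto
    have "\<bar>shifted z $$ (0, 0)\<bar> \<le> 1" unfolding shifted_def using a n dA fz by auto
    then have "\<bar>of_int (shifted z $$ (0, 0))\<bar> \<le> (1 :: rat)"
      by (metis of_int_abs of_int_le_1_iff)
    then have "l1 ((A - Diag z) *\<^sub>v ?w) \<le> 1"
      using minus_Diag_mult_shifted[OF z w, of 0] n dA lessThan_n
      unfolding l1_eq[OF mult_mat_vec_carrier[OF C w]] lessThan_n by simp
    moreover have "l1 ?w = 1" using True by (simp add: l1_def)
    ultimately have "1 - g \<le> g"
      using solution_bound[OF z w] g mult_left_mono[of "l1 ((A - Diag z) *\<^sub>v ?w)" 1 g] by simp
    then show False using g by simp
  qed
next
  case False
  then have "2 * 1 \<le> int n * data_bound Abar bbar dA db" using n data_bound_ge(5) by (intro mult_mono) auto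
  then show ?thesis by simp
qed

text \<open>Multiplying \<open>run_bound\<close> by the denominator gives
  \<open>\<delta> \<le> exp (- \<kappa> \<delta> k) * N^(4 n + 2)\<close>: one factor
  \<open>N\<close> bounds \<open>g * l1 b\<close>, the other \<open>4 n + 1\<close> bound the
  denominator. Take logarithms and use \<open>4 n + 2 \<le> 6 n\<close>.\<close>

lemma iteration_bound:
  assumes z0: "z0 \<in> sign_vecs n" and run: "capture_run \<kappa> A b z0 S" and \<kappa>: "0 < \<kappa>" "\<kappa> \<le> 1"
    and V: "\<And>j. j \<le> k \<Longrightarrow> mismatch A b (sign_after A b z0 S j) \<noteq> {}"
  defines "\<delta> \<equiv> real_of_rat (1 - 2 * g)"
    and "N \<equiv> real n * real_of_int (data_bound Abar bbar dA db)"
  shows "\<kappa> * \<delta> * real k + ln \<delta> \<le> 6 * real n * ln N"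
proof -
  define L where "L = data_bound Abar bbar dA db"
  have L1: "1 \<le> real_of_int L" using data_bound_ge(5) unfolding L_def by linarith
  have "real_of_int 2 \<le> real_of_int (int n * data_bound Abar bbar dA db)"
    using n_data_bound_ge_2 by (simp only: of_int_le_iff)
  then have N2: "2 \<le> N" by (simp add: N_def)
  have \<delta>: "0 < \<delta>" using g by (simp add: \<delta>_def)
  obtain z i where z: "z \<in> sign_vecs n" and i: "i < n" "x_of A b z $ i \<noteq> 0"
    and le: "real_of_rat ((1 - 2 * g) * \<bar>x_of A b z $ i\<bar>) \<le>
      exp (- (\<kappa> * \<delta> * real k)) * real_of_rat (g * l1 b)"
  proof -
    have "\<exists>z\<in>sign_vecs n. \<exists>i<n. x_of A b z $ i \<noteq> 0 \<and>
      real_of_rat ((1 - 2 * g) * \<bar>x_of A b z $ i\<bar>) \<le>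
        exp (- (\<kappa> * real_of_rat (1 - 2 * g) * k)) * real_of_rat (g * l1 b)"
      by (rule run_bound[OF z0 run _ \<kappa>(2)]) (use \<kappa> V in auto)
    then show thesis using that unfolding \<delta>_def by blast
  qed
  let ?x = "real_of_rat \<bar>x_of A b z $ i\<bar>" and ?D = "real_of_int \<bar>den z\<bar>"
  have "real_of_rat 1 \<le> real_of_rat (\<bar>x_of A b z $ i\<bar> * of_int \<bar>den z\<bar>)"
    using x_of_lower[OF z i] by (simp only: of_rat_less_eq)
  then have x: "1 \<le> ?x * ?D" by (simp only: of_rat_mult of_rat_of_int_eq of_rat_1)
  have "real_of_rat (g * l1 b) \<le> real_of_rat (1 * (of_nat n * of_int L))"
    using g l1_b_le unfolding of_rat_less_eq L_def
    by (intro mult_mono) (auto simp: l1_def intro: sum_nonneg)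
  then have b: "real_of_rat (g * l1 b) \<le> N" by (simp add: N_def L_def of_rat_mult)
  have D: "?D \<le> (N ^ 4) ^ n * N"
  proof -
    have "?D \<le> real_of_int ((4 * int n ^ 2 * L) ^ n * L)"
      using den_bound[OF z] unfolding L_def by (simp only: of_int_le_iff)
    also have "\<dots> = (4 * real n ^ 2 * real_of_int L) ^ n * real_of_int L" by simp
    also have "\<dots> \<le> (N ^ 4) ^ n * N"
    proof (intro mult_mono power_mono)
      show LN: "real_of_int L \<le> N" using n L1 mult_right_mono[of 1 "real n" "real_of_int L"] by (simp add: N_def L_def)
      have nN: "real n \<le> N" using n L1 mult_left_mono[of 1 "real_of_int L" "real n"] by (simp add: N_def L_def)
      \<comment> \<open>The constant 4 is absorbed as well: \<open>N \<ge> 2\<close> gives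
        \<open>4 \<le> N^2\<close>, and \<open>n \<le> N\<close> gives
        \<open>n N \<le> N^2\<close>.\<close>
      have "4 * real n ^ 2 * real_of_int L = 2 ^ 2 * (real n * N)"
        by (simp add: N_def L_def power2_eq_square)
      also have "\<dots> \<le> N ^ 2 * (N * N)" using N2 nN by (intro mult_mono power_mono) auto
      also have "\<dots> = N ^ 4" by (simp add: power2_eq_square power4_eq_xxxx)
      finally show "4 * real n ^ 2 * real_of_int L \<le> N ^ 4" .
    qed (use L1 N2 in auto)
    finally show ?thesis .
  qed
  have "\<delta> \<le> \<delta> * (?x * ?D)" using x \<delta> by simp
  also have "\<dots> = real_of_rat ((1 - 2 * g) * \<bar>x_of A b z $ i\<bar>) * ?D"
    by (simp add: \<delta>_def of_rat_mult)
  also have "\<dots> \<le> (exp (- (\<kappa> * \<delta> * real k)) * N) * ((N ^ 4) ^ n * N)"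
    using le b D N2 by (intro mult_mono order_trans[OF le] mult_left_mono) auto
  also have "\<dots> = exp (- (\<kappa> * \<delta> * real k)) * N ^ (4 * n + 2)"
    by (simp add: power_add power_mult power2_eq_square)
  finally have "ln \<delta> \<le> ln (exp (- (\<kappa> * \<delta> * real k)) * N ^ (4 * n + 2))"
    using \<delta> by (intro ln_mono) auto
  also have "\<dots> = - (\<kappa> * \<delta> * real k) + real (4 * n + 2) * ln N"
    using N2 by (simp add: ln_mult ln_realpow distrib_right)
  finally have "\<kappa> * \<delta> * real k + ln \<delta> \<le> real (4 * n + 2) * ln N" by simp
  also have "\<dots> \<le> (6 * real n) * ln N" using n N2 by (intro mult_right_mono) auto
  finally show ?thesis .
qed

end

section \<open>Cost and correctness of programs\<close>

lemma bits_mono: "\<bar>a\<bar> \<le> \<bar>b\<bar> \<Longrightarrow> bits a \<le> bits b"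
  unfolding bits_def by (auto intro!: floorlog_mono nat_mono)

lemma bits_pos [simp]: "0 < bits a" "Suc 0 \<le> bits a"
  by (auto simp: bits_def)

text \<open>The shift by one is the sign bit.\<close>

lemma bits_le_iff: "bits a \<le> Suc k \<longleftrightarrow> \<bar>a\<bar> < 2 ^ k"
proof -
  have "floorlog 2 (nat \<bar>a\<bar>) \<le> k \<longleftrightarrow> nat \<bar>a\<bar> < 2 ^ k"
    by (simp add: floorlog_le_iff)
  then show ?thesis by (auto simp: bits_def nat_less_iff)
qed

lemma abs_less_bits: "\<bar>a\<bar> < 2 ^ (bits a - 1)"
  using bits_le_iff[of a "bits a - 1"] by simp

lemma bits_add: "bits (a + b) \<le> bits a + bits b"
proof -
  define i where "i = bits a - 1"
  define j where "j = bits b - 1"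
  have a: "\<bar>a\<bar> < 2 ^ i" and b: "\<bar>b\<bar> < 2 ^ j" and e: "bits a = Suc i" "bits b = Suc j"
    using abs_less_bits[of a] abs_less_bits[of b] by (auto simp: i_def j_def)
  have "(2::int) ^ i + 2 ^ j \<le> 2 * 2 ^ (i + j)"
  proof -
    have "(2::int) ^ i \<le> 2 ^ (i + j)" "(2::int) ^ j \<le> 2 ^ (i + j)" by simp_all
    then show ?thesis by linarith
  qed
  then have "\<bar>a + b\<bar> < 2 ^ (Suc (i + j))" using a b by simp
  then show ?thesis using e bits_le_iff[of "a + b" "Suc (i + j)"] by simp
qed

lemma bits_uminus [simp]: "bits (- a) = bits a"
  by (simp add: bits_def)

lemma bits_diff: "bits (a - b) \<le> bits a + bits b"
  using bits_add[of a "- b"] by simp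

lemma bits_mult: "bits (a * b) \<le> bits a + bits b"
proof -
  define i where "i = bits a - 1"
  define j where "j = bits b - 1"
  have a: "\<bar>a\<bar> < 2 ^ i" and b: "\<bar>b\<bar> < 2 ^ j" and e: "bits a = Suc i" "bits b = Suc j"
    using abs_less_bits[of a] abs_less_bits[of b] by (auto simp: i_def j_def)
  have "\<bar>a * b\<bar> < 2 ^ (i + j)"
    unfolding abs_mult power_add using a b by (intro mult_strict_mono') auto
  then show ?thesis using e bits_le_iff[of "a * b" "i + j"] by simp
qed

text \<open>Rounding is towards minus infinity, so a negative quotient may grow in absolute value,
  but with a positive divisor it never falls below the dividend.\<close>

lemma abs_div_le: "\<bar>a div b\<bar> \<le> \<bar>a\<bar>" for a b :: int
proof -
  have pos: "\<bar>a div b\<bar> \<le> \<bar>a\<bar>" if b: "0 < b" for a b :: int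
  proof (cases "a \<ge> 0")
    case True
    then show ?thesis using b zdiv_mono2[of a 1 b] pos_imp_zdiv_nonneg_iff[of b a] by simp
  next
    case False
    then have "a \<le> a div b" "a div b < 0"
      using b zdiv_mono2_neg[of a 1 b] by (simp_all add: pos_imp_zdiv_neg_iff)
    then show ?thesis by linarith
  qed
  consider "b = 0" | "b > 0" | "b < 0" by linarith
  then show ?thesis
    using pos[of b a] pos[of "- b" "- a"] by cases auto
qed

lemma bits_div: "bits (a div b) \<le> bits a"
  by (rule bits_mono) (rule abs_div_le)

lemma bits_power: "bits (a ^ k) \<le> k * bits a + 2"
proof (induction k)
  case 0
  show ?case using bits_le_iff[of 1 1] by simp
next
  case (Suc k)
  then show ?case using bits_mult[of a "a ^ k"] by simp
qed

text \<open>A multiplier for bit lengths: a constant counts its own bits, a cell access counts as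
  one stored value. Adding the operands is right for all four operations, because sums, differences,
  products and quotients have at most the bits of both operands together.\<close>

primrec asize :: "aexp \<Rightarrow> nat" where
  "asize (Const k) = bits k"
| "asize (Cell x e1 e2) = asize e1 + asize e2 + 1"
| "asize (Plus e1 e2) = asize e1 + asize e2"
| "asize (Minus e1 e2) = asize e1 + asize e2"
| "asize (Times e1 e2) = asize e1 + asize e2"
| "asize (Div e1 e2) = asize e1 + asize e2"

definition bounded_store :: "nat \<Rightarrow> store \<Rightarrow> bool" where
  "bounded_store W s \<longleftrightarrow> (\<forall>l. bits (s l) \<le> W)"

lemma bounded_store_pos: "bounded_store W s \<Longrightarrow> 0 < W"
  unfolding bounded_store_def using bits_pos(1) by (meson less_le_trans)

lemma asize_pos: "0 < asize e"
  by (induction e) auto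

lemma bits_aval: "bounded_store W s \<Longrightarrow> bits (aval e s) \<le> asize e * W"
proof (induction e)
  case (Const k)
  then show ?case using bounded_store_pos[of W s] by simp
next
  case (Cell x e1 e2)
  then show ?case by (simp add: bounded_store_def trans_le_add1)
next
  case (Plus e1 e2)
  then show ?case using bits_add[of "aval e1 s" "aval e2 s"] by (simp add: add_mult_distrib)
next
  case (Minus e1 e2)
  then show ?case using bits_diff[of "aval e1 s" "aval e2 s"] by (simp add: add_mult_distrib)
next
  case (Times e1 e2)
  then show ?case using bits_mult[of "aval e1 s" "aval e2 s"] by (simp add: add_mult_distrib)
next
  case (Div e1 e2)
  then show ?case using bits_div[of "aval e1 s" "aval e2 s"] by (simp add: add_mult_distrib)
qed

text \<open>A cube is superadditive with enough slack to absorb what an operation charges, be it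
  \<open>a + b\<close> or \<open>a * b\<close>; this closes the induction in
  \<open>acost_le\<close>.\<close>

lemma cube_add: "0 < a \<Longrightarrow> 0 < b \<Longrightarrow> a ^ 3 + b ^ 3 + a + b + a * b \<le> (a + b) ^ 3" for a b :: nat
proof -
  assume "0 < a" "0 < b"
  then obtain x y where [simp]: "a = Suc x" "b = Suc y" by (metis gr0_implies_Suc)
  show ?thesis by (simp add: power3_eq_cube algebra_simps)
qed

lemma acost_le:
  assumes "bounded_store W s"
  shows "acost e s \<le> asize e ^ 3 * W\<^sup>2"
proof -
  have W: "W \<le> W\<^sup>2" using bounded_store_pos[OF assms] by (simp add: power2_eq_square)
  have binop: "acost e1 s + acost e2 s + k \<le> (asize e1 + asize e2) ^ 3 * W\<^sup>2"
    if IH: "acost e1 s \<le> asize e1 ^ 3 * W\<^sup>2" "acost e2 s \<le> asize e2 ^ 3 * W\<^sup>2"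
      and k: "k = bits (aval e1 s) + bits (aval e2 s) \<or> k = bits (aval e1 s) * bits (aval e2 s)"
    for e1 e2 k
  proof -
    let ?a = "asize e1" and ?b = "asize e2"
    have "bits (aval e1 s) + bits (aval e2 s) \<le> (?a + ?b) * W\<^sup>2"
    proof -
      have "bits (aval e1 s) + bits (aval e2 s) \<le> (?a + ?b) * W"
        using bits_aval[OF assms, of e1] bits_aval[OF assms, of e2] by (simp add: add_mult_distrib)
      also have "\<dots> \<le> (?a + ?b) * W\<^sup>2" using W by (rule mult_le_mono2)
      finally show ?thesis .
    qed
    moreover have "bits (aval e1 s) * bits (aval e2 s) \<le> (?a * ?b) * W\<^sup>2"
      using mult_le_mono[OF bits_aval[OF assms, of e1] bits_aval[OF assms, of e2]]
      by (simp add: power2_eq_square mult_ac)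
    ultimately have "k \<le> (?a + ?b + ?a * ?b) * W\<^sup>2"
      using k by (auto simp: add_mult_distrib)
    then have "acost e1 s + acost e2 s + k \<le> (?a ^ 3 + ?b ^ 3 + ?a + ?b + ?a * ?b) * W\<^sup>2"
      using IH by (simp add: add_mult_distrib)
    also have "\<dots> \<le> (?a + ?b) ^ 3 * W\<^sup>2"
      using cube_add[OF asize_pos asize_pos] by (intro mult_right_mono) auto
    finally show ?thesis .
  qed
  show ?thesis
  proof (induction e)
    case (Const k)
    have "bits k * 1 \<le> bits k ^ 3 * W\<^sup>2"
      using bounded_store_pos[OF assms] by (intro mult_mono self_le_power) (auto simp: Suc_le_eq)
    then show ?case by simp
  next
    case (Cell x e1 e2)
    let ?a = "asize e1" and ?b = "asize e2"
    have W: "W \<le> W\<^sup>2" using bounded_store_pos[OF assms] by (simp add: power2_eq_square)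
    have c: "?a ^ 3 + ?b ^ 3 + ?a + ?b + 1 \<le> (?a + ?b + 1) ^ 3"
      by (simp add: power3_eq_cube algebra_simps)
    have "acost (Cell x e1 e2) s \<le> ?a ^ 3 * W\<^sup>2 + ?b ^ 3 * W\<^sup>2 + ?a * W + ?b * W + W"
      using Cell bits_aval[OF assms, of e1] bits_aval[OF assms, of e2] assms
      by (auto simp: bounded_store_def intro!: add_mono)
    also have "\<dots> \<le> ?a ^ 3 * W\<^sup>2 + ?b ^ 3 * W\<^sup>2 + ?a * W\<^sup>2 + ?b * W\<^sup>2 + 1 * W\<^sup>2"
      using W by (intro add_mono mult_mono) auto
    also have "\<dots> = (?a ^ 3 + ?b ^ 3 + ?a + ?b + 1) * W\<^sup>2" by (simp add: algebra_simps)
    also have "\<dots> \<le> (?a + ?b + 1) ^ 3 * W\<^sup>2" using c by (intro mult_right_mono) auto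
    finally show ?case by simp
  next
    case (Plus e1 e2)
    then show ?case using binop[of e1 e2 "bits (aval e1 s) + bits (aval e2 s)"] assms by simp
  next
    case (Minus e1 e2)
    then show ?case using binop[of e1 e2 "bits (aval e1 s) + bits (aval e2 s)"] by simp
  next
    case (Times e1 e2)
    then show ?case using binop[of e1 e2 "bits (aval e1 s) * bits (aval e2 s)"] by simp
  next
    case (Div e1 e2)
    then show ?case using binop[of e1 e2 "bits (aval e1 s) * bits (aval e2 s)"] by simp
  qed
qed

text \<open>
  Cost in units of the squared bit length of the store, provided that every while loop makes at
  most \<open>n\<close> passes.
\<close>

primrec fsteps :: "nat \<Rightarrow> com \<Rightarrow> nat" where
  "fsteps n Skip = 1"
| "fsteps n (Assign x e1 e2 e) = (asize e1 + asize e2 + asize e) ^ 3"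
| "fsteps n (Seq P Q) = fsteps n P + fsteps n Q"
| "fsteps n (IfPos e P Q) = asize e ^ 3 + 1 + fsteps n P + fsteps n Q"
| "fsteps n (WhilePos e P) = (n + 1) * (asize e ^ 3 + 1 + fsteps n P)"

primrec writes :: "com \<Rightarrow> string set" where
  "writes Skip = {}"
| "writes (Assign x e1 e2 e) = {x}"
| "writes (Seq P Q) = writes P \<union> writes Q"
| "writes (IfPos e P Q) = writes P \<union> writes Q"
| "writes (WhilePos e P) = writes P"

section \<open>Total correctness with cost and size bounds\<close>

lemma exec_frame: "exec P s t s' \<Longrightarrow> fst l \<notin> writes P \<Longrightarrow> s' l = s l"
  by (induction rule: exec.induct) auto

text \<open>The start store is a fixed store, not a precondition, so postconditions can mention its
  cells directly and \<open>triple_Seq\<close> can nest one triple in the postcondition of another.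
  Boundedness is assumed and re-established, because it is what converts a step count into a
  cost.\<close>

definition triple :: "nat \<Rightarrow> nat \<Rightarrow> com \<Rightarrow> store \<Rightarrow> (store \<Rightarrow> bool) \<Rightarrow> bool" where
  "triple n W P s Q \<longleftrightarrow>
     (bounded_store W s \<longrightarrow> (\<exists>t s'. exec P s t s' \<and> t \<le> fsteps n P * W\<^sup>2 \<and> bounded_store W s' \<and> Q s'))"

lemma tripleI:
  assumes "bounded_store W s \<Longrightarrow> \<exists>t s'. exec P s t s' \<and> t \<le> fsteps n P * W\<^sup>2 \<and> bounded_store W s' \<and> Q s'"
  shows "triple n W P s Q"
  using assms by (simp add: triple_def)

text \<open>The frame property is built in, so specifications of programs need not list the cells
  they leave alone.\<close>

lemma triple_conseq:
  assumes "triple n W P s Q"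
    and "\<And>s'. bounded_store W s' \<Longrightarrow> Q s' \<Longrightarrow> (\<And>l. fst l \<notin> writes P \<Longrightarrow> s' l = s l) \<Longrightarrow> R s'"
  shows "triple n W P s R"
  using assms exec_frame unfolding triple_def by metis

lemma triple_bounded: "(bounded_store W s \<Longrightarrow> triple n W P s Q) \<Longrightarrow> triple n W P s Q"
  by (simp add: triple_def)

lemma triple_Skip: "Q s \<Longrightarrow> triple n W Skip s Q"
  by (rule tripleI) (use bounded_store_pos[of W s] exec_Skip in fastforce)

text \<open>Only the stored value has to fit into \<open>W\<close>; intermediate values and cell
  indices are covered by \<open>asize\<close>.\<close>

lemma triple_Assign:
  assumes "bits (aval e s) \<le> W" "Q (s((x, aval e1 s, aval e2 s) := aval e s))"
  shows "triple n W (Assign x e1 e2 e) s Q"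
proof (rule tripleI)
  assume W: "bounded_store W s"
  let ?a = "asize e1" and ?b = "asize e2" and ?c = "asize e"
  have W2: "W \<le> W\<^sup>2" using bounded_store_pos[OF W] by (simp add: power2_eq_square)
  have "bits (aval e s) \<le> ?c * W\<^sup>2"
    using mult_le_mono[of 1 "?c" W "W\<^sup>2"] assms(1) W2 asize_pos[of e] by simp
  moreover have "bits (aval e1 s) \<le> ?a * W\<^sup>2" "bits (aval e2 s) \<le> ?b * W\<^sup>2"
    using bits_aval[OF W, of e1] bits_aval[OF W, of e2] mult_le_mono2[OF W2] le_trans by blast+
  moreover note acost_le[OF W, of e1] acost_le[OF W, of e2] acost_le[OF W, of e]
  ultimately have "acost e1 s + acost e2 s + acost e s + bits (aval e1 s) + bits (aval e2 s)
      + bits (aval e s) \<le> (?a ^ 3 + ?b ^ 3 + ?c ^ 3 + ?a + ?b + ?c) * W\<^sup>2"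
    by (simp add: add_mult_distrib)
  also have "\<dots> \<le> (?a + ?b + ?c) ^ 3 * W\<^sup>2"
    using cube_add[OF asize_pos[of e1] asize_pos[of e2]]
      cube_add[of "?a + ?b" ?c] asize_pos[of e1] asize_pos[of e]
    by (intro mult_right_mono) auto
  finally have "acost e1 s + acost e2 s + acost e s + bits (aval e1 s) + bits (aval e2 s)
      + bits (aval e s) \<le> fsteps n (Assign x e1 e2 e) * W\<^sup>2" by simp
  moreover have "bounded_store W (s((x, aval e1 s, aval e2 s) := aval e s))"
    using W assms(1) by (simp add: bounded_store_def)
  ultimately show "\<exists>t s'. exec (Assign x e1 e2 e) s t s' \<and>
      t \<le> fsteps n (Assign x e1 e2 e) * W\<^sup>2 \<and> bounded_store W s' \<and> Q s'"
    using assms(2) exec_Assign[of x e1 e2 e s] by blast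
qed

lemma triple_Seq:
  assumes "triple n W P s (\<lambda>s'. triple n W Q s' R)"
  shows "triple n W (Seq P Q) s R"
proof (rule tripleI)
  assume "bounded_store W s"
  then obtain t s' t' s'' where "exec P s t s'" "t \<le> fsteps n P * W\<^sup>2"
    and "exec Q s' t' s''" "t' \<le> fsteps n Q * W\<^sup>2" "bounded_store W s''" "R s''"
    using assms by (auto simp: triple_def)
  then show "\<exists>t s'. exec (Seq P Q) s t s' \<and> t \<le> fsteps n (Seq P Q) * W\<^sup>2 \<and> bounded_store W s' \<and> R s'"
    by (intro exI[of _ "t + t'"] exI[of _ s'']) (auto simp: add_mult_distrib intro: exec_Seq)
qed

lemma triple_IfPos:
  assumes "aval e s > 0 \<Longrightarrow> triple n W P s R" "\<not> aval e s > 0 \<Longrightarrow> triple n W Q s R"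
  shows "triple n W (IfPos e P Q) s R"
proof (rule tripleI)
  assume W: "bounded_store W s"
  have W1: "1 \<le> W\<^sup>2" using bounded_store_pos[OF W] by simp
  obtain t s' where "exec (IfPos e P Q) s (acost e s + t + 1) s'"
    and t: "t \<le> (fsteps n P + fsteps n Q) * W\<^sup>2" and s': "bounded_store W s'" "R s'"
  proof (cases "aval e s > 0")
    case True
    then obtain t s' where "exec P s t s'" "t \<le> fsteps n P * W\<^sup>2" "bounded_store W s'" "R s'"
      using assms(1) W by (auto simp: triple_def)
    with that[of t s'] exec_IfTrue[of e s P t s' Q] True show ?thesis by (simp add: add_mult_distrib)
  next
    case False
    then obtain t s' where "exec Q s t s'" "t \<le> fsteps n Q * W\<^sup>2" "bounded_store W s'" "R s'"
      using assms(2) W by (auto simp: triple_def)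
    with that[of t s'] exec_IfFalse[of e s Q t s' P] False show ?thesis by (simp add: add_mult_distrib)
  qed
  moreover have "acost e s + t + 1 \<le> fsteps n (IfPos e P Q) * W\<^sup>2"
    using acost_le[OF W, of e] t W1 by (simp add: add_mult_distrib)
  ultimately show "\<exists>t s'. exec (IfPos e P Q) s t s' \<and> t \<le> fsteps n (IfPos e P Q) * W\<^sup>2 \<and> bounded_store W s' \<and> R s'"
    by blast
qed

text \<open>The number \<open>N\<close> of passes is free here, whereas \<open>fsteps\<close>
  charges for \<open>n\<close>: counting loops take \<open>N = n\<close>, the outer loop of the
  algorithm takes \<open>N = Suc T\<close>.\<close>

lemma exec_WhilePos:
  assumes "I 0 s" "bounded_store W s"
    and step: "\<And>k s. k < N \<Longrightarrow> I k s \<Longrightarrow> bounded_store W s \<Longrightarrow> 0 < aval e s \<and> triple n W P s (I (Suc k))"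
    and stop: "\<And>s. I N s \<Longrightarrow> \<not> 0 < aval e s"
  shows "\<exists>t s'. exec (WhilePos e P) s t s' \<and> t \<le> (N + 1) * (asize e ^ 3 + 1 + fsteps n P) * W\<^sup>2
    \<and> bounded_store W s' \<and> I N s'"
proof -
  \<comment> \<open>Induction on the number \<open>m\<close> of passes still to come.\<close>
  have "\<exists>t s'. exec (WhilePos e P) s t s' \<and> t \<le> (m + 1) * (asize e ^ 3 + 1 + fsteps n P) * W\<^sup>2
    \<and> bounded_store W s' \<and> I N s'" if "m \<le> N" "I (N - m) s" "bounded_store W s" for m s
    using that
  proof (induction m arbitrary: s)
    case 0
    have "1 \<le> W\<^sup>2" using bounded_store_pos[OF 0(3)] by simp
    then have "acost e s + 1 \<le> (asize e ^ 3 + 1 + fsteps n P) * W\<^sup>2"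
      using acost_le[OF 0(3), of e] unfolding add_mult_distrib by linarith
    then show ?case using 0 stop[of s] exec_WhileFalse[of e s P] by fastforce
  next
    case (Suc m)
    let ?K = "asize e ^ 3 + 1 + fsteps n P"
    have pos: "0 < aval e s" and "triple n W P s (I (Suc (N - Suc m)))"
      using step[of "N - Suc m" s] Suc.prems by auto
    then obtain t s' where P: "exec P s t s'" "t \<le> fsteps n P * W\<^sup>2" "bounded_store W s'" "I (N - m) s'"
      using Suc.prems by (auto simp: triple_def Suc_diff_Suc)
    then obtain t' s'' where Q: "exec (WhilePos e P) s' t' s''" "t' \<le> (m + 1) * ?K * W\<^sup>2"
      "bounded_store W s''" "I N s''"
      using Suc.IH[of s'] Suc.prems(1) by auto
    have "acost e s + t + t' + 1 \<le> (asize e ^ 3) * W\<^sup>2 + fsteps n P * W\<^sup>2 + (m + 1) * ?K * W\<^sup>2 + 1 * W\<^sup>2"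
      using acost_le[OF Suc.prems(3), of e] P(2) Q(2) bounded_store_pos[OF P(3)] by (intro add_mono) auto
    also have "\<dots> = (Suc m + 1) * ?K * W\<^sup>2" by (simp add: algebra_simps)
    finally show ?case using exec_WhileTrue[OF pos P(1) Q(1)] Q(3,4) by blast
  qed
  from this[of N s] show ?thesis using assms(1,2) by simp
qed

abbreviation Var :: "string \<Rightarrow> aexp" where
  "Var x \<equiv> Cell x (Const 0) (Const 0)"

abbreviation Set :: "string \<Rightarrow> aexp \<Rightarrow> com" where
  "Set x e \<equiv> Assign x (Const 0) (Const 0) e"

text \<open>Every loop inside an iteration has this form, which justifies charging \<open>n\<close>
  passes per loop in \<open>fsteps\<close>.\<close>

definition For :: "string \<Rightarrow> com \<Rightarrow> com" where
  "For v P = Seq (Set v (Const 0))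
     (WhilePos (Minus (Var ''n'') (Var v)) (Seq P (Set v (Plus (Var v) (Const 1)))))"

lemma writes_For [simp]: "writes (For v P) = insert v (writes P)"
  by (auto simp: For_def)

lemma triple_For:
  assumes n: "s0 (''n'', 0, 0) = int n" "''n'' \<notin> insert v (writes P)" "v \<notin> writes P"
    and I0: "\<And>s. (\<And>l. fst l \<noteq> v \<Longrightarrow> s l = s0 l) \<Longrightarrow> I 0 s"
    and step: "\<And>j s. j < n \<Longrightarrow> s (v, 0, 0) = int j \<Longrightarrow> I j s \<Longrightarrow>
        (\<And>l. fst l \<notin> insert v (writes P) \<Longrightarrow> s l = s0 l) \<Longrightarrow>
        triple n W P s (\<lambda>s'. I (Suc j) (s'((v, 0, 0) := int (Suc j))))"
    and Q: "\<And>s. I n s \<Longrightarrow> (\<And>l. fst l \<notin> insert v (writes P) \<Longrightarrow> s l = s0 l) \<Longrightarrow> Q s"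
  shows "triple n W (For v P) s0 Q"
proof (rule triple_bounded)
  assume W: "bounded_store W s0"
  have bn: "bits (int j) \<le> W" if "j \<le> n" for j
    using that W n(1) bits_mono[of "int j" "int n"] unfolding bounded_store_def
    by (metis abs_of_nat le_trans of_nat_mono)
  let ?B = "Seq P (Set v (Plus (Var v) (Const 1)))"
  let ?I = "\<lambda>j s. I j s \<and> s (v, 0, 0) = int j \<and> (\<forall>l. fst l \<notin> insert v (writes P) \<longrightarrow> s l = s0 l)"
  show ?thesis
    unfolding For_def
  proof (rule triple_Seq, rule triple_Assign)
    show "bits (aval (Const 0) s0) \<le> W" using bn[of 0] by simp
    let ?s = "s0((v, aval (Const 0) s0, aval (Const 0) s0) := aval (Const 0) s0)"
    have "?I 0 ?s" using I0[of ?s] by auto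
    then have "triple n W (WhilePos (Minus (Var ''n'') (Var v)) ?B) ?s (?I n)"
    proof (intro tripleI, subst fsteps.simps, intro exec_WhilePos)
      assume "?I 0 ?s" "bounded_store W ?s"
      then show "?I 0 ?s" "bounded_store W ?s" by blast+
    next
      fix k s assume k: "k < n" and I: "?I k s"
      have "triple n W P s (\<lambda>s'. I (Suc k) (s'((v, 0, 0) := int (Suc k))))"
        using step[of k s] k I by auto
      then have "triple n W P s (\<lambda>s'. triple n W (Set v (Plus (Var v) (Const 1))) s' (?I (Suc k)))"
        apply (rule triple_conseq)
        using n(3) I bn[of "Suc k"] k by (intro triple_Assign) (auto simp: add.commute)
      then show "0 < aval (Minus (Var ''n'') (Var v)) s \<and> triple n W ?B s (?I (Suc k))"
        using I k n by (auto intro: triple_Seq)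
    next
      fix s assume "?I n s"
      then show "\<not> 0 < aval (Minus (Var ''n'') (Var v)) s" using n by auto
    qed
    then show "triple n W (WhilePos (Minus (Var ''n'') (Var v)) ?B) ?s Q"
      by (rule triple_conseq) (use Q in auto)
  qed
qed

lemma fsteps_le: "\<exists>a k. \<forall>n. fsteps n P \<le> a * (n + 1) ^ k"
proof (induction P)
  case (Seq P Q)
  then obtain a k b m where *: "\<And>n. fsteps n P \<le> a * (n + 1) ^ k" "\<And>n. fsteps n Q \<le> b * (n + 1) ^ m"
    by auto
  have "fsteps n (Seq P Q) \<le> (a + b) * (n + 1) ^ (k + m)" for n
  proof -
    have "fsteps n (Seq P Q) \<le> a * (n + 1) ^ k + b * (n + 1) ^ m"
      using *(1)[of n] *(2)[of n] by simp
    also have "\<dots> \<le> a * (n + 1) ^ (k + m) + b * (n + 1) ^ (k + m)"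
      by (intro add_mono mult_le_mono2 power_increasing) auto
    finally show ?thesis by (simp add: add_mult_distrib)
  qed
  then show ?case by blast
next
  case (IfPos e P Q)
  then obtain a k b m where *: "\<And>n. fsteps n P \<le> a * (n + 1) ^ k" "\<And>n. fsteps n Q \<le> b * (n + 1) ^ m"
    by auto
  have "fsteps n (IfPos e P Q) \<le> (asize e ^ 3 + 1 + a + b) * (n + 1) ^ (k + m)" for n
  proof -
    have "fsteps n (IfPos e P Q) \<le> (asize e ^ 3 + 1) * 1 + a * (n + 1) ^ k + b * (n + 1) ^ m"
      using *(1)[of n] *(2)[of n] by simp
    also have "\<dots> \<le> (asize e ^ 3 + 1) * (n + 1) ^ (k + m) + a * (n + 1) ^ (k + m) + b * (n + 1) ^ (k + m)"
      by (intro add_mono mult_le_mono2 power_increasing one_le_power) auto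
    finally show ?thesis by (simp add: add_mult_distrib)
  qed
  then show ?case by blast
next
  case (WhilePos e P)
  then obtain a k where *: "\<And>n. fsteps n P \<le> a * (n + 1) ^ k"
    by auto
  have "fsteps n (WhilePos e P) \<le> (asize e ^ 3 + 1 + a) * (n + 1) ^ (Suc k)" for n
  proof -
    have "fsteps n (WhilePos e P) \<le> (n + 1) * ((asize e ^ 3 + 1) * 1 + a * (n + 1) ^ k)"
      using *(1)[of n] unfolding fsteps.simps by (intro mult_le_mono2) simp
    also have "\<dots> \<le> (n + 1) * ((asize e ^ 3 + 1) * (n + 1) ^ k + a * (n + 1) ^ k)"
      by (intro add_mono mult_le_mono2 power_increasing one_le_power) auto
    also have "\<dots> = (asize e ^ 3 + 1 + a) * (n + 1) ^ (Suc k)" by (simp add: algebra_simps)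
    finally show ?thesis .
  qed
  then show ?case by blast
next
  case (Assign x e1 e2 e)
  show ?case by (intro exI[of _ "(asize e1 + asize e2 + asize e) ^ 3"] exI[of _ 0]) simp
next
  case Skip
  show ?case by (intro exI[of _ 1] exI[of _ 0]) simp
qed

text \<open>For loops that fill arrays: pass \<open>j\<close> gives the cells in \<open>C j\<close>
  their final values, all described by one function \<open>f\<close>, while the contents of the
  scratch names \<open>N\<close> stay open. This fixes the invariant once and for all; a body may
  rely on initial values in cells that no earlier pass has filled.\<close>

lemma triple_For_cells:
  assumes n: "s0 (''n'', 0, 0) = int n" "''n'' \<notin> insert v (writes P)" "v \<notin> writes P"
    and C: "\<And>j l. j < n \<Longrightarrow> l \<in> C j \<Longrightarrow> fst l \<notin> insert v N"
    and body: "\<And>j s. j < n \<Longrightarrow> s (v, 0, 0) = int j \<Longrightarrow>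
        (\<And>l. fst l \<notin> insert v (writes P) \<Longrightarrow> s l = s0 l) \<Longrightarrow>
        (\<And>l. fst l \<notin> insert v N \<Longrightarrow> \<forall>i<j. l \<notin> C i \<Longrightarrow> s l = s0 l) \<Longrightarrow>
        triple n W P s (\<lambda>s'. \<forall>l. fst l \<notin> N \<longrightarrow> s' l = (if l \<in> C j then f l else s l))"
    and Q: "\<And>s. (\<And>l. fst l \<notin> insert v (writes P) \<Longrightarrow> s l = s0 l) \<Longrightarrow>
        (\<And>l. fst l \<notin> insert v N \<Longrightarrow> s l = (if \<exists>j<n. l \<in> C j then f l else s0 l)) \<Longrightarrow> Q s"
  shows "triple n W (For v P) s0 Q"
proof (rule triple_For[where I = "\<lambda>j s. \<forall>l. fst l \<notin> insert v N \<longrightarrow>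
    s l = (if \<exists>i<j. l \<in> C i then f l else s0 l)"])
  fix j s
  assume j: "j < n" and v: "s (v, 0, 0) = int j"
    and I: "\<forall>l. fst l \<notin> insert v N \<longrightarrow> s l = (if \<exists>i<j. l \<in> C i then f l else s0 l)"
    and frame: "\<And>l. fst l \<notin> insert v (writes P) \<Longrightarrow> s l = s0 l"
  have "triple n W P s (\<lambda>s'. \<forall>l. fst l \<notin> N \<longrightarrow> s' l = (if l \<in> C j then f l else s l))"
    using j v I frame by (intro body) auto
  then show "triple n W P s (\<lambda>s'. \<forall>l. fst l \<notin> insert v N \<longrightarrow>
      (s'((v, 0, 0) := int (Suc j))) l = (if \<exists>i<Suc j. l \<in> C i then f l else s0 l))"
  proof (rule triple_conseq, intro allI impI)
    fix s' and l :: loc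
    assume *: "\<forall>l. fst l \<notin> N \<longrightarrow> s' l = (if l \<in> C j then f l else s l)" "fst l \<notin> insert v N"
    have "l \<noteq> (v, 0, 0)" using *(2) by auto
    moreover have "s' l = (if l \<in> C j then f l else s l)" using *(1)[rule_format, of l] *(2) by simp
    moreover have "s l = (if \<exists>i<j. l \<in> C i then f l else s0 l)" using I[rule_format, of l] *(2) by simp
    ultimately show "(s'((v, 0, 0) := int (Suc j))) l = (if \<exists>i<Suc j. l \<in> C i then f l else s0 l)"
      by (auto simp: less_Suc_eq)
  qed
qed (use n Q in auto)

text \<open>Since the cell sets are disjoint, a body finds its own cells as they were initially
  wherever the pass stands in the double loop, and the order of the passes disappears from the
  obligation.\<close>

lemma triple_For_For_cells:
  assumes n: "s0 (''n'', 0, 0) = int n" "''n'' \<notin> insert v (insert w (writes P))"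
      "v \<notin> insert w (writes P)" "w \<notin> writes P"
    and C: "\<And>i j l. i < n \<Longrightarrow> j < n \<Longrightarrow> l \<in> C i j \<Longrightarrow> fst l \<notin> insert v (insert w N)"
    and disj: "\<And>i j i' j' l. l \<in> C i j \<Longrightarrow> l \<in> C i' j' \<Longrightarrow> i = i' \<and> j = j'"
    and v: "v \<notin> N"
    and body: "\<And>i j s. i < n \<Longrightarrow> j < n \<Longrightarrow> s (v, 0, 0) = int i \<Longrightarrow> s (w, 0, 0) = int j \<Longrightarrow>
        (\<And>l. fst l \<notin> insert v (insert w (writes P)) \<Longrightarrow> s l = s0 l) \<Longrightarrow>
        (\<And>l. fst l \<notin> insert v (insert w N) \<Longrightarrow> \<forall>i' j'. (i', j') \<noteq> (i, j) \<longrightarrow> l \<notin> C i' j' \<Longrightarrow> s l = s0 l) \<Longrightarrow>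
        (\<And>l. l \<in> C i j \<Longrightarrow> s l = s0 l) \<Longrightarrow>
        triple n W P s (\<lambda>s'. \<forall>l. fst l \<notin> N \<longrightarrow> s' l = (if l \<in> C i j then f l else s l))"
    and Q: "\<And>s. (\<And>l. fst l \<notin> insert v (insert w (writes P)) \<Longrightarrow> s l = s0 l) \<Longrightarrow>
        (\<And>l. fst l \<notin> insert v (insert w N) \<Longrightarrow>
          s l = (if \<exists>i<n. \<exists>j<n. l \<in> C i j then f l else s0 l)) \<Longrightarrow> Q s"
  shows "triple n W (For v (For w P)) s0 Q"
proof (rule triple_For_cells[where C = "\<lambda>i. \<Union>j<n. C i j" and N = "insert w N" and f = f])
  fix i s
  assume i: "i < n" "s (v, 0, 0) = int i"
    and s: "\<And>l. fst l \<notin> insert v (writes (For w P)) \<Longrightarrow> s l = s0 l"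
      "\<And>l. fst l \<notin> insert v (insert w N) \<Longrightarrow> \<forall>i'<i. l \<notin> (\<Union>j<n. C i' j) \<Longrightarrow> s l = s0 l"
  show "triple n W (For w P) s (\<lambda>s'. \<forall>l. fst l \<notin> insert w N \<longrightarrow> s' l = (if l \<in> (\<Union>j<n. C i j) then f l else s l))"
  proof (rule triple_For_cells[where C = "C i" and N = N and f = f])
    show "s (''n'', 0, 0) = int n" using s(1)[of "(''n'', 0, 0)"] n by simp
  next
    fix j s'
    assume j: "j < n" "s' (w, 0, 0) = int j"
      and s': "\<And>l. fst l \<notin> insert w (writes P) \<Longrightarrow> s' l = s l"
        "\<And>l. fst l \<notin> insert w N \<Longrightarrow> \<forall>i'<j. l \<notin> C i i' \<Longrightarrow> s' l = s l"
    have 1: "s' l = s0 l" if "fst l \<notin> insert v (insert w N)" "\<forall>i'<i. l \<notin> (\<Union>j<n. C i' j)" "\<forall>j'<j. l \<notin> C i j'" for l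
      using that s(2)[of l] s'(2)[of l] by auto
    show "triple n W P s' (\<lambda>s'a. \<forall>l. fst l \<notin> N \<longrightarrow> s'a l = (if l \<in> C i j then f l else s' l))"
    proof (rule body[of i j s'])
      show "s' (v, 0, 0) = int i" using s'(1)[of "(v, 0, 0)"] i n by simp
    next
      show "i < n" "j < n" "s' (w, 0, 0) = int j" by fact+
    next
      fix l :: loc assume "fst l \<notin> insert v (insert w (writes P))"
      then show "s' l = s0 l" using s(1)[of l] s'(1)[of l] by simp
    next
      fix l :: loc assume "fst l \<notin> insert v (insert w N)" "\<forall>i' j'. (i', j') \<noteq> (i, j) \<longrightarrow> l \<notin> C i' j'"
      then show "s' l = s0 l" by (intro 1) auto
    next
      fix l assume l: "l \<in> C i j"
      then have u: "l \<notin> C i' j'" if "(i', j') \<noteq> (i, j)" for i' j' using disj that by blast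
      show "s' l = s0 l"
      proof (rule 1)
        show "fst l \<notin> insert v (insert w N)" using C[OF i(1) j(1) l] .
        show "\<forall>i'<i. l \<notin> (\<Union>j<n. C i' j)" using u by simp
        show "\<forall>j'<j. l \<notin> C i j'" using u by simp
      qed
    qed
  qed (use n C i in auto)
next
  fix i and l :: loc assume "i < n" "l \<in> (\<Union>j<n. C i j)"
  then show "fst l \<notin> insert v (insert w N)" using C[of i _ l] by blast
next
  fix s
  assume "\<And>l. fst l \<notin> insert v (writes (For w P)) \<Longrightarrow> s l = s0 l"
    and "\<And>l. fst l \<notin> insert v (insert w N) \<Longrightarrow> s l = (if \<exists>i<n. l \<in> (\<Union>j<n. C i j) then f l else s0 l)"
  then show "Q s" by (intro Q) (simp_all add: Bex_def)
qed (use n in auto)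

text \<open>The accumulator is stored after each pass, so every partial sum must fit into
  \<open>W\<close>. Its address is computed afresh each time and must not depend on the counter or
  on the accumulator itself.\<close>

lemma triple_For_sum:
  assumes n: "s0 (''n'', 0, 0) = int n" "''n'' \<noteq> v" "''n'' \<noteq> x" "v \<noteq> x"
    and ix: "\<And>s. (\<And>l. fst l \<noteq> v \<Longrightarrow> l \<noteq> (x, a, b) \<Longrightarrow> s l = s0 l) \<Longrightarrow> aval e1 s = a \<and> aval e2 s = b"
    and e: "\<And>j s. j < n \<Longrightarrow> s (v, 0, 0) = int j \<Longrightarrow>
        (\<And>l. fst l \<noteq> v \<Longrightarrow> l \<noteq> (x, a, b) \<Longrightarrow> s l = s0 l) \<Longrightarrow> aval e s = f j"
    and bound: "\<And>k. k \<le> n \<Longrightarrow> bits (s0 (x, a, b) + (\<Sum>j<k. f j)) \<le> W"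
    and Q: "\<And>s. (\<And>l. fst l \<noteq> v \<Longrightarrow> s l = (if l = (x, a, b) then s0 (x, a, b) + (\<Sum>j<n. f j) else s0 l)) \<Longrightarrow> Q s"
  shows "triple n W (For v (Assign x e1 e2 (Plus (Cell x e1 e2) e))) s0 Q"
proof (rule triple_For[where I = "\<lambda>k s. \<forall>l. fst l \<noteq> v \<longrightarrow>
    s l = (if l = (x, a, b) then s0 (x, a, b) + (\<Sum>j<k. f j) else s0 l)"])
  fix j s
  assume j: "j < n" "s (v, 0, 0) = int j"
    and I: "\<forall>l. fst l \<noteq> v \<longrightarrow> s l = (if l = (x, a, b) then s0 (x, a, b) + (\<Sum>j<j. f j) else s0 l)"
  have I': "s l = (if l = (x, a, b) then s0 (x, a, b) + (\<Sum>j<j. f j) else s0 l)" if "fst l \<noteq> v" for l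
    using I that by blast
  have ix': "aval e1 s = a" "aval e2 s = b" using ix[of s] I' by auto
  have e': "aval e s = f j" using I' by (intro e j) simp
  have s: "s (x, a, b) + f j = s0 (x, a, b) + (\<Sum>j<Suc j. f j)" using I' n by simp
  show "triple n W (Assign x e1 e2 (Plus (Cell x e1 e2) e)) s
      (\<lambda>s'. \<forall>l. fst l \<noteq> v \<longrightarrow> (s'((v, 0, 0) := int (Suc j))) l =
        (if l = (x, a, b) then s0 (x, a, b) + (\<Sum>j<Suc j. f j) else s0 l))"
  proof (rule triple_Assign)
    show "bits (aval (Plus (Cell x e1 e2) e) s) \<le> W"
      using bound[of "Suc j"] j by (simp add: ix' e' s)
  qed (use I' n in \<open>simp add: ix' e' s\<close>)
qed (use n Q in auto)

section \<open>The sign-flip algorithm as a program\<close>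

text \<open>The Kronecker delta of two cells, by integer division.\<close>

definition delta :: "string \<Rightarrow> string \<Rightarrow> aexp" where
  "delta v w = Div (Const 1) (Plus (Const 1) (Times (Minus (Var v) (Var w)) (Minus (Var v) (Var w))))"

lemma aval_delta:
  assumes "s (v, 0, 0) = int i" "s (w, 0, 0) = int j"
  shows "aval (delta v w) s = (if i = j then 1 else 0)"
proof (cases "i = j")
  case False
  \<comment> \<open>The divisor is therefore at least 2, and 1 divided by it rounds down to
    0.\<close>
  then have "0 < (int i - int j) * (int i - int j)" by (auto simp: zero_less_mult_iff nat_neq_iff)
  then show ?thesis using assms False by (simp add: delta_def)
qed (use assms in \<open>simp add: delta_def\<close>)

definition init_prog :: com where
  "init_prog = For ''i'' (For ''j'' (Seq
     (Assign ''M'' (Var ''i'') (Var ''j'') (Minus (Cell ''A'' (Var ''i'') (Var ''j''))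
        (Times (Times (Var ''dA'') (Cell ''z'' (Var ''i'') (Const 0))) (delta ''i'' ''j''))))
     (Assign ''P'' (Var ''i'') (Var ''j'') (Const 0))))"

text \<open>An entry of \<open>P\<close> is cleared as soon as it has been consumed, so that
  \<open>mult_prog\<close> can accumulate into it.\<close>

definition shift_prog :: com where
  "shift_prog = For ''i'' (For ''j'' (Seq
     (Assign ''B'' (Var ''i'') (Var ''j'') (Plus (Cell ''P'' (Var ''i'') (Var ''j''))
        (Times (Var ''c'') (delta ''i'' ''j''))))
     (Assign ''P'' (Var ''i'') (Var ''j'') (Const 0))))"

definition mult_prog :: com where
  "mult_prog = For ''i'' (For ''j'' (For ''l'' (Assign ''P'' (Var ''i'') (Var ''j'')
     (Plus (Cell ''P'' (Var ''i'') (Var ''j''))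
       (Times (Cell ''M'' (Var ''i'') (Var ''l'')) (Cell ''B'' (Var ''l'') (Var ''j'')))))))"

text \<open>With \<open>P = M B\<close> the division is exact: by
  \<open>char_poly_coeff_trace\<close> the negated trace is \<open>r + 1\<close> times the next
  coefficient.\<close>

definition trace_prog :: com where
  "trace_prog = Seq (Set ''c'' (Const 0)) (Seq
     (For ''i'' (Set ''c'' (Plus (Var ''c'') (Minus (Const 0) (Cell ''P'' (Var ''i'') (Var ''i''))))))
     (Set ''c'' (Div (Var ''c'') (Plus (Var ''r'') (Const 1)))))"

text \<open>
  Faddeev--LeVerrier recursion: after \<open>r\<close> passes, \<open>B\<close> and \<open>c\<close> hold the coefficients of degree
  \<open>n - r\<close> of the adjugate of \<open>x I - M\<close> and of the characteristic polynomial, and \<open>P = M B\<close>.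
\<close>

definition adj_prog :: com where
  "adj_prog = Seq init_prog (Seq (Set ''c'' (Const 1))
     (For ''r'' (Seq shift_prog (Seq mult_prog trace_prog))))"

section \<open>Correctness of the integer recursion\<close>

lemma triple_init_prog:
  assumes n: "s0 (''n'', 0, 0) = int n"
    and M: "\<And>i j. i < n \<Longrightarrow> j < n \<Longrightarrow>
      s0 (''A'', int i, int j) - (if i = j then s0 (''dA'', 0, 0) * s0 (''z'', int i, 0) else 0) = m i j"
    and W: "\<And>i j. i < n \<Longrightarrow> j < n \<Longrightarrow> bits (m i j) \<le> W" "bits 0 \<le> W"
  shows "triple n W init_prog s0 (\<lambda>s. \<forall>i<n. \<forall>j<n. s (''M'', int i, int j) = m i j \<and> s (''P'', int i, int j) = 0)"
  unfolding init_prog_def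
proof (rule triple_For_For_cells[where C = "\<lambda>i j. {(''M'', int i, int j), (''P'', int i, int j)}" and N = "{}"
    and f = "\<lambda>(x, i, j). if x = ''M'' then m (nat i) (nat j) else 0"], goal_cases)
  case (8 i j s)
  have "s (''A'', a, b) = s0 (''A'', a, b)" "s (''dA'', a, b) = s0 (''dA'', a, b)"
    "s (''z'', a, b) = s0 (''z'', a, b)" for a b by (simp_all add: 8(5))
  then show ?case
    using W 8(1-4) M[OF 8(1,2)] by (intro triple_Seq triple_Assign) (auto simp: aval_delta[of s _ i _ j])
next
  case (9 s)
  then show ?case by auto
qed (use n in auto)


lemma triple_shift_prog:
  assumes n: "s0 (''n'', 0, 0) = int n"
    and B: "\<And>i j. i < n \<Longrightarrow> j < n \<Longrightarrow>
      s0 (''P'', int i, int j) + (if i = j then s0 (''c'', 0, 0) else 0) = q i j"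
    and W: "\<And>i j. i < n \<Longrightarrow> j < n \<Longrightarrow> bits (q i j) \<le> W" "bits 0 \<le> W"
  shows "triple n W shift_prog s0 (\<lambda>s. \<forall>i<n. \<forall>j<n. s (''B'', int i, int j) = q i j \<and> s (''P'', int i, int j) = 0)"
  unfolding shift_prog_def
proof (rule triple_For_For_cells[where C = "\<lambda>i j. {(''B'', int i, int j), (''P'', int i, int j)}" and N = "{}"
    and f = "\<lambda>(x, i, j). if x = ''B'' then q (nat i) (nat j) else 0"], goal_cases)
  case (8 i j s)
  have "s (''c'', a, b) = s0 (''c'', a, b)" for a b by (simp add: 8(5))
  moreover have "s (''P'', int i, int j) = s0 (''P'', int i, int j)" by (simp add: 8(7))
  ultimately show ?case
    using W 8(1-4) B[OF 8(1,2)] by (intro triple_Seq triple_Assign) (auto simp: aval_delta[of s _ i _ j])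
next
  case (9 s)
  then show ?case by auto
qed (use n in auto)

lemma triple_mult_prog:
  assumes n: "s0 (''n'', 0, 0) = int n"
    and P: "\<And>i j. i < n \<Longrightarrow> j < n \<Longrightarrow> s0 (''P'', int i, int j) = 0"
    and W: "\<And>i j k. i < n \<Longrightarrow> j < n \<Longrightarrow> k \<le> n \<Longrightarrow>
      bits (\<Sum>l<k. s0 (''M'', int i, int l) * s0 (''B'', int l, int j)) \<le> W"
  shows "triple n W mult_prog s0 (\<lambda>s. \<forall>i<n. \<forall>j<n.
    s (''P'', int i, int j) = (\<Sum>l<n. s0 (''M'', int i, int l) * s0 (''B'', int l, int j)))"
  unfolding mult_prog_def
proof (rule triple_For_For_cells[where C = "\<lambda>i j. {(''P'', int i, int j)}" and N = "{''l''}"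
    and f = "\<lambda>(x, i, j). \<Sum>l<n. s0 (''M'', i, int l) * s0 (''B'', int l, j)"], goal_cases)
  case (8 i j s)
  have *: "s (''M'', a, b) = s0 (''M'', a, b)" "s (''B'', a, b) = s0 (''B'', a, b)"
    "s (''n'', a, b) = s0 (''n'', a, b)" for a b by (simp_all add: 8(5))
  have z: "s (''P'', int i, int j) = 0" using 8(1,2) P by (simp add: 8(7))
  show ?case
  proof (rule triple_For_sum[where a = "int i" and b = "int j" and
        f = "\<lambda>l. s0 (''M'', int i, int l) * s0 (''B'', int l, int j)"], goal_cases)
    case (8 s')
    then show ?case by (simp add: z)
  qed (use n * z W 8(1-4) in auto)
next
  case (9 s)
  then show ?case by auto
qed (use n in auto)

lemma triple_trace_prog:
  assumes n: "s0 (''n'', 0, 0) = int n"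
    and W: "\<And>k. k \<le> n \<Longrightarrow> bits (\<Sum>i<k. s0 (''P'', int i, int i)) \<le> W"
  shows "triple n W trace_prog s0 (\<lambda>s. s (''c'', 0, 0) = (- (\<Sum>i<n. s0 (''P'', int i, int i))) div (s0 (''r'', 0, 0) + 1))"
  unfolding trace_prog_def
proof (rule triple_Seq, rule triple_Assign)
  let ?s = "s0((''c'', aval (Const 0) s0, aval (Const 0) s0) := aval (Const 0) s0)"
  show "bits (aval (Const 0) s0) \<le> W" using W[of 0] by simp
  show "triple n W (Seq (For ''i'' (Set ''c'' (Plus (Var ''c'') (Minus (Const 0) (Cell ''P'' (Var ''i'') (Var ''i''))))))
     (Set ''c'' (Div (Var ''c'') (Plus (Var ''r'') (Const 1))))) ?s
     (\<lambda>s. s (''c'', 0, 0) = (- (\<Sum>i<n. s0 (''P'', int i, int i))) div (s0 (''r'', 0, 0) + 1))"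
  proof (rule triple_Seq, rule triple_For_sum[where a = 0 and b = 0 and f = "\<lambda>i. - s0 (''P'', int i, int i)"], goal_cases)
    case (8 s')
    have "bits ((- (\<Sum>i<n. s0 (''P'', int i, int i))) div (s0 (''r'', 0, 0) + 1)) \<le> W"
      using bits_div[of "- (\<Sum>i<n. s0 (''P'', int i, int i))"] W[of n] by (auto intro: le_trans)
    then show ?case by (intro triple_Assign) (simp_all add: 8 sum_negf)
  qed (use n W in \<open>auto simp: sum_negf\<close>)
qed

lemma writes_adj_progs [simp]:
  "writes init_prog = {''i'', ''j'', ''M'', ''P''}"
  "writes shift_prog = {''i'', ''j'', ''B'', ''P''}"
  "writes mult_prog = {''i'', ''j'', ''l'', ''P''}"
  "writes trace_prog = {''i'', ''c''}"
  "writes adj_prog = {''i'', ''j'', ''l'', ''r'', ''M'', ''B'', ''P'', ''c''}"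
  by (auto simp: init_prog_def shift_prog_def mult_prog_def trace_prog_def adj_prog_def)

text \<open>The recursion itself stores nothing larger than \<open>G^n\<close> for
  \<open>G = 2 n^2 \<mu>\<close>. The further factor \<open>\<mu>\<close> in the hypothesis on
  \<open>W\<close> leaves room for the numerators and the denominator computed afterwards, so one
  \<open>W\<close> serves a whole iteration.\<close>

lemma triple_adj_prog:
  assumes M: "M \<in> carrier_mat n n" and n: "1 \<le> n"
    and \<mu>: "1 \<le> \<mu>" "\<And>i j. i < n \<Longrightarrow> j < n \<Longrightarrow> \<bar>M $$ (i, j)\<bar> \<le> \<mu>"
    and W: "\<And>v. \<bar>v\<bar> \<le> (2 * int n ^ 2 * \<mu>) ^ n * \<mu> \<Longrightarrow> bits v \<le> W"
    and s0n: "s0 (''n'', 0, 0) = int n"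
    and s0M: "\<And>i j. i < n \<Longrightarrow> j < n \<Longrightarrow>
      s0 (''A'', int i, int j) - (if i = j then s0 (''dA'', 0, 0) * s0 (''z'', int i, 0) else 0) = M $$ (i, j)"
  shows "triple n W adj_prog s0 (\<lambda>s. s (''c'', 0, 0) = coeff (char_poly M) 0 \<and>
    (\<forall>i<n. \<forall>j<n. s (''B'', int i, int j) = adj_coeff M 0 i j))"
proof -
  define G where "G = 2 * int n ^ 2 * \<mu>"
  have bound: "\<bar>adj_coeff M (n - Suc r) i j\<bar> \<le> G ^ r" if "r < n" "i < n" "j < n" for r i j
    unfolding G_def by (rule adj_coeff_bound[OF M]) (use assms that in auto)
  have n\<mu>: "1 \<le> int n * \<mu>" "1 \<le> int n * (int n * \<mu>)" "int n * \<mu> \<le> int n * (int n * \<mu>)"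
  proof -
    show 1: "1 \<le> int n * \<mu>" using n \<mu>(1) mult_mono[of 1 "int n" 1 \<mu>] by simp
    then show "1 \<le> int n * (int n * \<mu>)" using n mult_mono[of 1 "int n" 1 "int n * \<mu>"] by simp
    show "int n * \<mu> \<le> int n * (int n * \<mu>)" using n 1 mult_mono[of 1 "int n" "int n * \<mu>" "int n * \<mu>"] by simp
  qed
  have "G = 2 * (int n * (int n * \<mu>))" by (simp add: G_def power2_eq_square)
  then have G: "int n * (int n * \<mu>) \<le> G" "int n * \<mu> \<le> G" "1 \<le> G"
    using n\<mu> by linarith+
  have Wr: "bits v \<le> W" if "\<bar>v\<bar> \<le> G ^ r" "r \<le> n" for v r
  proof (rule W)
    have "G ^ r * 1 \<le> G ^ n * \<mu>" using G \<mu>(1) that by (intro mult_mono power_increasing) auto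
    then show "\<bar>v\<bar> \<le> (2 * int n ^ 2 * \<mu>) ^ n * \<mu>" using that by (simp add: G_def)
  qed
  have W0: "bits 0 \<le> W" "bits 1 \<le> W" using Wr[of _ 0] by auto
  have prod: "\<bar>\<Sum>l<k. M $$ (i, l) * adj_coeff M (n - Suc r) l j\<bar> \<le> int n * \<mu> * G ^ r"
    if "i < n" "j < n" "k \<le> n" "r < n" for i j k r
  proof -
    have "\<bar>\<Sum>l<k. M $$ (i, l) * adj_coeff M (n - Suc r) l j\<bar>
        \<le> (\<Sum>l<k. \<bar>M $$ (i, l) * adj_coeff M (n - Suc r) l j\<bar>)" by (rule sum_abs)
    also have "\<dots> \<le> (\<Sum>l<k. \<mu> * G ^ r)"
      unfolding abs_mult using \<mu> bound that by (intro sum_mono mult_mono) auto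
    also have "\<dots> = int k * (\<mu> * G ^ r)" by simp
    also have "\<dots> \<le> int n * (\<mu> * G ^ r)" using that \<mu>(1) G(3) by (intro mult_right_mono) auto
    finally show ?thesis by simp
  qed
  let ?A = "\<lambda>r i j. adj_coeff M (n - r) i j"
  let ?c = "\<lambda>r. coeff (char_poly M) (n - r)"
  \<comment> \<open>Nothing is claimed about \<open>B\<close> for \<open>r = 0\<close>, since it may
    then hold leftovers of the previous iteration; the first shift overwrites it.\<close>
  let ?I = "\<lambda>r s. (\<forall>i<n. \<forall>j<n. s (''P'', int i, int j) = (\<Sum>l<n. M $$ (i, l) * ?A r l j)) \<and>
    s (''c'', 0, 0) = ?c r \<and> (0 < r \<longrightarrow> (\<forall>i<n. \<forall>j<n. s (''B'', int i, int j) = ?A r i j))"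
  have body: "triple n W (Seq shift_prog (Seq mult_prog trace_prog)) s (?I (Suc r))"
    if r: "r < n" "s (''r'', 0, 0) = int r" "?I r s" and sn: "s (''n'', 0, 0) = int n"
      and sM: "\<And>i j. i < n \<Longrightarrow> j < n \<Longrightarrow> s (''M'', int i, int j) = M $$ (i, j)" for r s
  proof (rule triple_Seq, rule triple_conseq[OF triple_shift_prog[where q = "?A (Suc r)"]])
    show "s (''n'', 0, 0) = int n" by fact
    show "bits 0 \<le> W" by (rule W0)
    show "bits (?A (Suc r) i j) \<le> W" if "i < n" "j < n" for i j
      using bound[OF r(1) that] r(1) by (intro Wr[of _ r]) auto
    have e: "Suc (n - Suc r) = n - r" using r by simp
    show "s (''P'', int i, int j) + (if i = j then s (''c'', 0, 0) else 0) = ?A (Suc r) i j"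
      if "i < n" "j < n" for i j
      using r(3) that coeff_adj_Suc[OF M that, of "n - Suc r"] unfolding e by auto
    fix s1
    assume s1: "\<forall>i<n. \<forall>j<n. s1 (''B'', int i, int j) = ?A (Suc r) i j \<and> s1 (''P'', int i, int j) = 0"
      and f1: "\<And>l. fst l \<notin> writes shift_prog \<Longrightarrow> s1 l = s l"
    have s1n: "s1 (''n'', 0, 0) = int n" by (simp add: f1 sn)
    have s1M: "s1 (''M'', int i, int j) = M $$ (i, j)" if "i < n" "j < n" for i j
      by (simp add: f1 sM that)
    have p: "(\<Sum>l<k. s1 (''M'', int i, int l) * s1 (''B'', int l, int j)) = (\<Sum>l<k. M $$ (i, l) * ?A (Suc r) l j)"
      if "i < n" "j < n" "k \<le> n" for i j k
      using that s1 s1M by (intro sum.cong) auto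
    show "triple n W (Seq mult_prog trace_prog) s1 (?I (Suc r))"
    proof (rule triple_Seq, rule triple_conseq[OF triple_mult_prog])
      show "s1 (''n'', 0, 0) = int n" by fact
      show "s1 (''P'', int i, int j) = 0" if "i < n" "j < n" for i j using s1 that by blast
      show "bits (\<Sum>l<k. s1 (''M'', int i, int l) * s1 (''B'', int l, int j)) \<le> W"
        if "i < n" "j < n" "k \<le> n" for i j k
        unfolding p[OF that]
      proof (rule Wr[of _ "Suc r"])
        have "int n * \<mu> * G ^ r \<le> G * G ^ r" using G by (intro mult_right_mono) auto
        then show "\<bar>\<Sum>l<k. M $$ (i, l) * ?A (Suc r) l j\<bar> \<le> G ^ Suc r"
          using prod[OF that r(1)] by simp
      qed (use r in simp)
      fix s2
      assume s2: "\<forall>i<n. \<forall>j<n. s2 (''P'', int i, int j) =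
          (\<Sum>l<n. s1 (''M'', int i, int l) * s1 (''B'', int l, int j))"
        and f2: "\<And>l. fst l \<notin> writes mult_prog \<Longrightarrow> s2 l = s1 l"
      have s2P: "s2 (''P'', int i, int j) = (\<Sum>l<n. M $$ (i, l) * ?A (Suc r) l j)" if "i < n" "j < n" for i j
        using s2 p that by simp
      have s2B: "s2 (''B'', int i, int j) = ?A (Suc r) i j" if "i < n" "j < n" for i j
        using s1 that by (simp add: f2)
      have s2r: "s2 (''r'', 0, 0) = int r" using r by (simp add: f1 f2)
      show "triple n W trace_prog s2 (?I (Suc r))"
      proof (rule triple_conseq[OF triple_trace_prog])
        show "s2 (''n'', 0, 0) = int n" by (simp add: f2 s1n)
        show "bits (\<Sum>i<k. s2 (''P'', int i, int i)) \<le> W" if "k \<le> n" for k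
        proof (rule Wr[of _ "Suc r"])
          have "\<bar>\<Sum>i<k. s2 (''P'', int i, int i)\<bar> \<le> (\<Sum>i<k. \<bar>s2 (''P'', int i, int i)\<bar>)" by (rule sum_abs)
          also have "\<dots> \<le> (\<Sum>i<k. int n * \<mu> * G ^ r)"
            using that r prod by (intro sum_mono) (simp add: s2P)
          also have "\<dots> = int k * (int n * \<mu> * G ^ r)" by simp
          also have "\<dots> \<le> int n * (int n * \<mu> * G ^ r)"
            using that \<mu>(1) G(3) by (intro mult_right_mono mult_nonneg_nonneg) auto
          also have "\<dots> \<le> G * G ^ r"
            using mult_right_mono[OF G(1), of "G ^ r"] G(3) by (simp add: mult.assoc)
          finally show "\<bar>\<Sum>i<k. s2 (''P'', int i, int i)\<bar> \<le> G ^ Suc r" by simp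
        qed (use r in simp)
        fix s3
        assume s3: "s3 (''c'', 0, 0) = (- (\<Sum>i<n. s2 (''P'', int i, int i))) div (s2 (''r'', 0, 0) + 1)"
          and f3: "\<And>l. fst l \<notin> writes trace_prog \<Longrightarrow> s3 l = s2 l"
        have "(\<Sum>i<n. s2 (''P'', int i, int i)) = (\<Sum>i<n. \<Sum>l<n. M $$ (i, l) * ?A (Suc r) l i)"
          by (intro sum.cong) (auto simp: s2P)
        \<comment> \<open>In degree \<open>n - Suc r\<close> the identity has the factor
          \<open>r + 1\<close>, exactly the divisor used by the program.\<close>
        moreover have "n - (n - Suc r) = Suc r" using r(1) by simp
        ultimately have "- (\<Sum>i<n. s2 (''P'', int i, int i)) = (int r + 1) * ?c (Suc r)"
          using char_poly_coeff_trace[OF M, of "n - Suc r"] by (simp add: add.commute)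
        then have "s3 (''c'', 0, 0) = ?c (Suc r)" unfolding s3 s2r by simp
        then show "?I (Suc r) s3" by (simp add: f3 s2P s2B)
      qed
    qed
  qed
  show ?thesis
    unfolding adj_prog_def
  proof (rule triple_Seq, rule triple_conseq[OF triple_init_prog[where m = "\<lambda>i j. M $$ (i, j)"]])
    show "bits (M $$ (i, j)) \<le> W" if "i < n" "j < n" for i j
    proof (rule Wr[of _ 1])
      have "\<mu> * 1 \<le> \<mu> * int n" using n \<mu>(1) by (intro mult_left_mono) auto
      then show "\<bar>M $$ (i, j)\<bar> \<le> G ^ 1" using \<mu>(2)[OF that] G(2) by (simp add: mult.commute)
    qed (use n in simp)
    fix s1
    assume s1: "\<forall>i<n. \<forall>j<n. s1 (''M'', int i, int j) = M $$ (i, j) \<and> s1 (''P'', int i, int j) = 0"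
      and f1: "\<And>l. fst l \<notin> writes init_prog \<Longrightarrow> s1 l = s0 l"
    show "triple n W (Seq (Set ''c'' (Const 1)) (For ''r'' (Seq shift_prog (Seq mult_prog trace_prog)))) s1
      (\<lambda>s. s (''c'', 0, 0) = coeff (char_poly M) 0 \<and> (\<forall>i<n. \<forall>j<n. s (''B'', int i, int j) = adj_coeff M 0 i j))"
    proof (intro triple_Seq triple_Assign)
      show "bits (aval (Const 1) s1) \<le> W" using W0 by simp
      let ?s = "s1((''c'', aval (Const 0) s1, aval (Const 0) s1) := aval (Const 1) s1)"
      have c: "?c 0 = 1" using degree_monic_char_poly[OF M] by auto
      show "triple n W (For ''r'' (Seq shift_prog (Seq mult_prog trace_prog))) ?s
        (\<lambda>s. s (''c'', 0, 0) = coeff (char_poly M) 0 \<and> (\<forall>i<n. \<forall>j<n. s (''B'', int i, int j) = adj_coeff M 0 i j))"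
      proof (rule triple_For[where I = ?I], goal_cases)
        \<comment> \<open>The start is consistent because \<open>B_n = 0\<close> by
          \<open>adj_coeff_ge\<close>, so the cleared \<open>P\<close> equals \<open>M B_n\<close>,
          and 1 is the leading coefficient.\<close>
        case (4 s)
        then show ?case using s1 c by (simp add: adj_coeff_ge[OF M])
      next
        case (5 r s)
        have "triple n W (Seq shift_prog (Seq mult_prog trace_prog)) s (?I (Suc r))"
          using 5(1-3) s1 s0n by (intro body) (simp_all add: 5(4) f1)
        then show ?case by (rule triple_conseq) simp
      next
        case (6 s)
        then show ?case using n by simp
      qed (use s0n in \<open>auto simp: f1\<close>)
    qed
  qed (use s0n s0M W0 in auto)
qed


section \<open>One pass of the sign-flip loop\<close>

definition copy_prog :: com where
  "copy_prog = For ''i'' (Assign ''Z'' (Var ''T'') (Var ''i'') (Cell ''z'' (Var ''i'') (Const 0)))"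

definition sol_prog :: com where
  "sol_prog = For ''i'' (Seq (Assign ''X'' (Var ''T'') (Var ''i'') (Const 0))
     (For ''j'' (Assign ''X'' (Var ''T'') (Var ''i'') (Plus (Cell ''X'' (Var ''T'') (Var ''i''))
       (Times (Cell ''B'' (Var ''i'') (Var ''j'')) (Times (Var ''dA'') (Cell ''b'' (Var ''j'') (Const 0))))))))"

text \<open>The solution entry is \<open>X / D\<close>, so its product with the sign is negative
  exactly when \<open>z X D\<close> is; this avoids rational arithmetic and allows a negative
  \<open>D\<close>.\<close>

definition test_prog :: com where
  "test_prog = Seq (Set ''go'' (Const 0)) (For ''i'' (IfPos
     (Minus (Const 0) (Times (Times (Cell ''z'' (Var ''i'') (Const 0)) (Cell ''X'' (Var ''T'') (Var ''i'')))
       (Cell ''D'' (Var ''T'') (Const 0))))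
     (Set ''go'' (Const 1)) Skip))"

definition flip_prog :: com where
  "flip_prog = For ''i'' (IfPos (Cell ''S'' (Var ''T'') (Var ''i''))
     (Assign ''z'' (Var ''i'') (Const 0) (Minus (Const 0) (Cell ''z'' (Var ''i'') (Const 0)))) Skip)"

text \<open>Sign vector and solution are recorded before the test, and \<open>T\<close> advances
  only if there was a mismatch. The last pass thus records row \<open>T\<close> and leaves
  \<open>T\<close> equal to the number of iterations.\<close>

definition iter_prog :: com where
  "iter_prog = Seq copy_prog (Seq adj_prog
     (Seq (Assign ''D'' (Var ''T'') (Const 0) (Minus (Const 0) (Times (Var ''c'') (Var ''db''))))
     (Seq sol_prog (Seq test_prog
     (IfPos (Var ''go'') (Seq flip_prog (Set ''T'' (Plus (Var ''T'') (Const 1)))) Skip)))))"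

lemma writes_run_progs [simp]:
  "writes copy_prog = {''i'', ''Z''}"
  "writes sol_prog = {''i'', ''j'', ''X''}"
  "writes test_prog = {''i'', ''go''}"
  "writes flip_prog = {''i'', ''z''}"
  by (auto simp: copy_prog_def sol_prog_def test_prog_def flip_prog_def)

lemma triple_copy_prog:
  assumes n: "s0 (''n'', 0, 0) = int n"
    and W: "\<And>i. i < n \<Longrightarrow> bits (s0 (''z'', int i, 0)) \<le> W"
  shows "triple n W copy_prog s0 (\<lambda>s. \<forall>a b. s (''Z'', a, b) =
    (if a = s0 (''T'', 0, 0) \<and> 0 \<le> b \<and> b < int n then s0 (''z'', b, 0) else s0 (''Z'', a, b)))"
  unfolding copy_prog_def
proof (rule triple_For_cells[where C = "\<lambda>i. {(''Z'', s0 (''T'', 0, 0), int i)}" and N = "{}"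
    and f = "\<lambda>(x, a, b). s0 (''z'', b, 0)"], goal_cases)
  case (5 i s)
  have "s (''T'', a, b) = s0 (''T'', a, b)" "s (''z'', a, b) = s0 (''z'', a, b)" for a b
    by (simp_all add: 5(3))
  then show ?case using 5(1,2) W by (intro triple_Assign) auto
next
  case (6 s)
  have *: "(\<exists>i<n. b = int i) \<longleftrightarrow> 0 \<le> b \<and> b < int n" for b
    by (metis nat_less_iff of_nat_0_le_iff of_nat_less_iff nat_0_le)
  show ?case
  proof (intro allI)
    fix a b
    show "s (''Z'', a, b) = (if a = s0 (''T'', 0, 0) \<and> 0 \<le> b \<and> b < int n then s0 (''z'', b, 0) else s0 (''Z'', a, b))"
      using *[of b] 6(2)[of "(''Z'', a, b)"] by auto
  qed
qed (use n in auto)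

lemma triple_sol_prog:
  assumes n: "s0 (''n'', 0, 0) = int n"
    and x: "\<And>i k. i < n \<Longrightarrow> k \<le> n \<Longrightarrow> x k i =
      (\<Sum>j<k. s0 (''B'', int i, int j) * (s0 (''dA'', 0, 0) * s0 (''b'', int j, 0)))"
    and W: "\<And>i k. i < n \<Longrightarrow> k \<le> n \<Longrightarrow> bits (x k i) \<le> W"
  shows "triple n W sol_prog s0 (\<lambda>s. \<forall>a b. s (''X'', a, b) =
    (if a = s0 (''T'', 0, 0) \<and> 0 \<le> b \<and> b < int n then x n (nat b) else s0 (''X'', a, b)))"
  unfolding sol_prog_def
proof (rule triple_For_cells[where C = "\<lambda>i. {(''X'', s0 (''T'', 0, 0), int i)}" and N = "{''j''}"
    and f = "\<lambda>(y, a, b). x n (nat b)"], goal_cases)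
  case (5 i s)
  have *: "s (''T'', a, b) = s0 (''T'', a, b)" "s (''B'', a, b) = s0 (''B'', a, b)"
    "s (''n'', a, b) = s0 (''n'', a, b)" "s (''dA'', a, b) = s0 (''dA'', a, b)"
    "s (''b'', a, b) = s0 (''b'', a, b)" for a b
    by (simp_all add: 5(3))
  show ?case
  proof (rule triple_Seq, rule triple_Assign)
    show "bits (aval (Const 0) s) \<le> W" using W[of i 0] x[of i 0] 5 by simp
    show "triple n W (For ''j'' (Assign ''X'' (Var ''T'') (Var ''i'') (Plus (Cell ''X'' (Var ''T'') (Var ''i''))
       (Times (Cell ''B'' (Var ''i'') (Var ''j'')) (Times (Var ''dA'') (Cell ''b'' (Var ''j'') (Const 0)))))))
      (s((''X'', aval (Var ''T'') s, aval (Var ''i'') s) := aval (Const 0) s))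
      (\<lambda>s'. \<forall>l. fst l \<notin> {''j''} \<longrightarrow> s' l =
        (if l \<in> {(''X'', s0 (''T'', 0, 0), int i)} then case l of (y, a, b) \<Rightarrow> x n (nat b) else s l))"
    proof (rule triple_For_sum[where a = "s0 (''T'', 0, 0)" and b = "int i" and
          f = "\<lambda>j. s0 (''B'', int i, int j) * (s0 (''dA'', 0, 0) * s0 (''b'', int j, 0))"], goal_cases)
      case (7 k)
      then show ?case using W[of i k] x[of i k] 5 * by simp
    next
      case (8 s')
      then show ?case using 5 * by (simp add: x)
    qed (use n 5 in \<open>auto simp: *\<close>)
  qed
next
  case (6 s)
  have *: "(\<exists>i<n. b = int i) \<longleftrightarrow> 0 \<le> b \<and> b < int n" for b
    by (metis nat_less_iff of_nat_0_le_iff of_nat_less_iff nat_0_le)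
  show ?case
  proof (intro allI)
    fix a b
    show "s (''X'', a, b) = (if a = s0 (''T'', 0, 0) \<and> 0 \<le> b \<and> b < int n then x n (nat b) else s0 (''X'', a, b))"
      using *[of b] 6(2)[of "(''X'', a, b)"] by auto
  qed
qed (use n in auto)

lemma triple_test_prog:
  assumes n: "s0 (''n'', 0, 0) = int n" and W: "bits 1 \<le> W" "bits 0 \<le> W"
  shows "triple n W test_prog s0 (\<lambda>s. s (''go'', 0, 0) =
    (if \<exists>i<n. s0 (''z'', int i, 0) * s0 (''X'', s0 (''T'', 0, 0), int i) * s0 (''D'', s0 (''T'', 0, 0), 0) < 0
     then 1 else 0))"
  unfolding test_prog_def
proof (rule triple_Seq, rule triple_Assign)
  let ?s = "s0((''go'', aval (Const 0) s0, aval (Const 0) s0) := aval (Const 0) s0)"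
  let ?P = "\<lambda>i. s0 (''z'', int i, 0) * s0 (''X'', s0 (''T'', 0, 0), int i) * s0 (''D'', s0 (''T'', 0, 0), 0) < 0"
  show "bits (aval (Const 0) s0) \<le> W" using W by simp
  show "triple n W (For ''i'' (IfPos
     (Minus (Const 0) (Times (Times (Cell ''z'' (Var ''i'') (Const 0)) (Cell ''X'' (Var ''T'') (Var ''i'')))
       (Cell ''D'' (Var ''T'') (Const 0))))
     (Set ''go'' (Const 1)) Skip)) ?s (\<lambda>s. s (''go'', 0, 0) = (if \<exists>i<n. ?P i then 1 else 0))"
  proof (rule triple_For[where I = "\<lambda>k s. s (''go'', 0, 0) = (if \<exists>i<k. ?P i then 1 else 0)"], goal_cases)
    case (5 j s)
    have "s (''T'', a, b) = s0 (''T'', a, b)" "s (''z'', a, b) = s0 (''z'', a, b)"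
      "s (''X'', a, b) = s0 (''X'', a, b)" "s (''D'', a, b) = s0 (''D'', a, b)" for a b
      by (simp_all add: 5(4))
    then show ?case using W 5(1-3)
      by (intro triple_IfPos triple_Assign triple_Skip) (auto simp: less_Suc_eq)
  qed (use n in auto)
qed

lemma triple_flip_prog:
  assumes n: "s0 (''n'', 0, 0) = int n"
    and W: "\<And>i. i < n \<Longrightarrow> bits (s0 (''z'', int i, 0)) \<le> W"
  shows "triple n W flip_prog s0 (\<lambda>s. \<forall>i<n. s (''z'', int i, 0) =
    (if s0 (''S'', s0 (''T'', 0, 0), int i) > 0 then - s0 (''z'', int i, 0) else s0 (''z'', int i, 0)))"
  unfolding flip_prog_def
proof (rule triple_For_cells[where C = "\<lambda>i. {(''z'', int i, 0)}" and N = "{}"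
    and f = "\<lambda>(x, a, b). if s0 (''S'', s0 (''T'', 0, 0), a) > 0 then - s0 (x, a, b) else s0 (x, a, b)"], goal_cases)
  case (5 i s)
  have "s (''T'', a, b) = s0 (''T'', a, b)" "s (''S'', a, b) = s0 (''S'', a, b)" for a b
    by (simp_all add: 5(3))
  moreover have "s (''z'', int i, 0) = s0 (''z'', int i, 0)" using 5(4)[of "(''z'', int i, 0)"] by simp
  ultimately show ?case using 5(1,2) W
    by (intro triple_IfPos triple_Assign triple_Skip) auto
next
  case (6 s)
  then show ?case by auto
qed (use n in auto)

lemma writes_iter_prog [simp]:
  "writes iter_prog = {''i'', ''j'', ''l'', ''r'', ''M'', ''B'', ''P'', ''c'', ''Z'', ''D'', ''X'', ''go'', ''z'', ''T''}"
  by (auto simp: iter_prog_def)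

lemma triple_sol_test_flip:
  assumes n: "s0 (''n'', 0, 0) = int n" and T: "s0 (''T'', 0, 0) = int k"
    and x: "\<And>i m. i < n \<Longrightarrow> m \<le> n \<Longrightarrow> x m i =
      (\<Sum>j<m. s0 (''B'', int i, int j) * (s0 (''dA'', 0, 0) * s0 (''b'', int j, 0)))"
    and W: "\<And>i m. i < n \<Longrightarrow> m \<le> n \<Longrightarrow> bits (x m i) \<le> W" "bits 0 \<le> W" "bits 1 \<le> W"
      "bits (int (Suc k)) \<le> W" "\<And>i. i < n \<Longrightarrow> bits (s0 (''z'', int i, 0)) \<le> W"
  defines "neg \<equiv> \<exists>i<n. s0 (''z'', int i, 0) * x n i * s0 (''D'', int k, 0) < 0"
  shows "triple n W (Seq sol_prog (Seq test_prog
       (IfPos (Var ''go'') (Seq flip_prog (Set ''T'' (Plus (Var ''T'') (Const 1)))) Skip))) s0 (\<lambda>s.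
    (\<forall>a b. s (''X'', a, b) = (if a = int k \<and> 0 \<le> b \<and> b < int n then x n (nat b) else s0 (''X'', a, b))) \<and>
    s (''go'', 0, 0) = (if neg then 1 else 0) \<and>
    s (''T'', 0, 0) = (if neg then int (Suc k) else int k) \<and>
    (\<forall>i<n. s (''z'', int i, 0) =
      (if neg \<and> s0 (''S'', int k, int i) > 0 then - s0 (''z'', int i, 0) else s0 (''z'', int i, 0))))"
    (is "triple n W _ s0 ?Q")
proof (rule triple_Seq, rule triple_conseq[OF triple_sol_prog[of s0 n x, OF n]])
  show "x m i = (\<Sum>j<m. s0 (''B'', int i, int j) * (s0 (''dA'', 0, 0) * s0 (''b'', int j, 0)))"
    if "i < n" "m \<le> n" for i m by (rule x[OF that])
  show "bits (x m i) \<le> W" if "i < n" "m \<le> n" for i m by (rule W(1)[OF that])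
  fix s1
  assume s1: "\<forall>a b. s1 (''X'', a, b) =
      (if a = s0 (''T'', 0, 0) \<and> 0 \<le> b \<and> b < int n then x n (nat b) else s0 (''X'', a, b))"
    and f1: "\<And>l. fst l \<notin> writes sol_prog \<Longrightarrow> s1 l = s0 l"
  have n1: "s1 (''n'', 0, 0) = int n" by (simp add: f1 n)
  have neg: "(\<exists>i<n. s1 (''z'', int i, 0) * s1 (''X'', s1 (''T'', 0, 0), int i) *
      s1 (''D'', s1 (''T'', 0, 0), 0) < 0) \<longleftrightarrow> neg"
    unfolding neg_def using s1 by (auto simp: f1 T)
  show "triple n W (Seq test_prog
      (IfPos (Var ''go'') (Seq flip_prog (Set ''T'' (Plus (Var ''T'') (Const 1)))) Skip)) s1 ?Q"
  proof (rule triple_Seq, rule triple_conseq[OF triple_test_prog[of s1 n, OF n1 W(3,2), unfolded neg]])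
    fix s2
    assume s2: "s2 (''go'', 0, 0) = (if neg then 1 else 0)"
      and f2: "\<And>l. fst l \<notin> writes test_prog \<Longrightarrow> s2 l = s1 l"
    have n2: "s2 (''n'', 0, 0) = int n" by (simp add: f2 n1)
    have X2: "s2 (''X'', a, b) = (if a = int k \<and> 0 \<le> b \<and> b < int n then x n (nat b) else s0 (''X'', a, b))" for a b
      using s1 by (simp add: f2 T)
    have T2: "s2 (''T'', 0, 0) = int k" by (simp add: f1 f2 T)
    have z2: "s2 (''z'', a, b) = s0 (''z'', a, b)" for a b by (simp add: f1 f2)
    have S2: "s2 (''S'', a, b) = s0 (''S'', a, b)" for a b by (simp add: f1 f2)
    show "triple n W (IfPos (Var ''go'') (Seq flip_prog (Set ''T'' (Plus (Var ''T'') (Const 1)))) Skip) s2 ?Q"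
    proof (rule triple_IfPos)
      assume "0 < aval (Var ''go'') s2"
      then have neg by (simp add: s2 split: if_splits)
      show "triple n W (Seq flip_prog (Set ''T'' (Plus (Var ''T'') (Const 1)))) s2 ?Q"
      proof (rule triple_Seq, rule triple_conseq[OF triple_flip_prog[of s2 n, OF n2]])
        show "bits (s2 (''z'', int i, 0)) \<le> W" if "i < n" for i using W(5)[OF that] by (simp add: z2)
        fix s3
        assume s3: "\<forall>i<n. s3 (''z'', int i, 0) =
            (if s2 (''S'', s2 (''T'', 0, 0), int i) > 0 then - s2 (''z'', int i, 0) else s2 (''z'', int i, 0))"
          and f3: "\<And>l. fst l \<notin> writes flip_prog \<Longrightarrow> s3 l = s2 l"
        have T3: "s3 (''T'', 0, 0) = int k" by (simp add: f3 T2)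
        show "triple n W (Set ''T'' (Plus (Var ''T'') (Const 1))) s3 ?Q"
        proof (rule triple_Assign)
          show "bits (aval (Plus (Var ''T'') (Const 1)) s3) \<le> W" using W(4) by (simp add: T3 add.commute)
          show "?Q (s3((''T'', aval (Const 0) s3, aval (Const 0) s3) := aval (Plus (Var ''T'') (Const 1)) s3))"
            using s3 \<open>neg\<close> by (simp add: T3 f3 X2 s2 T2 z2 S2)
        qed
      qed
    next
      assume "\<not> 0 < aval (Var ''go'') s2"
      then have "\<not> neg" by (simp add: s2 split: if_splits)
      then show "triple n W Skip s2 ?Q" by (intro triple_Skip) (simp add: X2 s2 T2 z2)
    qed
  qed
qed

lemma triple_iter_prog:
  assumes M: "M \<in> carrier_mat n n" and n: "1 \<le> n"
    and \<mu>: "1 \<le> \<mu>" "\<And>i j. i < n \<Longrightarrow> j < n \<Longrightarrow> \<bar>M $$ (i, j)\<bar> \<le> \<mu>"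
    and W: "\<And>v. \<bar>v\<bar> \<le> (2 * int n ^ 2 * \<mu>) ^ n * \<mu> \<Longrightarrow> bits v \<le> W"
    and s0n: "s0 (''n'', 0, 0) = int n"
    and s0M: "\<And>i j. i < n \<Longrightarrow> j < n \<Longrightarrow>
      s0 (''A'', int i, int j) - (if i = j then s0 (''dA'', 0, 0) * s0 (''z'', int i, 0) else 0) = M $$ (i, j)"
    and s0T: "s0 (''T'', 0, 0) = int k" and WT: "bits (int (Suc k)) \<le> W"
    and s0z: "\<And>i. i < n \<Longrightarrow> \<bar>s0 (''z'', int i, 0)\<bar> \<le> 1"
    and s0d: "\<bar>s0 (''dA'', 0, 0)\<bar> \<le> \<mu>" "\<bar>s0 (''db'', 0, 0)\<bar> \<le> \<mu>"
    and s0b: "\<And>i. i < n \<Longrightarrow> \<bar>s0 (''b'', int i, 0)\<bar> \<le> \<mu>"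
  defines "x \<equiv> \<lambda>i. \<Sum>j<n. adj_coeff M 0 i j * (s0 (''dA'', 0, 0) * s0 (''b'', int j, 0))"
    and "d \<equiv> - (coeff (char_poly M) 0 * s0 (''db'', 0, 0))"
  defines "neg \<equiv> \<exists>i<n. s0 (''z'', int i, 0) * x i * d < 0"
  shows "triple n W iter_prog s0 (\<lambda>s.
    (\<forall>a b. s (''Z'', a, b) = (if a = int k \<and> 0 \<le> b \<and> b < int n then s0 (''z'', b, 0) else s0 (''Z'', a, b))) \<and>
    (\<forall>a b. s (''X'', a, b) = (if a = int k \<and> 0 \<le> b \<and> b < int n then x (nat b) else s0 (''X'', a, b))) \<and>
    (\<forall>a b. s (''D'', a, b) = (if a = int k \<and> b = 0 then d else s0 (''D'', a, b))) \<and>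
    s (''go'', 0, 0) = (if neg then 1 else 0) \<and>
    s (''T'', 0, 0) = (if neg then int (Suc k) else int k) \<and>
    (\<forall>i<n. s (''z'', int i, 0) =
      (if neg \<and> s0 (''S'', int k, int i) > 0 then - s0 (''z'', int i, 0) else s0 (''z'', int i, 0))))"
    (is "triple n W iter_prog s0 ?Q")
proof -
  define G where "G = 2 * int n ^ 2 * \<mu>"
  have G1: "int n * \<mu> \<le> G" "1 \<le> G"
  proof -
    have 1: "1 \<le> int n * \<mu>" using n \<mu>(1) mult_mono[of 1 "int n" 1 \<mu>] by simp
    have "int n * \<mu> \<le> int n * (int n * \<mu>)"
      using n 1 mult_mono[of 1 "int n" "int n * \<mu>" "int n * \<mu>"] by simp
    moreover have "G = 2 * (int n * (int n * \<mu>))" by (simp add: G_def power2_eq_square)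
    ultimately show "int n * \<mu> \<le> G" "1 \<le> G" using 1 by linarith+
  qed
  have W': "bits v \<le> W" if "\<bar>v\<bar> \<le> G ^ n * \<mu>" for v using that by (intro W) (simp add: G_def)
  have W1: "bits v \<le> W" if "\<bar>v\<bar> \<le> 1" for v
  proof (rule W')
    have "1 * 1 \<le> G ^ n * \<mu>" using G1 \<mu>(1) by (intro mult_mono one_le_power) auto
    with that show "\<bar>v\<bar> \<le> G ^ n * \<mu>" by simp
  qed
  have c: "\<bar>coeff (char_poly M) 0\<bar> \<le> G ^ n"
    using adj_coeff_bound(1)[OF M \<mu>(1) _ n, of n] \<mu>(2) by (simp add: G_def)
  have adj: "\<bar>adj_coeff M 0 i j\<bar> \<le> G ^ (n - 1)" if "i < n" "j < n" for i j
    using adj_coeff_bound(2)[OF M \<mu>(1) _ n, of "n - 1" i j] \<mu>(2) that n by (simp add: G_def)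
  show ?thesis
    unfolding iter_prog_def
  proof (rule triple_Seq, rule triple_conseq[OF triple_copy_prog[of s0 n, OF s0n]])
    show "bits (s0 (''z'', int i, 0)) \<le> W" if "i < n" for i using s0z[OF that] by (rule W1)
    fix s1
    assume s1: "\<forall>a b. s1 (''Z'', a, b) =
        (if a = s0 (''T'', 0, 0) \<and> 0 \<le> b \<and> b < int n then s0 (''z'', b, 0) else s0 (''Z'', a, b))"
      and f1: "\<And>l. fst l \<notin> writes copy_prog \<Longrightarrow> s1 l = s0 l"
    show "triple n W (Seq adj_prog
     (Seq (Assign ''D'' (Var ''T'') (Const 0) (Minus (Const 0) (Times (Var ''c'') (Var ''db''))))
     (Seq sol_prog (Seq test_prog
     (IfPos (Var ''go'') (Seq flip_prog (Set ''T'' (Plus (Var ''T'') (Const 1)))) Skip))))) s1 ?Q"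
    proof (rule triple_Seq, rule triple_conseq[OF triple_adj_prog[OF M n \<mu>(1)]], goal_cases)
      case (5 s2)
      note f2 = 5(3)
      have c2: "s2 (''c'', 0, 0) = coeff (char_poly M) 0" using 5(2) by blast
      have B2: "s2 (''B'', int i, int j) = adj_coeff M 0 i j" if "i < n" "j < n" for i j
        using 5(2) that by blast
      have T2: "s2 (''T'', 0, 0) = int k" by (simp add: f1 f2 s0T)
      have d2: "0 - s2 (''c'', 0, 0) * s2 (''db'', 0, 0) = d" by (simp add: f1 f2 c2 d_def)
      let ?s3 = "s2((''D'', aval (Var ''T'') s2, aval (Const 0) s2) :=
          aval (Minus (Const 0) (Times (Var ''c'') (Var ''db''))) s2)"
      show ?case
      proof (rule triple_Seq, rule triple_Assign)
        have "\<bar>d\<bar> \<le> G ^ n * \<mu>"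
          unfolding d_def abs_minus_cancel abs_mult using c s0d G1 by (intro mult_mono) auto
        then show "bits (aval (Minus (Const 0) (Times (Var ''c'') (Var ''db''))) s2) \<le> W"
          using d2 by (intro W') simp
        have s3: "?s3 (''D'', a, b) = (if a = int k \<and> b = 0 then d else s0 (''D'', a, b))" for a b
          using T2 d2 by (simp add: f1 f2)
        have f3: "?s3 l = s0 l" if "fst l \<notin> {''i'', ''j'', ''l'', ''r'', ''M'', ''B'', ''P'', ''c'', ''Z'', ''D''}" for l
          using that by (auto simp: f1 f2)
        have B3: "?s3 (''B'', int i, int j) = adj_coeff M 0 i j" if "i < n" "j < n" for i j
          by (simp add: B2 that)
        have Z3: "?s3 (''Z'', a, b) = (if a = int k \<and> 0 \<le> b \<and> b < int n then s0 (''z'', b, 0) else s0 (''Z'', a, b))" for a b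
          using s1 s0T by (simp add: f2)
        have f3s: "?s3 (''X'', a, b) = s0 (''X'', a, b)" "?s3 (''z'', a, b) = s0 (''z'', a, b)"
          "?s3 (''S'', a, b) = s0 (''S'', a, b)" for a b
          by (rule f3; simp)+
        define x' where "x' = (\<lambda>m i. \<Sum>j<m. adj_coeff M 0 i j * (s0 (''dA'', 0, 0) * s0 (''b'', int j, 0)))"
        show "triple n W (Seq sol_prog (Seq test_prog
           (IfPos (Var ''go'') (Seq flip_prog (Set ''T'' (Plus (Var ''T'') (Const 1)))) Skip))) ?s3 ?Q"
        proof (rule triple_conseq[OF triple_sol_test_flip[where x = x' and k = k]], goal_cases)
          case (4 i m)
          \<comment> \<open>A partial numerator has at most \<open>n\<close> terms of size
            \<open>G^(n - 1) \<mu>^2\<close>; trading \<open>n \<mu>\<close> for one more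
            \<open>G\<close> gives \<open>G^n \<mu>\<close>.\<close>
          have "\<bar>x' m i\<bar> \<le> (\<Sum>j<m. \<bar>adj_coeff M 0 i j * (s0 (''dA'', 0, 0) * s0 (''b'', int j, 0))\<bar>)"
            unfolding x'_def by (rule sum_abs)
          also have "\<dots> \<le> (\<Sum>j<m. G ^ (n - 1) * (\<mu> * \<mu>))"
            unfolding abs_mult using 4 adj s0d s0b \<mu>(1) G1 by (intro sum_mono mult_mono) auto
          also have "\<dots> = int m * (G ^ (n - 1) * (\<mu> * \<mu>))" by simp
          also have "\<dots> \<le> int n * (G ^ (n - 1) * (\<mu> * \<mu>))"
            using 4 \<mu>(1) G1 by (intro mult_right_mono) auto
          also have "\<dots> = (int n * \<mu>) * (G ^ (n - 1) * \<mu>)" by simp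
          also have "\<dots> \<le> G * (G ^ (n - 1) * \<mu>)" using G1 \<mu>(1) by (intro mult_right_mono) auto
          also have "\<dots> = G ^ n * \<mu>" using n by (simp add: power_eq_if)
          finally show ?case by (rule W')
        next
          case (9 s)
          have x': "x' n i = x i" for i by (simp add: x'_def x_def)
          have f: "s l = ?s3 l" if "fst l \<notin> {''i'', ''j'', ''X'', ''go'', ''z'', ''T''}" for l
            using that by (intro 9(3)) simp
          have "s (''Z'', a, b) = ?s3 (''Z'', a, b)" "s (''D'', a, b) = ?s3 (''D'', a, b)" for a b
            by (rule f; simp)+
          then show ?case
            using 9(2) unfolding Z3 s3 x' neg_def by (simp only: s3 f3s) simp
        qed (use s0n s0T WT W1 s0z B2 in \<open>auto simp: f1 f2 x'_def intro!: sum.cong\<close>)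
      qed
    next
      case (4 i j)
      then show ?case using s0M[of i j] by (simp add: f1 split: if_splits)
    qed (use s0n \<mu>(2) W in \<open>auto simp: f1\<close>)
  qed
qed

section \<open>The complete run and its cost\<close>

definition flip_algorithm :: com where
  "flip_algorithm = Seq (Set ''go'' (Const 1)) (WhilePos (Var ''go'') iter_prog)"

context ave_int
begin

text \<open>The program inside \<open>fsteps\<close> is never run. Replacing the while loop by a
  conditional makes \<open>fsteps\<close> charge for a single pass, and the factor
  \<open>T + 2\<close> counts the \<open>T + 1\<close> passes and the final test.\<close>

lemma exec_flip_algorithm:
  assumes z0: "z0 \<in> sign_vecs n" and T: "stops_after A b z0 S T"
    and \<mu>: "1 \<le> \<mu>" "\<And>i j. i < n \<Longrightarrow> j < n \<Longrightarrow> \<bar>Abar $$ (i, j)\<bar> + dA \<le> \<mu>"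
      "\<And>i. i < n \<Longrightarrow> \<bar>bbar $ i\<bar> \<le> \<mu>" "dA \<le> \<mu>" "db \<le> \<mu>"
    and W: "\<And>v. \<bar>v\<bar> \<le> (2 * int n ^ 2 * \<mu>) ^ n * \<mu> \<Longrightarrow> bits v \<le> W"
      "bits (int (Suc T)) \<le> W"
    and s0: "bounded_store W (input_store n Abar bbar dA db z0 S)"
  shows "\<exists>t s. exec flip_algorithm (input_store n Abar bbar dA db z0 S) t s \<and>
    computes_run n A b z0 S T s \<and>
    t \<le> (T + 2) * fsteps n (Seq (Set ''go'' (Const 1)) (IfPos (Var ''go'') iter_prog Skip)) * W\<^sup>2"
proof -
  let ?s0 = "input_store n Abar bbar dA db z0 S"
  let ?z = "sign_after A b z0 S"
  note sgn = sign_after_sign_vecs[OF z0, of A b S]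
  define good where "good = (\<lambda>k s. s (''D'', int k, 0) = den (?z k) \<and>
    (\<forall>i<n. s (''Z'', int k, int i) = \<lfloor>?z k $ i\<rfloor> \<and> s (''X'', int k, int i) = num (?z k) i))"
  \<comment> \<open>There are \<open>T + 1\<close> passes: the invariant at \<open>Suc T\<close>
    describes the exit, where the counter stays at \<open>T\<close> although rows \<open>0\<close>
    to \<open>T\<close> have been recorded.\<close>
  define I where "I = (\<lambda>r s. (\<forall>l. fst l \<in> {''n'', ''dA'', ''db'', ''A'', ''b'', ''S''} \<longrightarrow> s l = ?s0 l) \<and>
    (\<forall>k<r. good k s) \<and>
    (r \<le> T \<longrightarrow> s (''go'', 0, 0) = 1 \<and> s (''T'', 0, 0) = int r \<and> (\<forall>i<n. s (''z'', int i, 0) = \<lfloor>?z r $ i\<rfloor>)) \<and>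
    (r = Suc T \<longrightarrow> s (''go'', 0, 0) = 0 \<and> s (''T'', 0, 0) = int T))"
  have bits1: "bits 1 \<le> W"
    using le_trans[OF bits_mono[of 1 "int (Suc T)"] W(2)] by simp
  have step: "0 < aval (Var ''go'') s \<and> triple n W iter_prog s (I (Suc r))"
    if r: "r < Suc T" and Ir: "I r s" for r s
  proof
    have st: "s l = ?s0 l" if "fst l \<in> {''n'', ''dA'', ''db'', ''A'', ''b'', ''S''}" for l
      using Ir that unfolding I_def by blast
    have go: "s (''go'', 0, 0) = 1" and sT: "s (''T'', 0, 0) = int r"
      and sz: "\<And>i. i < n \<Longrightarrow> s (''z'', int i, 0) = \<lfloor>?z r $ i\<rfloor>"
      using Ir r unfolding I_def by auto
    have old: "good k s" if "k < r" for k using Ir that unfolding I_def by blast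
    show "0 < aval (Var ''go'') s" using go by simp
    have sn: "s (''n'', 0, 0) = int n" "s (''dA'', 0, 0) = dA" "s (''db'', 0, 0) = db"
      by (simp_all add: st) (simp_all add: input_store_def)
    have sb: "s (''b'', int i, 0) = bbar $ i" if "i < n" for i
      using that by (simp add: st) (simp add: input_store_def)
    have sA: "s (''A'', int i, int j) = Abar $$ (i, j)" if "i < n" "j < n" for i j
      using that by (simp add: st) (simp add: input_store_def)
    have sS: "s (''S'', int k, int i) = (if i \<in> S k then 1 else 0)" if "i < n" for i k
      using that by (simp add: st) (simp add: input_store_def)
    have num: "(\<Sum>j<n. adj_coeff (shifted (?z r)) 0 i j * (s (''dA'', 0, 0) * s (''b'', int j, 0))) = num (?z r) i" for i
      unfolding num_def by (intro sum.cong) (auto simp: sn sb)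
    have den: "- (coeff (char_poly (shifted (?z r))) 0 * s (''db'', 0, 0)) = den (?z r)"
      by (simp add: den_def sn)
    have neg: "(\<exists>i<n. s (''z'', int i, 0) * num (?z r) i * den (?z r) < 0) \<longleftrightarrow> mismatch A b (?z r) \<noteq> {}"
    proof -
      have "s (''z'', int i, 0) * num (?z r) i * den (?z r) < 0 \<longleftrightarrow> ?z r $ i * x_of A b (?z r) $ i < 0"
        if i: "i < n" for i
      proof -
        have "?z r $ i * x_of A b (?z r) $ i < 0 \<longleftrightarrow>
            (of_int (s (''z'', int i, 0)) * of_int (num (?z r) i)) / of_int (den (?z r)) < (0 :: rat)"
          unfolding x_of_eq[OF sgn i] sz[OF i] floor_sign(1)[OF sgn i] by simp
        also have "\<dots> \<longleftrightarrow> of_int (s (''z'', int i, 0)) * of_int (num (?z r) i) * of_int (den (?z r)) < (0 :: rat)"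
          using den_neq_0[OF sgn] by (auto simp: divide_less_0_iff mult_less_0_iff)
        also have "\<dots> \<longleftrightarrow> s (''z'', int i, 0) * num (?z r) i * den (?z r) < 0"
          by (simp only: of_int_mult[symmetric] of_int_less_0_iff)
        finally show ?thesis by blast
      qed
      then show ?thesis using sign_vecsD(3)[OF sgn] by (auto simp: mismatch_def)
    qed
    note spec = triple_iter_prog[of "shifted (?z r)" n \<mu> W s r, unfolded num den neg, OF shifted_carrier n \<mu>(1)]
    show "triple n W iter_prog s (I (Suc r))"
    proof (rule triple_conseq[OF spec], goal_cases)
      case (1 i j)
      then show ?case using \<mu>(2) by (intro shifted_bound[OF sgn]) auto
    next
      case (2 v)
      then show ?case by (rule W(1))
    next
      case 3
      show ?case by (rule sn)
    next
      case (4 i j)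
      then show ?case by (simp add: sA sn sz shifted_def)
    next
      case 5
      show ?case by (rule sT)
    next
      case 6
      show ?case using r by (intro le_trans[OF bits_mono W(2)]) simp
    next
      case (7 i)
      then show ?case using floor_sign(2)[OF sgn] by (simp add: sz)
    next
      case 8
      then show ?case using \<mu>(4) Abar(3) by (simp add: sn)
    next
      case 9
      then show ?case using \<mu>(5) Abar(4) by (simp add: sn)
    next
      case (10 i)
      then show ?case using \<mu>(3) by (simp add: sb)
    next
      case (11 s')
      let ?V = "mismatch A b (?z r) \<noteq> {}"
      have Z: "s' (''Z'', a, b) = (if a = int r \<and> 0 \<le> b \<and> b < int n then s (''z'', b, 0) else s (''Z'', a, b))"
        and X: "s' (''X'', a, b) = (if a = int r \<and> 0 \<le> b \<and> b < int n then num (?z r) (nat b) else s (''X'', a, b))"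
        and D: "s' (''D'', a, b) = (if a = int r \<and> b = 0 then den (?z r) else s (''D'', a, b))" for a b
        using 11(2) by blast+
      have go': "s' (''go'', 0, 0) = (if ?V then 1 else 0)"
        and T': "s' (''T'', 0, 0) = (if ?V then int (Suc r) else int r)"
        and z': "\<And>i. i < n \<Longrightarrow> s' (''z'', int i, 0) =
          (if ?V \<and> s (''S'', int r, int i) > 0 then - s (''z'', int i, 0) else s (''z'', int i, 0))"
        using 11(2) by blast+
      have st': "s' l = ?s0 l" if "fst l \<in> {''n'', ''dA'', ''db'', ''A'', ''b'', ''S''}" for l
        using st[OF that] 11(3)[of l] that by auto
      have V: "?V \<longleftrightarrow> r < T" using T r unfolding stops_after_def by (cases "r = T") auto
      have "good k s'" if "k < Suc r" for k
      proof (cases "k = r")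
        case True
        then show ?thesis by (simp add: good_def Z X D sz)
      next
        case False
        then show ?thesis using old[of k] that by (simp add: good_def Z X D)
      qed
      moreover have "s' (''z'', int i, 0) = \<lfloor>?z (Suc r) $ i\<rfloor>" if rT: "r < T" and i: "i < n" for i
      proof -
        have "?z (Suc r) $ i = (if i \<in> S r then - (?z r $ i) else ?z r $ i)"
          using rT V i sign_vecsD(3)[OF sgn, of r] by (simp add: Let_def flip_def)
        moreover have "s' (''z'', int i, 0) = (if i \<in> S r then - \<lfloor>?z r $ i\<rfloor> else \<lfloor>?z r $ i\<rfloor>)"
          using rT V z'[OF i] sS[OF i] sz[OF i] by simp
        \<comment> \<open>This relies on the entry being an integer.\<close>
        moreover have "\<lfloor>- (?z r $ i)\<rfloor> = - \<lfloor>?z r $ i\<rfloor>"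
        proof -
          have "\<lfloor>- (?z r $ i)\<rfloor> = \<lfloor>of_int (- \<lfloor>?z r $ i\<rfloor>) :: rat\<rfloor>"
            by (simp only: of_int_minus floor_sign(1)[OF sgn i])
          then show ?thesis by (simp only: floor_of_int)
        qed
        ultimately show ?thesis by simp
      qed
      ultimately show ?case
        unfolding I_def using st' go' T' V r by auto
    qed
  qed
  have W2: "bits (aval (Const 1) ?s0) \<le> W" using bits1 by simp
  let ?s1 = "?s0((''go'', aval (Const 0) ?s0, aval (Const 0) ?s0) := aval (Const 1) ?s0)"
  have "I 0 ?s1"
    unfolding I_def by (auto simp: input_store_def)
  then have "triple n W (Set ''go'' (Const 1)) ?s0 (I 0)" by (intro triple_Assign W2)
  then obtain t1 s1 where 1: "exec (Set ''go'' (Const 1)) ?s0 t1 s1"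
    "t1 \<le> fsteps n (Set ''go'' (Const 1)) * W\<^sup>2" "bounded_store W s1" "I 0 s1"
    using s0 unfolding triple_def by blast
  obtain t2 s2 where 2: "exec (WhilePos (Var ''go'') iter_prog) s1 t2 s2"
    "t2 \<le> (Suc T + 1) * (asize (Var ''go'') ^ 3 + 1 + fsteps n iter_prog) * W\<^sup>2" "I (Suc T) s2"
    using exec_WhilePos[where I = I and N = "Suc T" and e = "Var ''go''" and P = iter_prog, OF 1(4,3) step]
    by (auto simp: I_def)
  have "computes_run n A b z0 S T s2"
    unfolding computes_run_def
  proof (intro conjI allI impI)
    show "s2 (''T'', 0, 0) = int T" using 2(3) by (simp add: I_def)
    fix k assume "k \<le> T"
    then have k: "good k s2" using 2(3) by (simp add: I_def)
    then show "s2 (''D'', int k, 0) \<noteq> 0" using den_neq_0[OF sgn] by (simp add: good_def)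
    fix i assume i: "i < n"
    show "of_int (s2 (''Z'', int k, int i)) = ?z k $ i"
    proof -
      have "s2 (''Z'', int k, int i) = \<lfloor>?z k $ i\<rfloor>" using k i by (simp add: good_def)
      then show ?thesis by (simp only: floor_sign(1)[OF sgn i])
    qed
    show "of_int (s2 (''X'', int k, int i)) / of_int (s2 (''D'', int k, 0)) = x_of A b (?z k) $ i"
      using k i x_of_eq[OF sgn i] by (simp add: good_def)
  qed
  moreover have "t1 + t2 \<le> (T + 2) * fsteps n (Seq (Set ''go'' (Const 1)) (IfPos (Var ''go'') iter_prog Skip)) * W\<^sup>2"
  proof -
    define f K where "f = fsteps n (Set ''go'' (Const 1))"
      and "K = asize (Var ''go'') ^ 3 + 1 + fsteps n iter_prog"
    have "Suc T + 1 = T + 2" by simp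
    then have "t1 \<le> f * W\<^sup>2" "t2 \<le> (T + 2) * K * W\<^sup>2"
      using 1(2) 2(2) unfolding f_def K_def by metis+
    then have "t1 + t2 \<le> (f + (T + 2) * K) * W\<^sup>2"
      by (simp add: add_mult_distrib)
    also have "\<dots> \<le> ((T + 2) * fsteps n (Seq (Set ''go'' (Const 1)) (IfPos (Var ''go'') iter_prog Skip))) * W\<^sup>2"
      unfolding f_def K_def by (intro mult_right_mono) (simp_all add: add_mult_distrib2)
    finally show ?thesis .
  qed
  ultimately show ?thesis
    unfolding flip_algorithm_def using exec_Seq[OF 1(1) 2(1)] by blast
qed

lemma bits_input_store:
  assumes z0: "z0 \<in> sign_vecs n"
  shows "bits (input_store n Abar bbar dA db z0 S l) \<le> input_size n Abar bbar dA db"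
proof -
  obtain x i j where l: "l = (x, i, j)" by (cases l)
  have A: "bits (Abar $$ (nat i, nat j)) \<le> (\<Sum>i<n. \<Sum>j<n. bits (Abar $$ (i, j)))"
    if "0 \<le> i" "i < int n" "0 \<le> j" "j < int n"
  proof -
    have "bits (Abar $$ (nat i, nat j)) \<le> (\<Sum>j<n. bits (Abar $$ (nat i, j)))"
      using that by (intro member_le_sum) auto
    also have "\<dots> \<le> (\<Sum>i<n. \<Sum>j<n. bits (Abar $$ (i, j)))"
      using that by (intro member_le_sum[of "nat i" _ "\<lambda>i. \<Sum>j<n. bits (Abar $$ (i, j))"]) auto
    finally show ?thesis .
  qed
  have b: "bits (bbar $ nat i) \<le> (\<Sum>i<n. bits (bbar $ i))" if "0 \<le> i" "i < int n"
    using that by (intro member_le_sum) auto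
  have z: "bits \<lfloor>z0 $ nat i\<rfloor> \<le> 2" if "0 \<le> i" "i < int n"
    using floor_sign(2)[OF z0, of "nat i"] that bits_le_iff[of "\<lfloor>z0 $ nat i\<rfloor>" 1] by simp
  have 01: "bits 0 \<le> 2" "bits 1 \<le> 2" using bits_le_iff[of 0 1] bits_le_iff[of 1 1] by simp_all
  \<comment> \<open>A stored sign takes two bits while the input size counts only one for it; the
    bits of \<open>dA\<close> and \<open>db\<close> already make up for this.\<close>
  have "2 \<le> input_size n Abar bbar dA db"
    unfolding input_size_def using bits_pos(2)[of dA] bits_pos(2)[of db] by linarith
  then show ?thesis
    using A b z 01 unfolding l input_store_def by (auto simp: input_size_def)
qed

lemma abs_less_input_size:
  defines "m \<equiv> input_size n Abar bbar dA db"
  shows "i < n \<Longrightarrow> j < n \<Longrightarrow> \<bar>Abar $$ (i, j)\<bar> + dA \<le> 2 ^ m" "i < n \<Longrightarrow> \<bar>bbar $ i\<bar> \<le> 2 ^ m"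
    "dA \<le> 2 ^ m" "db \<le> 2 ^ m" "n \<le> m"
proof -
  have pow: "\<bar>v\<bar> \<le> 2 ^ m" if "bits v \<le> m" for v
  proof -
    have "\<bar>v\<bar> < 2 ^ (bits v - 1)" by (rule abs_less_bits)
    also have "\<dots> \<le> (2 :: int) ^ m" using that by (intro power_increasing) auto
    finally show ?thesis by simp
  qed
  show "n \<le> m" by (simp add: m_def input_size_def)
  show "dA \<le> 2 ^ m" "db \<le> 2 ^ m" using pow[of dA] pow[of db] by (auto simp: m_def input_size_def)
  have b: "bits (bbar $ i) \<le> (\<Sum>i<n. bits (bbar $ i))" if "i < n" for i
    using that by (intro member_le_sum) auto
  show "i < n \<Longrightarrow> \<bar>bbar $ i\<bar> \<le> 2 ^ m"
    using b[of i] by (intro pow) (simp add: m_def input_size_def)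
  show "\<bar>Abar $$ (i, j)\<bar> + dA \<le> 2 ^ m" if "i < n" "j < n"
  proof -
    have "bits (Abar $$ (i, j)) \<le> (\<Sum>j<n. bits (Abar $$ (i, j)))"
      using that by (intro member_le_sum) auto
    also have "\<dots> \<le> (\<Sum>i<n. \<Sum>j<n. bits (Abar $$ (i, j)))"
      using that by (intro member_le_sum[of i _ "\<lambda>i. \<Sum>j<n. bits (Abar $$ (i, j))"]) auto
    finally have "bits (Abar $$ (i, j)) + bits dA \<le> m" by (simp add: m_def input_size_def)
    moreover have "\<bar>Abar $$ (i, j)\<bar> < 2 ^ (bits (Abar $$ (i, j)) - 1)" "\<bar>dA\<bar> < 2 ^ (bits dA - 1)"
      by (rule abs_less_bits)+
    \<comment> \<open>The sign bits in \<open>bits\<close> leave exponents of at most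
      \<open>m - 1\<close>, so the two summands together stay below \<open>2^m\<close>.\<close>
    moreover have "(2 :: int) ^ (bits (Abar $$ (i, j)) - 1) \<le> 2 ^ (m - 1)" "(2 :: int) ^ (bits dA - 1) \<le> 2 ^ (m - 1)"
      using \<open>bits (Abar $$ (i, j)) + bits dA \<le> m\<close> by (auto intro!: power_increasing)
    moreover have "(2 :: int) ^ (m - 1) + 2 ^ (m - 1) = 2 ^ m"
      using \<open>n \<le> m\<close> n by (cases m) auto
    ultimately show ?thesis by linarith
  qed
qed

text \<open>The recursion values need at most \<open>3 m^2 + 6 m + 4\<close> bits, and
  \<open>m \<le> m^2\<close> turns this into \<open>13 m^2\<close>. The summand \<open>T + 3\<close>
  holds the iteration counter; a bound linear in \<open>T\<close>, not logarithmic, is enough for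
  polynomial time.\<close>

lemma exec_flip_algorithm_cost:
  assumes z0: "z0 \<in> sign_vecs n" and T: "stops_after A b z0 S T"
  defines "m \<equiv> input_size n Abar bbar dA db"
  shows "\<exists>t s. exec flip_algorithm (input_store n Abar bbar dA db z0 S) t s \<and>
    computes_run n A b z0 S T s \<and>
    t \<le> (T + 2) * fsteps n (Seq (Set ''go'' (Const 1)) (IfPos (Var ''go'') iter_prog Skip)) * (13 * m\<^sup>2 + T + 3)\<^sup>2"
proof (rule exec_flip_algorithm[OF z0 T, where \<mu> = "2 ^ m"])
  note le = abs_less_input_size[folded m_def]
  show "1 \<le> (2 :: int) ^ m" by simp
  show "\<bar>Abar $$ (i, j)\<bar> + dA \<le> 2 ^ m" if "i < n" "j < n" for i j using le(1)[OF that] .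
  show "\<bar>bbar $ i\<bar> \<le> 2 ^ m" if "i < n" for i using le(2)[OF that] .
  show "dA \<le> 2 ^ m" "db \<le> 2 ^ m" using le by auto
  have m: "1 \<le> m" "m \<le> m\<^sup>2" using le(5) n by (auto simp: power2_eq_square)
  show "bounded_store (13 * m\<^sup>2 + T + 3) (input_store n Abar bbar dA db z0 S)"
    unfolding bounded_store_def
  proof
    fix l show "bits (input_store n Abar bbar dA db z0 S l) \<le> 13 * m\<^sup>2 + T + 3"
      using bits_input_store[OF z0, of S l] m unfolding m_def[symmetric] by linarith
  qed
  have "int (Suc T) < 2 ^ Suc T" using less_exp[of "Suc T"] by (metis of_nat_less_iff of_nat_numeral of_nat_power)
  then show "bits (int (Suc T)) \<le> 13 * m\<^sup>2 + T + 3"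
    using bits_le_iff[of "int (Suc T)" "Suc T"] by simp
  show "bits v \<le> 13 * m\<^sup>2 + T + 3" if "\<bar>v\<bar> \<le> (2 * int n ^ 2 * 2 ^ m) ^ n * 2 ^ m" for v
  proof -
    have bm: "bits (2 ^ m) \<le> m + 2" using bits_le_iff[of "2 ^ m" "Suc m"] by simp
    have bn: "bits (int n) \<le> m" by (simp add: m_def input_size_def)
    have b2: "bits 2 \<le> 3" using bits_le_iff[of 2 2] by simp
    have "bits (2 * int n ^ 2 * 2 ^ m) \<le> 3 * m + 5"
      using bits_mult[of "2 * int n ^ 2" "2 ^ m"] bits_mult[of 2 "int n ^ 2"] bits_mult[of "int n" "int n"] bm bn b2
      unfolding power2_eq_square by linarith
    then have "n * bits (2 * int n ^ 2 * 2 ^ m) \<le> m * (3 * m + 5)" using le(5) by (intro mult_mono) auto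
    then have "bits ((2 * int n ^ 2 * 2 ^ m) ^ n * 2 ^ m) \<le> m * (3 * m + 5) + 2 + (m + 2)"
      using bits_mult[of "(2 * int n ^ 2 * 2 ^ m) ^ n" "2 ^ m"] bits_power[of "2 * int n ^ 2 * 2 ^ m" n] bm by linarith
    also have "\<dots> = 3 * m\<^sup>2 + 6 * m + 4" by (simp add: power2_eq_square algebra_simps)
    also have "\<dots> \<le> 13 * m\<^sup>2 + T + 3" using m by linarith
    finally have "bits ((2 * int n ^ 2 * 2 ^ m) ^ n * 2 ^ m) \<le> 13 * m\<^sup>2 + T + 3" .
    moreover have "bits v \<le> bits ((2 * int n ^ 2 * 2 ^ m) ^ n * 2 ^ m)" using that by (intro bits_mono) simp
    ultimately show ?thesis by linarith
  qed
qed

end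

section \<open>Termination and running time\<close>

text \<open>The exponent collects 3 from the number of passes, \<open>k\<close> from the cost of a
  pass and 6 from the squared bit bound. The constant 16 is \<open>13 + 3\<close>.\<close>

lemma polynomial_bound:
  fixes C u :: real and n m T a k :: nat
  assumes u: "1 \<le> u" "real n \<le> u" "real m \<le> u" and C: "0 \<le> C" "real T \<le> C * u ^ 3"
  shows "real ((T + 2) * (a * (n + 1) ^ k) * (13 * m\<^sup>2 + T + 3)\<^sup>2) \<le>
    ((C + 2) * real a * 2 ^ k * (C + 16)\<^sup>2) * u ^ (9 + k)"
proof -
  have u3: "1 \<le> u ^ 3" "u ^ 2 \<le> u ^ 3" using u by (auto intro: power_increasing)
  have 1: "real (T + 2) \<le> (C + 2) * u ^ 3"
    using C u3 by (simp add: distrib_right)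
  have 2: "real (a * (n + 1) ^ k) \<le> real a * (2 * u) ^ k"
    unfolding of_nat_mult of_nat_power using u by (intro mult_left_mono power_mono) auto
  have "real m ^ 2 \<le> u ^ 2" using u by (intro power_mono) auto
  then have "real (13 * m\<^sup>2 + T + 3) \<le> (C + 16) * u ^ 3"
    using C u3 by (simp add: distrib_right)
  then have "real ((13 * m\<^sup>2 + T + 3)\<^sup>2) \<le> ((C + 16) * u ^ 3)\<^sup>2"
    unfolding of_nat_power by (intro power_mono) auto
  then have "real ((T + 2) * (a * (n + 1) ^ k) * (13 * m\<^sup>2 + T + 3)\<^sup>2) \<le>
      ((C + 2) * u ^ 3) * (real a * (2 * u) ^ k) * ((C + 16) * u ^ 3)\<^sup>2"
    unfolding of_nat_mult[of _ "(13 * m\<^sup>2 + T + 3)\<^sup>2"] of_nat_mult[of "T + 2"]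
    using 1 2 u C by (intro mult_mono) auto
  also have "\<dots> = ((C + 2) * real a * 2 ^ k * (C + 16)\<^sup>2) * (u ^ 3 * u ^ k * (u ^ 3)\<^sup>2)"
    by (simp add: power_mult_distrib)
  also have "u ^ 3 * u ^ k * (u ^ 3)\<^sup>2 = u ^ (9 + k)"
    by (simp add: power_add[symmetric] power_mult[symmetric] add.commute)
  finally show ?thesis .
qed

text \<open>As \<open>n ln N \<ge> 1/2\<close>, the term \<open>\<bar>ln \<delta>\<bar>\<close>
  costs at most twice itself times \<open>n ln N\<close>. The bound holds for the last index
  \<open>k\<close> with a mismatch; the step to \<open>T = k + 1\<close> is paid for by the final
  \<open>+ 2\<close>. Working with \<open>\<delta>\<close> instead of \<open>1 - 2 g\<close> makes
  the constant independent of the instance.\<close>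

lemma (in ave_int) terminates:
  assumes z0: "z0 \<in> sign_vecs n" and run: "capture_run \<kappa> A b z0 S" and \<kappa>: "0 < \<kappa>" "\<kappa> \<le> 1"
    and \<delta>: "0 < \<delta>" "\<delta> \<le> real_of_rat (1 - 2 * g)"
  defines "N \<equiv> real n * real_of_int (data_bound Abar bbar dA db)"
  shows "\<exists>T. stops_after A b z0 S T \<and>
    real T \<le> ((6 + 2 * \<bar>ln \<delta>\<bar>) / \<delta> + 2) * (real n / \<kappa> * ln N)"
proof -
  let ?V = "\<lambda>k. mismatch A b (sign_after A b z0 S k)"
  have "real_of_int 2 \<le> real_of_int (int n * data_bound Abar bbar dA db)"
    using n_data_bound_ge_2 by (simp only: of_int_le_iff)
  then have N2: "2 \<le> N" by (simp add: N_def)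
  have "1 / 2 \<le> ln (2 :: real)" using ln_le_minus_one[of "1 / 2 :: real"] by (simp add: ln_div)
  also have "\<dots> \<le> ln N" using N2 by simp
  finally have "1 / 2 \<le> ln N" .
  then have nN: "1 / 2 \<le> real n * ln N" using n mult_mono[of 1 "real n" "1 / 2" "ln N"] by simp
  have bound: "\<kappa> * \<delta> * real k \<le> (6 + 2 * \<bar>ln \<delta>\<bar>) * (real n * ln N)" if "\<And>j. j \<le> k \<Longrightarrow> ?V j \<noteq> {}" for k
  proof -
    let ?d = "real_of_rat (1 - 2 * g)"
    have ib: "\<kappa> * ?d * real k + ln ?d \<le> 6 * real n * ln N"
      unfolding N_def by (rule iteration_bound[OF z0 run \<kappa>]) (use that in auto)
    have "\<kappa> * \<delta> * real k \<le> \<kappa> * ?d * real k"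
      using \<kappa> \<delta> by (intro mult_right_mono mult_left_mono) auto
    also have "\<dots> \<le> 6 * real n * ln N - ln ?d"
      using ib by simp
    also have "\<dots> \<le> 6 * (real n * ln N) + \<bar>ln \<delta>\<bar> * 1"
      using \<delta> ln_mono[of \<delta> ?d] by simp
    also have "\<dots> \<le> 6 * (real n * ln N) + \<bar>ln \<delta>\<bar> * (2 * (real n * ln N))"
      using nN by (intro add_left_mono mult_left_mono) auto
    finally show ?thesis by (simp add: algebra_simps)
  qed
  have "\<exists>k. ?V k = {}"
  proof (rule ccontr)
    assume "\<nexists>k. ?V k = {}"
    then have *: "\<kappa> * \<delta> * real k \<le> (6 + 2 * \<bar>ln \<delta>\<bar>) * (real n * ln N)" for k by (intro bound) auto
    obtain k where "(6 + 2 * \<bar>ln \<delta>\<bar>) * (real n * ln N) < real k * (\<kappa> * \<delta>)"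
      using reals_Archimedean3[of "\<kappa> * \<delta>"] \<kappa> \<delta> by auto
    with *[of k] show False by (simp add: mult.commute)
  qed
  define T where "T = (LEAST k. ?V k = {})"
  have T: "?V T = {}" "\<And>k. k < T \<Longrightarrow> ?V k \<noteq> {}"
    using LeastI_ex[OF \<open>\<exists>k. ?V k = {}\<close>] not_less_Least unfolding T_def by blast+
  have "real T \<le> ((6 + 2 * \<bar>ln \<delta>\<bar>) / \<delta> + 2) * (real n / \<kappa> * ln N)"
  proof (cases T)
    case 0
    then show ?thesis using \<delta> \<kappa> N2 by simp
  next
    case (Suc k)
    have "\<kappa> * \<delta> * real k \<le> (6 + 2 * \<bar>ln \<delta>\<bar>) * (real n * ln N)"
      using T(2) Suc by (intro bound) auto
    then have "real k \<le> (6 + 2 * \<bar>ln \<delta>\<bar>) / \<delta> * (real n / \<kappa> * ln N)"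
      using \<kappa> \<delta> by (simp add: field_simps)
    moreover have "1 \<le> 2 * (real n / \<kappa> * ln N)"
    proof -
      have "1 * (real n * ln N) \<le> (1 / \<kappa>) * (real n * ln N)"
        using \<kappa> nN by (intro mult_right_mono) auto
      then show ?thesis using nN by simp
    qed
    ultimately show ?thesis unfolding Suc of_nat_Suc distrib_right by (metis add_mono add.commute)
  qed
  then show ?thesis using T unfolding stops_after_def by blast
qed

lemma (in ave_int) data_bound_le_input_size:
  "data_bound Abar bbar dA db \<le> 2 ^ input_size n Abar bbar dA db"
proof -
  let ?m = "input_size n Abar bbar dA db"
  note le = abs_less_input_size
  have "norm_inf bbar \<le> 2 ^ ?m"
    unfolding norm_inf_def using n Abar(2) le(2) by (subst Max_le_iff) (auto simp: lessThan_empty_iff)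
  moreover have "norm_max Abar \<le> 2 ^ ?m"
    unfolding norm_max_def
  proof (subst Max_le_iff)
    show "\<forall>a\<in>(\<lambda>(i, j). \<bar>Abar $$ (i, j)\<bar>) ` ({..<dim_row Abar} \<times> {..<dim_col Abar}). a \<le> 2 ^ ?m"
      using Abar(1,3) le(1) by force
  qed (use n Abar(1) in \<open>auto simp: lessThan_empty_iff\<close>)
  ultimately show ?thesis using le by (simp add: data_bound_def)
qed

lemma (in ave_int) ln_data_bound_le:
  "ln (real n * real_of_int (data_bound Abar bbar dA db)) \<le> 2 * real (input_size n Abar bbar dA db)"
proof -
  let ?m = "input_size n Abar bbar dA db" and ?L = "real_of_int (data_bound Abar bbar dA db)"
  have L1: "1 \<le> ?L" using data_bound_ge(5) by linarith
  have "?L \<le> real_of_int (2 ^ ?m)" using data_bound_le_input_size by (simp only: of_int_le_iff)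
  then have "ln ?L \<le> ln (2 ^ ?m)" using L1 by (intro ln_mono) auto
  also have "\<dots> = real ?m * ln 2" by (simp add: ln_realpow)
  also have "\<dots> \<le> real ?m * 1" using ln_2_less_1 by (intro mult_left_mono) auto
  finally have "ln ?L \<le> real ?m" by simp
  moreover have "ln (real n) \<le> real ?m"
    using ln_le_minus_one[of "real n"] n abs_less_input_size(5) by linarith
  ultimately show ?thesis using L1 n by (simp add: ln_mult)
qed

theorem theorem3p12:
  fixes \<gamma> :: real
  assumes "\<gamma> < 1 / 2"
  shows
    "\<exists>C > 0. \<exists>(P :: com) (p :: real poly).
       \<forall>(c :: nat \<Rightarrow> real) (n :: nat) (A :: rat mat) (b :: rat vec)
         (Abar :: int mat) (bbar :: int vec) (dA :: int) (db :: int)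
         (z0 :: rat vec) (S :: nat \<Rightarrow> nat set).
         (\<forall>m. 0 < c m \<and> c m \<le> 1) \<longrightarrow>
         n \<ge> 1 \<longrightarrow>
         A \<in> carrier_mat n n \<longrightarrow>
         invertible_mat A \<longrightarrow>
         real_of_rat (norm_1 (matinv A)) \<le> \<gamma> \<longrightarrow>
         b \<in> carrier_vec n \<longrightarrow>
         integer_data n A b Abar bbar dA db \<longrightarrow>
         z0 \<in> sign_vecs n \<longrightarrow>
         capture_run (c n) A b z0 S \<longrightarrow>
         (\<exists>T. stops_after A b z0 S T \<and>
              global_maximizer n A b (sign_after A b z0 S T) \<and>
              real T \<le> C * (real n / c n * ln (real n * real_of_int (data_bound Abar bbar dA db))) \<and>
              (\<exists>t s. exec P (input_store n Abar bbar dA db z0 S) t s \<and>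
                     computes_run n A b z0 S T s \<and>
                     real t \<le> poly p (real (input_size n Abar bbar dA db) + 1 / c n)))"
proof -
  define \<delta> where "\<delta> = 1 - 2 * \<gamma>"
  \<comment> \<open>Built from \<open>\<gamma>\<close> alone, hence admissible in front of the
    quantifiers over instances.\<close>
  define C where "C = (6 + 2 * \<bar>ln \<delta>\<bar>) / \<delta> + 2"
  have \<delta>: "0 < \<delta>" using assms by (simp add: \<delta>_def)
  then have C: "0 < C" by (simp add: C_def add_pos_pos)
  obtain a k where ak: "\<And>n. fsteps n (Seq (Set ''go'' (Const 1)) (IfPos (Var ''go'') iter_prog Skip)) \<le> a * (n + 1) ^ k"
    using fsteps_le by blast
  \<comment> \<open>The coefficient is that of \<open>polynomial_bound\<close> for
    \<open>2 * C\<close>; the 2 comes from \<open>ln (n L) \<le> 2 m\<close> in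
    \<open>ln_data_bound_le\<close>.\<close>
  define p where "p = monom ((2 * C + 2) * real a * 2 ^ k * (2 * C + 16)\<^sup>2) (9 + k)"
  show ?thesis
  proof (intro exI[of _ C] conjI C exI[of _ flip_algorithm] exI[of _ p] allI impI)
    fix c :: "nat \<Rightarrow> real" and n A b Abar bbar dA db z0 S
    assume c: "\<forall>m. 0 < c m \<and> c m \<le> 1" and n: "n \<ge> 1" and A: "A \<in> carrier_mat n n"
      and inv: "invertible_mat A" and \<gamma>: "real_of_rat (norm_1 (matinv A)) \<le> \<gamma>"
      and b: "b \<in> carrier_vec n" and data: "integer_data n A b Abar bbar dA db"
      and z0: "z0 \<in> sign_vecs n" and run: "capture_run (c n) A b z0 S"
    note det = invertible_mat_det[OF A inv]
    \<comment> \<open>The locale needs a rational bound while \<open>\<gamma>\<close> is real, so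
      the norm itself is used.\<close>
    let ?g = "norm_1 (matinv A)"
    have "(\<Sum>i<n. \<bar>matinv A $$ (i, 0)\<bar>) \<le> ?g"
      unfolding norm_1_def using matinv_inverse(1)[OF A det] n by (intro Max_ge) auto
    then have g0: "0 \<le> ?g" by (meson abs_ge_zero order_trans sum_nonneg)
    have "real_of_rat ?g < real_of_rat (1 / 2)" using \<gamma> assms by (simp add: of_rat_divide)
    then have g: "?g < 1 / 2" by (simp only: of_rat_less)
    interpret ave_int n A b ?g Abar bbar dA db
      by unfold_locales (use A det b g0 g data n in auto)
    have \<kappa>: "0 < c n" "c n \<le> 1" using c by auto
    have "\<delta> \<le> real_of_rat (1 - 2 * ?g)"
      using \<gamma> by (simp add: \<delta>_def of_rat_diff of_rat_mult)
    from terminates[OF z0 run \<kappa> \<delta> this] obtain T where T: "stops_after A b z0 S T"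
      and TC: "real T \<le> C * (real n / c n * ln (real n * real_of_int (data_bound Abar bbar dA db)))"
      unfolding C_def by blast
    have "global_maximizer n A b (sign_after A b z0 S T)"
      using T by (intro stop_maximizer sign_after_sign_vecs z0) (simp add: stops_after_def)
    moreover obtain t s where ts: "exec flip_algorithm (input_store n Abar bbar dA db z0 S) t s"
        "computes_run n A b z0 S T s"
      and t: "t \<le> (T + 2) * fsteps n (Seq (Set ''go'' (Const 1)) (IfPos (Var ''go'') iter_prog Skip))
        * (13 * (input_size n Abar bbar dA db)\<^sup>2 + T + 3)\<^sup>2"
      using exec_flip_algorithm_cost[OF z0 T] by blast
    moreover have "real t \<le> poly p (real (input_size n Abar bbar dA db) + 1 / c n)"
    proof -
      let ?m = "input_size n Abar bbar dA db"
      \<comment> \<open>A common upper bound for \<open>n\<close>, the input size and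
        \<open>1 / c n\<close>, and at least 1; each of the three factors in the iteration bound is
        replaced by it.\<close>
      define u where "u = real ?m + 1 / c n"
      have u: "1 / c n \<le> u" "real ?m \<le> u" "1 \<le> 1 / c n" using \<kappa> by (auto simp: u_def)
      have nm: "real n \<le> u" using abs_less_input_size(5) u by simp
      have "real n / c n * ln (real n * real_of_int (data_bound Abar bbar dA db)) \<le> real n / c n * (2 * real ?m)"
        using \<kappa> by (intro mult_left_mono ln_data_bound_le) auto
      also have "\<dots> = 2 * (real n * (1 / c n) * real ?m)" by simp
      also have "\<dots> \<le> 2 * (u * u * u)"
        using u nm \<kappa> by (intro mult_left_mono mult_mono) auto
      finally have "real T \<le> C * (2 * (u * u * u))"
        using TC C by (meson mult_left_mono less_imp_le order_trans)
      then have Tu: "real T \<le> (2 * C) * u ^ 3" by (simp add: power3_eq_cube)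
      have "t \<le> (T + 2) * (a * (n + 1) ^ k) * (13 * ?m\<^sup>2 + T + 3)\<^sup>2"
        by (rule order_trans[OF t]) (intro mult_le_mono ak order_refl)
      then have "real t \<le> real ((T + 2) * (a * (n + 1) ^ k) * (13 * ?m\<^sup>2 + T + 3)\<^sup>2)"
        by (simp only: of_nat_le_iff)
      also have "\<dots> \<le> ((2 * C + 2) * real a * 2 ^ k * (2 * C + 16)\<^sup>2) * u ^ (9 + k)"
        using u nm Tu C by (intro polynomial_bound) auto
      finally show ?thesis by (simp add: p_def poly_monom u_def)
    qed
    ultimately show "\<exists>T. stops_after A b z0 S T \<and>
              global_maximizer n A b (sign_after A b z0 S T) \<and>
              real T \<le> C * (real n / c n * ln (real n * real_of_int (data_bound Abar bbar dA db))) \<and>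
              (\<exists>t s. exec flip_algorithm (input_store n Abar bbar dA db z0 S) t s \<and>
                     computes_run n A b z0 S T s \<and>
                     real t \<le> poly p (real (input_size n Abar bbar dA db) + 1 / c n))"
      using T TC by blast
  qed
qed

end
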